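(* Let $p>2$, $f\in L^{p,2}(\mathbb{C}_+)$, $h\in\mathcal{H}_{tg}$, and $c\in\mathbb{R}$. Then the Schwarz boundary value problem $$\frac{\partial w}{\partial\bar z}=f\ \text{ in }\mathbb{C}_+,\qquad \operatorname{Re}w_b=\operatorname{Re}h_b,\qquad \operatorname{Im}w(i)=c$$ is solved by the function given, for $z=x+iy\in\mathbb{C}_+$, by $$\begin{aligned}w(z)={}&ic+\frac1\pi\langle h_b,P(x-\cdot,y)\rangle-\frac i\pi\langle\operatorname{Im}h_b,P(\cdot,1)\rangle\\&-\frac1\pi\iint_{\mathbb{C}_+}\left(f(\zeta)\left(\frac1{\zeta-z}-\frac{\zeta}{\zeta^2+1}\right)-\overline{f(\zeta)}\left(\frac1{\overline\zeta-z}-\frac{\overline\zeta}{\overline\zeta^2+1}\right)\right)d\xi\,d\eta\\={}&ic+h(z)-I+\mathcal{T}_{\mathbb{C}_+}(f)(z),\end{aligned}$$ where $\zeta=\xi+i\eta$, $P(x,y)=\frac{y}{x^2+y^2}$ is the Poisson kernel for $\mathbb{C}_+$, $I=\frac i\pi\langle\operatorname{Im}h_b,P(\cdot,1)\rangle$, and $\mathcal{T}_{\mathbb{C}_+}(f)(z)$ denotes the last term (the area integral together with its factor $-\frac1\pi$).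
   Context: $\mathbb{C}_+$ and $\mathbb{C}_-$ are the open upper and lower half-planes, $D$ is the open unit disk, $H(\mathbb{C}_+)$ is the space of holomorphic functions on $\mathbb{C}_+$, and $\mathcal{D}'(\mathbb{R})$ is the space of distributions on $\mathbb{R}$. The equation $\partial w/\partial\bar z=f$ is understood in the weak (distributional) sense. $L^{p,\nu}(\mathbb{C}_+)$ is the space of functions $f:\mathbb{C}_+\to\mathbb{C}$ such that $f\in L^p(D\cap\mathbb{C}_+)$ and $f_\nu\in L^p(D\cap\mathbb{C}_-)$, where $f_\nu(z):=\frac1{|z|^\nu}f\left(\frac1z\right)$. A function $g$ on $\mathbb{C}_+$ has a boundary value in the sense of distributions, denoted $g_b\in\mathcal{D}'(\mathbb{R})$, if for every $\varphi\in C_c^\infty(\mathbb{R})$ the limit $$\langle g_b,\varphi\rangle:=\lim_{s\searrow0}\int_{-\infty}^\infty g(t+is)\,\varphi(t)\,dt$$ exists. For a distribution $u$, $\operatorname{Re}u$ and $\operatorname{Im}u$ are the real-valued distributions with $u=\operatorname{Re}u+i\operatorname{Im}u$, i.e. $\langle\operatorname{Re}u,\varphi\rangle=\operatorname{Re}\langle u,\varphi\rangle$ and $\langle\operatorname{Im}u,\varphi\rangle=\operatorname{Im}\langle u,\varphi\rangle$ for real-valued $\varphi$. $\mathcal{H}_{tg}$ is the set of $f\in H(\mathbb{C}_+)$ with tempered growth at the boundary: there exist a constant $C$ and a positive integer $N$ such that $|f(x+iy)|\le C/y^N$ for all $x+iy\in\mathbb{C}_+$. Every $h\in\mathcal{H}_{tg}$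 has a boundary value in the sense of distributions. The pairings of $h_b$ and $\operatorname{Im}h_b$ with Poisson kernels are understood through the same limit: $\langle h_b,P(x-\cdot,y)\rangle=\lim_{s\searrow0}\int_{-\infty}^\infty h(t+is)P(x-t,y)\,dt$ and $\langle\operatorname{Im}h_b,P(\cdot,1)\rangle=\lim_{s\searrow0}\int_{-\infty}^\infty\operatorname{Im}h(t+is)P(t,1)\,dt$. *)

theory Defs
  imports "HOL-Complex_Analysis.Complex_Analysis"
begin

abbreviation Cplus :: "complex set" where
  "Cplus \<equiv> {z. 0 < Im z}"

abbreviation Cminus :: "complex set" where
  "Cminus \<equiv> {z. Im z < 0}"


section \<open>Test functions\<close>

text \<open>\<open>C_k k g\<close>: all iterated directional derivatives of \<open>g\<close> up to order \<open>k\<close> exist in the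
  real (Frechet) sense and are continuous. On \<open>complex\<close> this is real, not complex,
  differentiability.\<close>

fun C_k :: "nat \<Rightarrow> ('a::euclidean_space \<Rightarrow> 'b::real_normed_vector) \<Rightarrow> bool" where
  "C_k 0 g \<longleftrightarrow> continuous_on UNIV g"
| "C_k (Suc k) g \<longleftrightarrow>
     (\<forall>x. g differentiable (at x)) \<and> (\<forall>v. C_k k (\<lambda>x. frechet_derivative g (at x) v))"

text \<open>\<open>C_c^\<infinity>(\<Omega>)\<close>, each function being extended by zero to the whole space.\<close>

definition test_functions ::
    "'a::euclidean_space set \<Rightarrow> ('a \<Rightarrow> 'b::real_normed_vector) set" where
  "test_functions \<Omega> =
     {\<phi>. (\<forall>k. C_k k \<phi>) \<and> compact (closure {x. \<phi> x \<noteq> 0}) \<and> closure {x. \<phi> x \<noteq> 0} \<subseteq> \<Omega>}"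


section \<open>The weak Cauchy-Riemann equation\<close>

definition dbar :: "(complex \<Rightarrow> complex) \<Rightarrow> complex \<Rightarrow> complex" where
  "dbar \<phi> z = (frechet_derivative \<phi> (at z) 1 + \<i> * frechet_derivative \<phi> (at z) \<i>) / 2"

definition locally_integrable_on :: "complex set \<Rightarrow> (complex \<Rightarrow> complex) \<Rightarrow> bool" where
  "locally_integrable_on \<Omega> g \<longleftrightarrow>
     (\<forall>K. compact K \<and> K \<subseteq> \<Omega> \<longrightarrow> set_integrable lebesgue K g)"

definition weak_dbar_eq ::
    "complex set \<Rightarrow> (complex \<Rightarrow> complex) \<Rightarrow> (complex \<Rightarrow> complex) \<Rightarrow> bool" where
  "weak_dbar_eq \<Omega> w f \<longleftrightarrow>
     locally_integrable_on \<Omega> w \<and> locally_integrable_on \<Omega> f \<and>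
     (\<forall>\<phi> \<in> test_functions \<Omega>.
        (LINT z:\<Omega>|lebesgue. w z * dbar \<phi> z) = - (LINT z:\<Omega>|lebesgue. f z * \<phi> z))"


section \<open>The function spaces\<close>

definition Lp_space :: "real \<Rightarrow> complex set \<Rightarrow> (complex \<Rightarrow> complex) set" where
  "Lp_space p S =
     {g. set_borel_measurable lebesgue S g \<and>
         set_integrable lebesgue S (\<lambda>z. norm (g z) powr p)}"

definition Lp_nu_space :: "real \<Rightarrow> real \<Rightarrow> (complex \<Rightarrow> complex) set" where
  "Lp_nu_space p \<nu> =
     {f. f \<in> Lp_space p (ball 0 1 \<inter> Cplus) \<and>
         (\<lambda>z. of_real (1 / norm z powr \<nu>) * f (1 / z)) \<in> Lp_space p (ball 0 1 \<inter> Cminus)}"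

definition H_tg :: "(complex \<Rightarrow> complex) set" where
  "H_tg = {h. h holomorphic_on Cplus \<and>
              (\<exists>C::real. \<exists>N::nat. N > 0 \<and> (\<forall>z\<in>Cplus. norm (h z) \<le> C / Im z ^ N))}"


section \<open>Distributional boundary values\<close>

text \<open>The pairing \<open>lim\<^bsub>s\<searrow>0\<^esub> \<integral> g(t + is) k(t) dt\<close>. Since \<open>Lim\<close> and the Bochner integral are total,
  \<open>bv_pairing\<close> is meaningful only where \<open>bv_pairing_exists\<close> holds.\<close>

definition bv_pairing_exists :: "(complex \<Rightarrow> complex) \<Rightarrow> (real \<Rightarrow> complex) \<Rightarrow> bool" where
  "bv_pairing_exists g k \<longleftrightarrow>
     (\<forall>\<^sub>F s in at_right 0. integrable lebesgue (\<lambda>t. g (Complex t s) * k t)) \<and>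
     (\<exists>l. ((\<lambda>s. LINT t|lebesgue. g (Complex t s) * k t) \<longlongrightarrow> l) (at_right 0))"

definition bv_pairing :: "(complex \<Rightarrow> complex) \<Rightarrow> (real \<Rightarrow> complex) \<Rightarrow> complex" where
  "bv_pairing g k = Lim (at_right 0) (\<lambda>s. LINT t|lebesgue. g (Complex t s) * k t)"

text \<open>When \<open>has_distr_bv g\<close> holds, the distribution \<open>g\<^sub>b\<close> is the functional
  \<open>\<phi> \<mapsto> bv_pairing g \<phi>\<close> on test functions.\<close>

definition has_distr_bv :: "(complex \<Rightarrow> complex) \<Rightarrow> bool" where
  "has_distr_bv g \<longleftrightarrow> (\<forall>\<phi> \<in> test_functions UNIV. bv_pairing_exists g \<phi>)"

text \<open>Real part of a distribution, as a functional on real-valued test functions.\<close>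

definition distr_Re :: "((real \<Rightarrow> complex) \<Rightarrow> complex) \<Rightarrow> (real \<Rightarrow> real) \<Rightarrow> real" where
  "distr_Re u \<phi> = Re (u (\<lambda>t. complex_of_real (\<phi> t)))"


section \<open>The Schwarz problem\<close>

definition solves_schwarz ::
    "(complex \<Rightarrow> complex) \<Rightarrow> (complex \<Rightarrow> complex) \<Rightarrow> real \<Rightarrow> (complex \<Rightarrow> complex) \<Rightarrow> bool" where
  "solves_schwarz f h c w \<longleftrightarrow>
     weak_dbar_eq Cplus w f \<and>
     has_distr_bv h \<and> has_distr_bv w \<and>
     (\<forall>\<phi> \<in> test_functions UNIV. distr_Re (bv_pairing w) \<phi> = distr_Re (bv_pairing h) \<phi>) \<and>
     Im (w \<i>) = c"

definition poisson :: "real \<Rightarrow> real \<Rightarrow> real" where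
  "poisson x y = y / (x\<^sup>2 + y\<^sup>2)"

definition schwarz_integrand ::
    "(complex \<Rightarrow> complex) \<Rightarrow> complex \<Rightarrow> complex \<Rightarrow> complex" where
  "schwarz_integrand f z \<zeta> =
     f \<zeta> * (1 / (\<zeta> - z) - \<zeta> / (\<zeta>\<^sup>2 + 1)) -
     cnj (f \<zeta>) * (1 / (cnj \<zeta> - z) - cnj \<zeta> / ((cnj \<zeta>)\<^sup>2 + 1))"

definition T_Cplus :: "(complex \<Rightarrow> complex) \<Rightarrow> complex \<Rightarrow> complex" where
  "T_Cplus f z = - (1 / of_real pi) * (LINT \<zeta>:Cplus|lebesgue. schwarz_integrand f z \<zeta>)"

end

theory Submission
  imports Defs
begin

text \<open>
  For \<open>h\<close> of tempered growth the slices \<open>h(\<cdot> + is)\<close> are bounded, so the Poisson formula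
  turns the Poisson pairings into \<open>\<pi> h(z)\<close> and \<open>\<pi> Im h(i)\<close>; the distributional boundary value of
  \<open>h\<close> exists because \<open>F\<^sub>\<phi>(s) = \<integral> h(t + is) \<phi>(t) dt\<close> satisfies \<open>F\<^sub>\<phi>' = - i F\<^bsub>\<phi>'\<^esub>\<close>, so that every
  integration in \<open>s\<close> gains one power of \<open>s\<close>. The area integral is
  \<open>- (S(z) - cnj (S(cnj z))) / \<pi>\<close> with \<open>S(z) = \<integral> f(\<zeta>) (1/(\<zeta> - z) - \<zeta>/(\<zeta>\<^sup>2 + 1)) dA\<close>. Since \<open>p > 2\<close>,
  \<open>S\<close> is continuous on the whole plane, so the area term has a continuous boundary value, which is
  imaginary on the real line; Fubini and the Cauchy-Pompeiu formula for test functions give its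
  weak \<open>\<partial>/\<partial>z\<^sup>*\<close> derivative.
\<close>

section \<open>Inversion and the weighted space\<close>

text \<open>Two features of the data shape the proof. First, \<open>f\<close> is merely Lebesgue
  measurable, is unconstrained off \<open>Cplus\<close>, and its behaviour at infinity is encoded
  through the inversion z -> 1/z. All analysis is therefore done with a Borel function
  \<open>F\<close> that agrees with \<open>f\<close> almost everywhere on \<open>Cplus\<close> and
  is zero elsewhere. Under inversion, whose Jacobian is |z|^(-4), the weight 2 becomes integrability
  of |F|/|z|^2 near infinity. This matches the decay of the kernel: \<zeta>/(\<zeta>^2 + 1) is the
  mean of 1/(\<zeta> - i) and 1/(\<zeta> + i), and subtracting it leaves O(|\<zeta>|^(-2)). The same
  mean makes the kernel change sign between z = i and z = -i, which gives the normalisation Im w(i)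
  = c. Second, p > 2 means that the conjugate exponent q is below 2, so |w|^(-q) is locally
  integrable in the plane; Young's inequality with a free weight then takes the place of Hoelder's.
  The conjugated half of the integrand is S reflected across the real line; its density lives in the
  lower half-plane and is invisible to test functions on \<open>Cplus\<close>.\<close>

lemma box_complex: "box a b = {z. Re a < Re z \<and> Re z < Re b \<and> Im a < Im z \<and> Im z < Im b}"
  by (auto simp: box_def Basis_complex_def)

lemma measurable_Complex [measurable]:
  "(\<lambda>(x, y). Complex x y) \<in> borel_measurable (lborel \<Otimes>\<^sub>M lborel)"
  unfolding lborel_prod case_prod_beta Complex_eq
  by (subst measurable_lborel2) (intro borel_measurable_continuous_onI continuous_intros)

text \<open>Agreement on boxes determines \<open>lborel\<close>. This is the source of the iterated
  integrals over real and imaginary part below.\<close>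

lemma lborel_eq_distr_Complex:
  "lborel = distr (lborel \<Otimes>\<^sub>M lborel) borel (\<lambda>(x, y). Complex x y)"
proof (rule lborel_eqI)
  fix l u :: complex
  assume lu: "\<And>b. b \<in> Basis \<Longrightarrow> l \<bullet> b \<le> u \<bullet> b"
  then have le: "Re l \<le> Re u" "Im l \<le> Im u"
    using lu[of 1] lu[of \<i>] by (auto simp: Basis_complex_def)
  have "(\<lambda>(x, y). Complex x y) -` box l u = {Re l<..<Re u} \<times> {Im l<..<Im u}"
    by (auto simp: box_complex)
  then have "emeasure (distr (lborel \<Otimes>\<^sub>M lborel) borel (\<lambda>(x, y). Complex x y)) (box l u)
      = emeasure (lborel \<Otimes>\<^sub>M lborel) ({Re l<..<Re u} \<times> {Im l<..<Im u})"
    by (subst emeasure_distr) (auto simp: space_pair_measure)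
  also have "\<dots> = ennreal (Re u - Re l) * ennreal (Im u - Im l)"
    using le by (subst lborel.emeasure_pair_measure_Times) auto
  finally show "emeasure (distr (lborel \<Otimes>\<^sub>M lborel) borel (\<lambda>(x, y). Complex x y)) (box l u)
     = ennreal (\<Prod>b\<in>Basis. (u - l) \<bullet> b)"
    using le by (simp add: Basis_complex_def ennreal_mult)
qed simp

section \<open>Coordinates in \<open>real^2\<close>, the setting of the Jacobian change of
  variables\<close>

definition vec_of_complex :: "complex \<Rightarrow> real^2" where
  "vec_of_complex z = vector [Re z, Im z]"

definition complex_of_vec :: "real^2 \<Rightarrow> complex" where
  "complex_of_vec v = Complex (v$1) (v$2)"

lemma complex_of_vec_inverse [simp]: "complex_of_vec (vec_of_complex z) = z"
  by (simp add: complex_of_vec_def vec_of_complex_def)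

lemma vec_of_complex_inverse [simp]: "vec_of_complex (complex_of_vec v) = v"
  by (simp add: complex_of_vec_def vec_of_complex_def vec_eq_iff forall_2)

lemma linear_vec_of_complex: "linear vec_of_complex"
  by (rule linearI) (auto simp: vec_of_complex_def vec_eq_iff forall_2)

lemma linear_complex_of_vec: "linear complex_of_vec"
  by (rule linearI) (auto simp: complex_of_vec_def complex_eq_iff)

lemmas bounded_linear_vec_of_complex = linear_vec_of_complex[THEN linear_conv_bounded_linear[THEN iffD1]]
lemmas bounded_linear_complex_of_vec = linear_complex_of_vec[THEN linear_conv_bounded_linear[THEN iffD1]]

lemma measurable_complex_of_vec: "complex_of_vec \<in> borel_measurable borel"
  by (intro borel_measurable_continuous_onI linear_continuous_on bounded_linear_complex_of_vec)

lemma measurable_vec_of_complex: "vec_of_complex \<in> borel_measurable borel"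
  by (intro borel_measurable_continuous_onI linear_continuous_on bounded_linear_vec_of_complex)

lemma lborel_eq_distr_complex_of_vec: "lborel = distr lborel borel complex_of_vec"
proof (rule lborel_eqI)
  fix l u :: complex
  assume lu: "\<And>b. b \<in> Basis \<Longrightarrow> l \<bullet> b \<le> u \<bullet> b"
  then have le: "Re l \<le> Re u" "Im l \<le> Im u"
    using lu[of 1] lu[of \<i>] by (auto simp: Basis_complex_def)
  have B: "(Basis :: (real^2) set) = {axis 1 1, axis 2 1}"
    by (auto simp: Basis_vec_def UNIV_2)
  have "complex_of_vec -` box l u = box (vec_of_complex l) (vec_of_complex u)"
    by (auto simp: box_complex complex_of_vec_def vec_of_complex_def mem_box_cart forall_2)
  then have "emeasure (distr lborel borel complex_of_vec) (box l u)
      = emeasure lborel (box (vec_of_complex l) (vec_of_complex u))"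
    using measurable_complex_of_vec by (subst emeasure_distr) auto
  also have "\<dots> = ennreal (\<Prod>b\<in>Basis. (vec_of_complex u - vec_of_complex l) \<bullet> b)"
    using le by (subst emeasure_lborel_box) 
       (auto simp: B vec_of_complex_def inner_axis)
  also have "(\<Prod>b\<in>Basis. (vec_of_complex u - vec_of_complex l) \<bullet> b) = (\<Prod>b\<in>Basis. (u - l) \<bullet> b)"
    by (simp add: B Basis_complex_def vec_of_complex_def inner_axis axis_eq_axis)
  finally show "emeasure (distr lborel borel complex_of_vec) (box l u)
     = ennreal (\<Prod>b\<in>Basis. (u - l) \<bullet> b)" .
qed simp

lemma lborel_eq_distr_vec_of_complex: "lborel = distr lborel borel vec_of_complex"
proof -
  have "distr lborel borel vec_of_complex = distr (distr lborel borel complex_of_vec) borel vec_of_complex"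
    using lborel_eq_distr_complex_of_vec by simp
  also have "\<dots> = distr lborel borel (\<lambda>v. v)"
    using measurable_complex_of_vec measurable_vec_of_complex
    by (subst distr_distr) (auto simp: o_def)
  also have "\<dots> = lborel"
    by (rule distr_id2) simp
  finally show ?thesis by simp
qed

text \<open>A measure-preserving Borel map stays measure preserving for the completed measures,
  since preimages of null sets are null.\<close>

lemma distr_lebesgue_of_lborel:
  fixes T :: "'a::euclidean_space \<Rightarrow> 'b::euclidean_space"
  assumes [measurable]: "T \<in> borel_measurable borel" and distr: "lborel = distr lborel borel T"
  shows "T \<in> lebesgue \<rightarrow>\<^sub>M lebesgue" "distr lebesgue lebesgue T = lebesgue"
proof -
  have m: "T \<in> lebesgue \<rightarrow>\<^sub>M lborel"
    using assms(1) by (auto intro: measurable_completion)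
  have "distr lebesgue lborel T = distr lborel lborel T"
    by (rule distr_completion) simp
  also have "\<dots> = lborel"
    by (subst (2) distr) (rule distr_cong, auto)
  finally have eq: "distr lebesgue lborel T = lborel" .
  show "distr lebesgue lebesgue T = lebesgue"
    using completion.completion_distr_eq[OF m] by (simp add: eq)
  show "T \<in> lebesgue \<rightarrow>\<^sub>M lebesgue"
    by (rule completion.measurable_completion2[OF m]) (simp add: eq)
qed

lemma integrable_lebesgue_compose:
  fixes T :: "'a::euclidean_space \<Rightarrow> 'b::euclidean_space"
    and f :: "'b \<Rightarrow> 'c::{banach, second_countable_topology}"
  assumes "T \<in> borel_measurable borel" "lborel = distr lborel borel T" "integrable lebesgue f"
  shows "integrable lebesgue (\<lambda>x. f (T x))"
  using distr_lebesgue_of_lborel[OF assms(1,2)] assms(3) integrable_distr by metis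

lemma absolutely_integrable_on_complex_iff:
  fixes f :: "complex \<Rightarrow> 'c::euclidean_space"
  shows "(\<lambda>v. f (complex_of_vec v)) absolutely_integrable_on (vec_of_complex ` S)
           \<longleftrightarrow> f absolutely_integrable_on S"
proof -
  have *: "v \<in> vec_of_complex ` S \<longleftrightarrow> complex_of_vec v \<in> S" for v
    by (metis complex_of_vec_inverse image_iff vec_of_complex_inverse)
  show ?thesis
    unfolding set_integrable_def indicator_def of_bool_def *
    using integrable_lebesgue_compose[OF measurable_complex_of_vec lborel_eq_distr_complex_of_vec,
         of "\<lambda>x. (if x \<in> S then 1 else 0) *\<^sub>R f x"]
      integrable_lebesgue_compose[OF measurable_vec_of_complex lborel_eq_distr_vec_of_complex,
         of "\<lambda>v. (if complex_of_vec v \<in> S then 1 else 0) *\<^sub>R f (complex_of_vec v)"]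
    by auto
qed

lemma sets_lebesgue_vec_of_complex:
  assumes "S \<in> sets lebesgue"
  shows "vec_of_complex ` S \<in> sets lebesgue"
proof -
  have "vec_of_complex ` S = complex_of_vec -` S \<inter> space lebesgue"
    by (auto simp: image_iff) (metis vec_of_complex_inverse)
  then show ?thesis
    using measurable_sets[OF distr_lebesgue_of_lborel(1)[OF measurable_complex_of_vec lborel_eq_distr_complex_of_vec] assms]
    by simp
qed

text \<open>Inversion has complex derivative -1/z^2; as a real linear map this has determinant
  |1/z^2|^2, whence the fourth power.\<close>

lemma absolutely_integrable_compose_inverse:
  fixes f :: "complex \<Rightarrow> real"
  assumes S: "S \<in> sets lebesgue" and 0: "0 \<notin> S"
    and f: "f absolutely_integrable_on (inverse ` S)"
  shows "(\<lambda>z. f (inverse z) / norm z ^ 4) absolutely_integrable_on S"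
proof -
  define g where "g = (\<lambda>v. vec_of_complex (inverse (complex_of_vec v)))"
  define g' where "g' = (\<lambda>v h. vec_of_complex (- (inverse (complex_of_vec v) * inverse (complex_of_vec v) * complex_of_vec h)))"
  have Sv: "vec_of_complex ` S \<in> sets lebesgue"
    by (rule sets_lebesgue_vec_of_complex[OF S])
  have inS: "complex_of_vec v \<in> S" if "v \<in> vec_of_complex ` S" for v
    using that by auto
  have der: "(g has_derivative g' v) (at v within vec_of_complex ` S)" if "v \<in> vec_of_complex ` S" for v
  proof -
    have "complex_of_vec v \<noteq> 0" using inS[OF that] 0 by metis
    then show ?thesis unfolding g_def g'_def
      by (auto intro!: bounded_linear.has_derivative[OF bounded_linear_vec_of_complex]
        bounded_linear_imp_has_derivative[OF bounded_linear_complex_of_vec] derivative_eq_intros)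
  qed
  have inj: "inj_on g (vec_of_complex ` S)"
    by (auto simp: inj_on_def g_def dest!: arg_cong[where f=complex_of_vec])
  \<comment> \<open>Multiplication by \<open>a\<close> has the matrix with rows (Re a, -Im a) and
    (Im a, Re a), so its determinant is |a|^2.\<close>
  have det: "\<bar>det (matrix (g' v))\<bar> = 1 / norm (complex_of_vec v) ^ 4" for v
  proof -
    define a where "a = - (inverse (complex_of_vec v))\<^sup>2"
    have "g' v h = vec_of_complex (a * complex_of_vec h)" for h
      by (simp add: g'_def a_def power2_eq_square)
    then have "det (matrix (g' v)) = (Re a)\<^sup>2 + (Im a)\<^sup>2"
      unfolding det_2 matrix_def
      by (simp add: vec_of_complex_def complex_of_vec_def axis_def power2_eq_square)
    also have "\<dots> = (norm a)\<^sup>2" by (simp add: cmod_power2)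
    also have "\<dots> = 1 / norm (complex_of_vec v) ^ 4"
      by (simp add: a_def norm_power norm_divide power_divide power_inverse norm_inverse divide_inverse flip: power_mult)
    finally show ?thesis by simp
  qed
  have gS: "g ` vec_of_complex ` S = vec_of_complex ` inverse ` S"
    by (auto simp: g_def image_image)
  \<comment> \<open>The change of variables takes its values in a space of real vectors;
    \<open>real^1\<close> stands for the real line.\<close>
  let ?F = "\<lambda>v. vec (f (complex_of_vec v)) :: real^1"
  have "?F absolutely_integrable_on (g ` vec_of_complex ` S)"
    using f unfolding absolutely_integrable_on_1_iff gS
    by (simp add: absolutely_integrable_on_complex_iff)
  then have "(\<lambda>v. \<bar>det (matrix (g' v))\<bar> *\<^sub>R ?F (g v)) absolutely_integrable_on vec_of_complex ` S"
    using absolutely_integrable_change_of_variables[OF Sv der inj, where f="?F"] by simp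
  then have "(\<lambda>v. f (inverse (complex_of_vec v)) / norm (complex_of_vec v) ^ 4) absolutely_integrable_on vec_of_complex ` S"
    unfolding absolutely_integrable_on_1_iff det by (simp add: g_def)
  then show ?thesis
    using absolutely_integrable_on_complex_iff[where f="\<lambda>z. f (inverse z) / norm z ^ 4" and S=S] by simp
qed

section \<open>Borel representatives and integrability in the weighted space\<close>

lemma completion_ex_borel_measurable_complex:
  fixes g :: "'a \<Rightarrow> complex"
  assumes g: "g \<in> borel_measurable (completion M)"
  shows "\<exists>g'\<in>borel_measurable M. (AE x in M. g x = g' x)"
proof -
  have "(\<lambda>x. Re (g x)) \<in> borel_measurable (completion M)" "(\<lambda>x. Im (g x)) \<in> borel_measurable (completion M)"
    using g by measurable
  from this[THEN completion_ex_borel_measurable_real]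
  obtain a b where [measurable]: "a \<in> borel_measurable M" "b \<in> borel_measurable M"
    and ae: "AE x in M. Re (g x) = a x" "AE x in M. Im (g x) = b x" by auto
  show ?thesis
  proof
    show "(\<lambda>x. complex_of_real (a x) + \<i> * complex_of_real (b x)) \<in> borel_measurable M" by measurable
    show "AE x in M. g x = complex_of_real (a x) + \<i> * complex_of_real (b x)"
      using ae by eventually_elim (auto simp: complex_eq_iff)
  qed
qed

lemma negligible_imp_AE_not_in: "negligible S \<Longrightarrow> AE x in lebesgue. x \<notin> S"
  by (rule AE_not_in) (simp add: negligible_iff_null_sets)

lemma le_one_plus_powr:
  fixes x p :: real assumes "0 \<le> x" "1 \<le> p" shows "x \<le> 1 + x powr p"
proof (cases "x \<le> 1")
  case False
  then have "x powr 1 \<le> x powr p" using assms by (intro powr_mono) auto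
  then show ?thesis using False by simp
qed (use assms in \<open>auto simp: add_increasing2\<close>)

text \<open>Domination of |g| by 1 + |g|^p stands in for Hoelder's inequality on a set of finite
  measure.\<close>

lemma Lp_space_imp_set_integrable:
  assumes g: "g \<in> Lp_space p S" and p: "p \<ge> 1" and S: "S \<in> lmeasurable"
  shows "set_integrable lebesgue S g"
  unfolding set_integrable_def
proof (rule Bochner_Integration.integrable_bound)
  have "integrable lebesgue (indicat_real S)" 
    using S by (intro integrable_real_indicator) (auto simp: fmeasurable_def)
  then show "integrable lebesgue (\<lambda>z. indicator S z + indicator S z *\<^sub>R norm (g z) powr p)"
    using g unfolding Lp_space_def set_integrable_def by (intro Bochner_Integration.integrable_add) auto
  show "(\<lambda>z. indicator S z *\<^sub>R g z) \<in> borel_measurable lebesgue"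
    using g by (auto simp: Lp_space_def set_borel_measurable_def)
  show "AE z in lebesgue. norm (indicator S z *\<^sub>R g z) \<le> norm (indicator S z + indicator S z *\<^sub>R norm (g z) powr p)"
    using le_one_plus_powr[OF norm_ge_zero p] by (auto simp: indicator_def)
qed

text \<open>Passage from \<open>f\<close> to data fit for Fubini. The inverted function lies in L^p,
  hence in L^1, of the lower half disc; the Jacobian |z|^(-4) against the factor |z|^2 leaves
  |f|/|z|^2 outside the disc. Values on the unit circle, which neither condition of
  \<open>Lp_nu_space\<close> controls, form a null set.\<close>

lemma Lp_nu_space_borel_version:
  assumes p: "p > 2" and f: "f \<in> Lp_nu_space p 2"
  obtains F where "F \<in> borel_measurable lborel" "AE z in lebesgue. z \<in> Cplus \<longrightarrow> F z = f z"
    "\<And>z. z \<notin> Cplus \<Longrightarrow> F z = 0"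
    "integrable lborel (\<lambda>z. norm (F z) powr p)"
    "integrable lborel (\<lambda>z. indicator {z. 1 < norm z} z * (norm (F z) / norm z ^ 2))"
proof -
  define B S where "B = ball 0 1 \<inter> Cplus" and "S = {z. 0 < Im z \<and> 1 < norm z}"
  define G where "G = (\<lambda>z. complex_of_real (1 / norm z powr 2) * f (1 / z))"
  have oS: "open S" "open B" "open Cplus" "open Cminus"
    unfolding S_def B_def
    by (auto intro!: open_Collect_conj open_Collect_less continuous_intros open_halfspace_Im_gt open_halfspace_Im_lt)
  then have [measurable]: "S \<in> sets lebesgue" "B \<in> sets lebesgue" "Cplus \<in> sets lebesgue"
    "S \<in> sets borel" "B \<in> sets borel" "Cplus \<in> sets borel"
    by (auto intro: lborelD)
  have S0: "0 \<notin> S" by (auto simp: S_def)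
  have invS: "inverse ` S = ball 0 1 \<inter> Cminus"
  proof (intro equalityI subsetI)
    fix z assume z: "z \<in> ball 0 1 \<inter> Cminus"
    then have "z \<noteq> 0" by auto
    with z have "inverse z \<in> S"
      by (auto simp: S_def norm_inverse one_less_inverse_iff divide_neg_pos sum_power2_gt_zero_iff 
          complex_eq_iff divide_less_0_iff)
    then show "z \<in> inverse ` S" by (metis image_eqI inverse_inverse_eq)
  qed (auto simp: S_def norm_inverse inverse_less_1_iff divide_neg_pos sum_power2_gt_zero_iff)
  have lm: "ball 0 1 \<inter> Cminus \<in> lmeasurable"
    using oS by (intro bounded_set_imp_lmeasurable) (auto intro!: bounded_Int lborelD)
  have GLp: "G \<in> Lp_space p (inverse ` S)" and fLp: "f \<in> Lp_space p B"
    using f unfolding Lp_nu_space_def invS G_def B_def by auto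
  have G1: "set_integrable lebesgue (inverse ` S) G"
    using Lp_space_imp_set_integrable[OF GLp] lm invS p by simp
  have Gp: "set_integrable lebesgue (inverse ` S) (\<lambda>z. norm (G z) powr p)"
    using GLp by (simp add: Lp_space_def)
  have Ginv: "G (inverse z) = of_real (norm z ^ 2) * f z" if "z \<in> S" for z
  proof -
    have "z \<noteq> 0" using that S0 by auto
    then have "1 / norm (inverse z) powr 2 = norm z ^ 2"
      by (subst powr_numeral) (auto simp: norm_inverse power_inverse divide_inverse)
    then show ?thesis by (simp only: G_def) (simp add: divide_inverse)
  qed
  have eq4: "x * (y\<^sup>2 :: real) / y ^ 4 = x / y\<^sup>2" for x y
    by (cases "y = 0") (auto simp: field_simps power2_eq_square numeral_eq_Suc)
  \<comment> \<open>\<open>absolutely_integrable_compose_inverse\<close> handles real functions, so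
    real and imaginary parts are transformed separately.\<close>
  have "(\<lambda>z. Re (G (inverse z)) / norm z ^ 4) absolutely_integrable_on S"
    using G1 S0 by (intro absolutely_integrable_compose_inverse) (auto intro: absolutely_integrable_linear[OF G1 bounded_linear_Re, unfolded o_def])
  then have re: "(\<lambda>z. Re (f z) / norm z ^ 2) absolutely_integrable_on S"
    by (rule set_integrable_cong[OF refl refl, THEN iffD1, rotated]) (auto simp: Ginv eq4 mult.commute[of "_\<^sup>2"])
  have "(\<lambda>z. Im (G (inverse z)) / norm z ^ 4) absolutely_integrable_on S"
    using G1 S0 by (intro absolutely_integrable_compose_inverse) (auto intro: absolutely_integrable_linear[OF G1 bounded_linear_Im, unfolded o_def])
  then have im: "(\<lambda>z. Im (f z) / norm z ^ 2) absolutely_integrable_on S"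
    by (rule set_integrable_cong[OF refl refl, THEN iffD1, rotated]) (auto simp: Ginv eq4 mult.commute[of "_\<^sup>2"])
  have "integrable lebesgue (\<lambda>z. of_real (indicator S z *\<^sub>R (Re (f z) / norm z ^ 2))
     + \<i> * of_real (indicator S z *\<^sub>R (Im (f z) / norm z ^ 2)))"
    using re im unfolding set_integrable_def
    by (intro Bochner_Integration.integrable_add integrable_mult_right integrable_of_real) auto
  then have f2: "integrable lebesgue (\<lambda>z. indicator S z *\<^sub>R (f z / of_real (norm z ^ 2)))"
    by (rule Bochner_Integration.integrable_cong[OF refl, THEN iffD1, rotated]) (auto simp: complex_eq_iff indicator_def)
  \<comment> \<open>Measurability of \<open>f\<close> on \<open>S\<close> is given only after
    inversion; it is recovered from the integrability of f/|z|^2 just obtained.\<close>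
  have [measurable]: "(\<lambda>z. indicator S z *\<^sub>R f z) \<in> borel_measurable lebesgue"
  proof (rule measurable_cong[THEN iffD1])
    show "(\<lambda>z. of_real (norm z ^ 2) * (indicator S z *\<^sub>R (f z / of_real (norm z ^ 2)))) \<in> borel_measurable lebesgue"
      by (rule borel_measurable_times[OF measurable_completion borel_measurable_integrable[OF f2]]) auto
  qed (use S0 in \<open>auto simp: indicator_def\<close>)
  have [measurable]: "(\<lambda>z. indicator B z *\<^sub>R f z) \<in> borel_measurable lebesgue"
    using fLp by (auto simp: Lp_space_def set_borel_measurable_def)
  define u where "u = (\<lambda>z. indicator B z *\<^sub>R f z + indicator S z *\<^sub>R f z)"
  have "u \<in> borel_measurable lebesgue" unfolding u_def by measurable
  then obtain F0 where [measurable]: "F0 \<in> borel_measurable lborel" and F0: "AE z in lborel. u z = F0 z"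
    using completion_ex_borel_measurable_complex by blast
  define F where "F = (\<lambda>z. indicator Cplus z *\<^sub>R F0 z)"
  have [measurable]: "F \<in> borel_measurable lborel" unfolding F_def by measurable
  have aeu: "AE z in lebesgue. F z = u z"
    using AE_completion[OF F0] by eventually_elim (auto simp: F_def u_def B_def S_def indicator_def)
  have "negligible (sphere 0 1 :: complex set)" by (rule negligible_sphere)
  then have "AE z::complex in lebesgue. z \<notin> sphere 0 1"
    by (rule negligible_imp_AE_not_in)
  with aeu have ae: "AE z in lebesgue. z \<in> Cplus \<longrightarrow> F z = f z"
    by eventually_elim (auto simp: u_def B_def S_def indicator_def)
  have fp: "integrable lebesgue (\<lambda>z. indicator S z *\<^sub>R norm (f z) powr p)"
  proof (rule Bochner_Integration.integrable_bound)
    show "integrable lebesgue (\<lambda>z. indicator S z *\<^sub>R (norm (G (inverse z)) powr p / norm z ^ 4))"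
      using absolutely_integrable_compose_inverse[OF _ S0 Gp] unfolding set_integrable_def by simp
    have "(\<lambda>z. indicator S z *\<^sub>R norm (indicator S z *\<^sub>R f z) powr p) \<in> borel_measurable lebesgue" by measurable
    then show "(\<lambda>z. indicator S z *\<^sub>R norm (f z) powr p) \<in> borel_measurable lebesgue"
      by (rule measurable_cong[THEN iffD1, rotated]) (auto simp: indicator_def)
    \<comment> \<open>The Jacobian costs |z|^(-4) and the weight gains |z|^(2p); since p > 2 and |z|
      > 1 the net factor is at least 1.\<close>
    have "norm (f z) powr p \<le> norm (G (inverse z)) powr p / norm z ^ 4" if "z \<in> S" for z
    proof -
      have 1: "1 < norm z" using that by (simp add: S_def)
      have "norm z powr 4 \<le> norm z powr (2 * p)" using 1 p by (intro powr_mono) auto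
      then have "1 \<le> norm z powr (2 * p) / norm z ^ 4"
        using 1 zero_less_power[of "norm z" 4] by (subst le_divide_eq_1_pos) (auto simp: powr_numeral)
      moreover have "norm (G (inverse z)) powr p = norm z powr (2 * p) * norm (f z) powr p"
      proof -
        have "norm (G (inverse z)) = norm z powr 2 * norm (f z)"
          using 1 by (simp add: Ginv[OF that] norm_mult norm_power powr_numeral)
        then show ?thesis by (simp only: powr_mult powr_powr norm_ge_zero powr_ge_zero)
      qed
      ultimately show ?thesis
        using mult_right_mono[of 1 "norm z powr (2 * p) / norm z ^ 4" "norm (f z) powr p"] by simp
    qed
    then show "AE z in lebesgue. norm (indicator S z *\<^sub>R norm (f z) powr p)
        \<le> norm (indicator S z *\<^sub>R (norm (G (inverse z)) powr p / norm z ^ 4))"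
      by (auto simp: indicator_def)
  qed
  have "integrable lebesgue (\<lambda>z. indicator B z *\<^sub>R norm (f z) powr p + indicator S z *\<^sub>R norm (f z) powr p)"
    using fp fLp unfolding Lp_space_def set_integrable_def by auto
  then have "integrable lebesgue (\<lambda>z. norm (u z) powr p)"
    by (rule Bochner_Integration.integrable_cong[OF refl, THEN iffD1, rotated]) (auto simp: u_def indicator_def B_def S_def)
  then have "integrable lebesgue (\<lambda>z. norm (F z) powr p)"
  proof (rule integrable_cong_AE_imp)
    show "(\<lambda>z. norm (F z) powr p) \<in> borel_measurable lebesgue"
      by (intro measurable_completion) measurable
    show "AE z in lebesgue. norm (u z) powr p = norm (F z) powr p"
      using aeu by eventually_elim simp
  qed
  then have 4: "integrable lborel (\<lambda>z. norm (F z) powr p)"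
    by (subst (asm) integrable_completion) auto
  have "integrable lebesgue (\<lambda>z. norm (indicator S z *\<^sub>R (f z / of_real (norm z ^ 2))))"
    using f2 by (rule integrable_norm)
  then have "integrable lebesgue (\<lambda>z. indicator {z. 1 < norm z} z * (norm (F z) / norm z ^ 2))"
  proof (rule integrable_cong_AE_imp)
    show "(\<lambda>z. indicator {z. 1 < cmod z} z * (cmod (F z) / (cmod z)\<^sup>2)) \<in> borel_measurable lebesgue"
      by (intro measurable_completion) measurable
    show "AE z in lebesgue. norm (indicator S z *\<^sub>R (f z / of_real (norm z ^ 2))) = indicator {z. 1 < norm z} z * (norm (F z) / norm z ^ 2)"
      using ae by eventually_elim (auto simp: indicator_def S_def F_def norm_divide norm_power)
  qed
  then have "integrable lborel (\<lambda>z. indicator {z. 1 < norm z} z * (norm (F z) / norm z ^ 2))"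
    by (subst (asm) integrable_completion) measurable
  then show ?thesis
    using that[of F] ae 4 by (auto simp: F_def)
qed

section \<open>Cauchy transforms of compactly supported functions in Lp\<close>

lemma integrable_lborel_translate_iff:
  fixes f :: "'a::euclidean_space \<Rightarrow> 'b::{banach, second_countable_topology}"
  assumes [measurable]: "f \<in> borel_measurable borel"
  shows "integrable lborel (\<lambda>x. f (c + x)) \<longleftrightarrow> integrable lborel f"
  using integrable_distr_eq[of "(+) c" lborel borel f] by (simp add: lborel_distr_plus)

lemma integral_lborel_translate:
  fixes f :: "'a::euclidean_space \<Rightarrow> 'b::{banach, second_countable_topology}"
  assumes [measurable]: "f \<in> borel_measurable borel"
  shows "(\<integral>x. f (c + x) \<partial>lborel) = (\<integral>x. f x \<partial>lborel)"
  using integral_distr[of "(+) c" lborel borel f] by (simp add: lborel_distr_plus)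

text \<open>The power left over when Young's inequality meets the Cauchy kernel, with
  \<open>q\<close> the conjugate exponent. At the origin the convention \<open>0 powr _ = 0\<close>
  gives the value 0.\<close>

definition sing_ball :: "real \<Rightarrow> real \<Rightarrow> complex \<Rightarrow> real" where
  "sing_ball q \<delta> w = indicator (ball 0 \<delta>) w * norm w powr (-q)"

lemma sing_ball_measurable [measurable]: "sing_ball q \<delta> \<in> borel_measurable borel"
  unfolding sing_ball_def[abs_def]
  by (rule borel_measurable_times) (rule borel_measurable_indicator, simp, measurable)

lemma sing_ball_nonneg: "sing_ball q \<delta> w \<ge> 0"
  by (simp add: sing_ball_def)

lemma nn_integral_abs_powr_finite:
  fixes a :: real assumes a: "a > -1"
  shows "(\<integral>\<^sup>+x. ennreal (indicator {-1..1} x * \<bar>x\<bar> powr a) \<partial>lborel) < \<infinity>"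
proof -
  have "(\<lambda>x::real. x powr a) integrable_on {0..1}"
    using has_integral_powr_from_0[OF a, of 1] by (auto simp: integrable_on_def)
  then have 1: "(\<lambda>x::real. x powr a) absolutely_integrable_on {0..1}"
    by (rule nonnegative_absolutely_integrable_1) auto
  then have "(\<lambda>x::real. (-x) powr a) absolutely_integrable_on {-1..-0}"
    by (subst absolutely_integrable_reflect_real)
  then have "(\<lambda>x::real. (-x) powr a) absolutely_integrable_on {-1..0}" by simp
  then have 2: "(\<lambda>x::real. \<bar>x\<bar> powr a) absolutely_integrable_on {-1..0}"
    by (rule set_integrable_cong[OF refl refl, THEN iffD1, rotated]) auto
  have "(\<lambda>x::real. \<bar>x\<bar> powr a) absolutely_integrable_on {0..1}"
    using 1 by (rule set_integrable_cong[OF refl refl, THEN iffD1, rotated]) auto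
  with 2 have "(\<lambda>x::real. \<bar>x\<bar> powr a) absolutely_integrable_on {-1..0} \<union> {0..1}"
    by (rule absolutely_integrable_Un)
  moreover have "{-1..0} \<union> {0..1} = {-1..1::real}" by auto
  ultimately have "integrable lborel (\<lambda>x::real. indicator {-1..1} x * \<bar>x\<bar> powr a)"
    unfolding set_integrable_def by (subst (asm) integrable_completion) auto
  then show ?thesis
    by (simp add: integrable_iff_bounded)
qed

text \<open>Since \<open>\<bar>w\<bar>\<^sup>2 \<ge> \<bar>Re w\<bar> \<bar>Im w\<bar>\<close>, the singularity is dominated by a product of one-dimensional
  integrable functions.\<close>

lemma integrable_sing_ball_1:
  assumes q: "0 < q" "q < 2"
  shows "integrable lborel (sing_ball q 1)"
proof -
  define g :: "real \<Rightarrow> real" where "g = (\<lambda>x. indicator {-1..1} x * \<bar>x\<bar> powr (-q/2))"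
  have [measurable]: "g \<in> borel_measurable borel" unfolding g_def by measurable
  have g0: "g x \<ge> 0" for x by (simp add: g_def)
  \<comment> \<open>This is where q < 2 matters: the exponent -q/2 then exceeds -1.\<close>
  have fin: "(\<integral>\<^sup>+x. ennreal (g x) \<partial>lborel) < \<infinity>"
    unfolding g_def using q by (intro nn_integral_abs_powr_finite) simp
  \<comment> \<open>The axes are excluded: there one factor is \<open>0 powr _\<close>, that is 0,
    and the bound breaks down. They are null sets.\<close>
  have bound: "sing_ball q 1 w \<le> g (Re w) * g (Im w)" if "Re w \<noteq> 0" "Im w \<noteq> 0" for w
  proof (cases "norm w < 1")
    case True
    have le: "\<bar>Re w\<bar> \<le> 1" "\<bar>Im w\<bar> \<le> 1"
      using abs_Re_le_cmod[of w] abs_Im_le_cmod[of w] True by linarith+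
    have "\<bar>Re w\<bar> * \<bar>Im w\<bar> \<le> norm w * norm w"
      by (intro mult_mono abs_Re_le_cmod abs_Im_le_cmod) auto
    then have "(norm w * norm w) powr (-q/2) \<le> (\<bar>Re w\<bar> * \<bar>Im w\<bar>) powr (-q/2)"
      using q that by (intro powr_mono2') auto
    moreover have "(norm w * norm w) powr (-q/2) = norm w powr (-q)"
      by (auto simp: powr_mult simp flip: powr_add)
    ultimately show ?thesis using le True
      by (auto simp: sing_ball_def g_def powr_mult abs_le_iff)
  qed (use g0 in \<open>auto simp: sing_ball_def\<close>)
  have "negligible {w::complex. w \<bullet> 1 = 0}"
    by (rule negligible_standard_hyperplane) (simp add: Basis_complex_def)
  moreover have "negligible {w::complex. w \<bullet> \<i> = 0}"
    by (rule negligible_standard_hyperplane) (simp add: Basis_complex_def)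
  ultimately have "negligible {w. Re w = 0}" "negligible {w. Im w = 0}" by simp_all
  then have "AE w in lebesgue. w \<notin> {w. Re w = 0}" "AE w in lebesgue. w \<notin> {w. Im w = 0}"
    by (auto dest!: negligible_imp_AE_not_in)
  then have "AE w in lebesgue. Re w \<noteq> 0 \<and> Im w \<noteq> 0" by eventually_elim auto
  then have ae: "AE w in lborel. Re w \<noteq> 0 \<and> Im w \<noteq> 0"
    by (rule AE_completion_iff[THEN iffD1, rotated]) measurable
  have "(\<integral>\<^sup>+w. ennreal (sing_ball q 1 w) \<partial>lborel) \<le> (\<integral>\<^sup>+w. (\<Prod>b\<in>Basis. ennreal (g ((w::complex) \<bullet> b))) \<partial>lborel)"
  proof (rule nn_integral_mono_AE)
    show "AE w in lborel. ennreal (sing_ball q 1 w) \<le> (\<Prod>b\<in>Basis. ennreal (g (w \<bullet> b)))"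
      using ae
    proof eventually_elim
      case (elim w)
      have "(\<Prod>b\<in>Basis. ennreal (g (w \<bullet> b))) = ennreal (g (Re w) * g (Im w))"
        by (simp add: Basis_complex_def ennreal_mult[OF g0 g0])
      then show ?case using ennreal_leI[OF bound[of w]] elim by simp
    qed
  qed
  also have "\<dots> = (\<Prod>b\<in>(Basis::complex set). (\<integral>\<^sup>+x. ennreal (g x) \<partial>lborel))"
    by (rule nn_integral_lborel_prod) auto
  also have "\<dots> < \<infinity>"
    using fin by (simp add: Basis_complex_def ennreal_mult_less_top)
  finally show ?thesis
    by (auto simp: integrable_iff_bounded sing_ball_nonneg)
qed

lemma sing_ball_le: "\<delta> \<le> 1 \<Longrightarrow> sing_ball q \<delta> w \<le> sing_ball q 1 w"
  by (auto simp: sing_ball_def indicator_def)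

lemma integrable_sing_ball:
  assumes q: "0 < q" "q < 2" and "\<delta> \<le> 1"
  shows "integrable lborel (sing_ball q \<delta>)"
  using sing_ball_le[OF \<open>\<delta> \<le> 1\<close>]
  by (intro Bochner_Integration.integrable_bound[OF integrable_sing_ball_1[OF q]])
     (auto simp: sing_ball_nonneg)

lemma tendsto_integral_sing_ball:
  assumes q: "0 < q" "q < 2"
  shows "(\<lambda>n. \<integral>w. sing_ball q (1 / real (Suc n)) w \<partial>lborel) \<longlonglongrightarrow> 0"
proof -
  have "(\<lambda>n. \<integral>w. sing_ball q (1 / real (Suc n)) w \<partial>lborel) \<longlonglongrightarrow> (\<integral>w. 0 \<partial>(lborel::complex measure))"
  proof (rule integral_dominated_convergence)
    show "integrable lborel (sing_ball q 1)" by (rule integrable_sing_ball_1[OF q])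
    show "AE w in lborel. norm (sing_ball q (1 / real (Suc n)) w) \<le> sing_ball q 1 w" for n
      using sing_ball_le[of "1 / real (Suc n)" q] by (auto simp: sing_ball_nonneg)
    show "AE w in lborel. (\<lambda>n. sing_ball q (1 / real (Suc n)) w) \<longlonglongrightarrow> 0"
    proof (intro AE_I2)
      fix w :: complex
      show "(\<lambda>n. sing_ball q (1 / real (Suc n)) w) \<longlonglongrightarrow> 0"
      proof (cases "w = 0")
        case False
        have "(\<lambda>n. 1 / real (Suc n)) \<longlonglongrightarrow> 0" by (rule LIMSEQ_Suc[OF lim_1_over_n])
        then have "eventually (\<lambda>n. 1 / real (Suc n) < norm w) sequentially"
          using False by (intro order_tendstoD) auto
        then have "eventually (\<lambda>n. sing_ball q (1 / real (Suc n)) w = 0) sequentially"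
          by eventually_elim (auto simp: sing_ball_def)
        then show ?thesis by (rule tendsto_eventually)
      qed (auto simp: sing_ball_def)
    qed
  qed auto
  then show ?thesis by simp
qed

text \<open>Young's inequality for (l a)(b / l), with the factors 1/p and 1/q dropped. A small
  \<open>l\<close> makes the first term small; the large factor it puts on the second is later
  absorbed by shrinking the ball.\<close>

lemma weighted_Young:
  fixes a b l :: real
  assumes p: "p > 1" and q: "q = p / (p - 1)" and "a \<ge> 0" "b \<ge> 0" "l > 0"
  shows "a * b \<le> l powr p * a powr p + l powr (-q) * b powr q"
proof -
  have q1: "q > 1" using p by (simp add: q)
  have "a * b = (l * a) * (b / l)" using assms by simp
  also have "\<dots> \<le> (l * a) powr p / p + (b / l) powr q / q"
    using assms q1 by (intro Youngs_inequality) (auto simp: field_simps)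
  also have "\<dots> \<le> (l * a) powr p + (b / l) powr q"
    using p q1 divide_left_mono[of 1 p "(l * a) powr p"] divide_left_mono[of 1 q "(b / l) powr q"]
    by (intro add_mono) auto
  also have "\<dots> = l powr p * a powr p + l powr (-q) * b powr q"
    using assms by (simp add: powr_mult powr_divide powr_minus field_simps)
  finally show ?thesis .
qed

text \<open>Since 1/w = cnj w / |w|^2, keeping the modulus in the denominator at least \<delta>
  gives a continuous function that coincides with 1/w outside the ball of radius \<delta>.\<close>

definition cut_kernel :: "real \<Rightarrow> complex \<Rightarrow> complex" where
  "cut_kernel \<delta> w = cnj w / (of_real (max (norm w) \<delta>))\<^sup>2"

lemma cnj_over_norm_squared: "cnj w / (of_real (norm w))\<^sup>2 = 1 / w"
proof -
  have "(of_real (norm w))\<^sup>2 = w * cnj w" by (metis complex_norm_square of_real_power)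
  then show ?thesis unfolding \<open>(of_real (norm w))\<^sup>2 = w * cnj w\<close>
    by (cases "w = 0") (simp_all add: nonzero_divide_mult_cancel_right del: complex_mult_cnj)
qed

lemma continuous_on_cut_kernel:
  assumes "\<delta> > 0" shows "continuous_on UNIV (cut_kernel \<delta>)"
  unfolding cut_kernel_def[abs_def] using assms
  by (intro continuous_intros) (auto simp: max_def)

lemma norm_cut_kernel_le:
  assumes "\<delta> > 0" shows "norm (cut_kernel \<delta> w) \<le> 1 / \<delta>"
proof -
  define m where "m = max (norm w) \<delta>"
  have m: "m > 0" "norm w \<le> m" "\<delta> \<le> m" using assms by (auto simp: m_def)
  have "norm (cut_kernel \<delta> w) = norm w / m\<^sup>2"
    using m by (simp add: cut_kernel_def norm_divide norm_power flip: m_def)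
  also have "\<dots> \<le> m / m\<^sup>2" using m by (intro divide_right_mono) auto
  also have "\<dots> = 1 / m" using m by (simp add: power2_eq_square)
  also have "\<dots> \<le> 1 / \<delta>" using m assms by (intro divide_left_mono) auto
  finally show ?thesis .
qed

lemma norm_inverse_diff_cut_kernel_le:
  assumes "\<delta> > 0" 
  shows "norm (1 / w - cut_kernel \<delta> w) \<le> indicator (ball 0 \<delta>) w * (1 / norm w)"
proof (cases "norm w < \<delta>")
  case True
  show ?thesis
  proof (cases "w = 0")
    case False
    \<comment> \<open>Both kernels are nonnegative multiples of \<open>cnj w\<close> and the cut one
      is the smaller, so the difference is at most 1/|w|.\<close>
    have "1 / w - cut_kernel \<delta> w = cnj w * of_real (1 / norm w ^ 2 - 1 / \<delta>\<^sup>2)"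
      using True by (simp add: cut_kernel_def right_diff_distrib cnj_over_norm_squared)
    then have "norm (1 / w - cut_kernel \<delta> w) = norm w * \<bar>1 / norm w ^ 2 - 1 / \<delta>\<^sup>2\<bar>"
      by (simp only: norm_mult norm_of_real complex_mod_cnj)
    also have "1 / \<delta>\<^sup>2 \<le> 1 / norm w ^ 2"
      using True False assms by (intro divide_left_mono power_mono mult_pos_pos zero_less_power) auto
    then have "\<bar>1 / norm w ^ 2 - 1 / \<delta>\<^sup>2\<bar> \<le> 1 / norm w ^ 2" by simp
    then have "norm w * \<bar>1 / norm w ^ 2 - 1 / \<delta>\<^sup>2\<bar> \<le> norm w * (1 / norm w ^ 2)"
      by (intro mult_left_mono) auto
    also have "\<dots> = 1 / norm w" using False by (simp add: power2_eq_square)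
    finally show ?thesis using True by simp
  qed (simp add: cut_kernel_def)
next
  case False
  then show ?thesis using cnj_over_norm_squared[of w] by (simp add: cut_kernel_def)
qed

text \<open>Serves twice: for a truncation of the density \<open>F\<close>, and with exponent 3 for
  \<open>dbar g\<close> in the Cauchy-Pompeiu formula.\<close>

locale Lp_compact_support =
  fixes G :: "complex \<Rightarrow> complex" and p q \<rho> :: real
  assumes p: "p > 2" and q: "q = p / (p - 1)"
    and meas [measurable]: "G \<in> borel_measurable borel"
    and Gp: "integrable lborel (\<lambda>w. norm (G w) powr p)"
    and supp: "\<And>w. w \<notin> ball 0 \<rho> \<Longrightarrow> G w = 0"
begin

lemma q_bounds: "1 < q" "0 < q" "q < 2"
  using p by (auto simp: q divide_less_eq)

lemma integrable_ball: "integrable lborel (indicat_real (ball 0 \<rho> :: complex set))"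
  by (intro integrable_real_indicator) (simp_all add: emeasure_bounded_finite[OF bounded_ball, unfolded infinity_ennreal_def])

lemma integrable_G: "integrable lborel G"
proof (rule Bochner_Integration.integrable_bound)
  show "integrable lborel (\<lambda>w. indicat_real (ball 0 \<rho>) w + norm (G w) powr p)"
    using integrable_ball Gp by simp
  have "norm (G w) \<le> indicat_real (ball 0 \<rho>) w + norm (G w) powr p" for w
  proof (cases "norm (G w) \<le> 1")
    case True
    then show ?thesis using supp[of w] by (auto simp: indicator_def add_increasing2)
  next
    case False
    then have "norm (G w) powr 1 \<le> norm (G w) powr p" using p by (intro powr_mono) auto
    then show ?thesis using False by (simp add: indicator_def)
  qed
  then show "AE w in lborel. norm (G w) \<le> norm (indicat_real (ball 0 \<rho>) w + norm (G w) powr p)"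
    by (intro AE_I2) (rule order_trans, assumption, simp)
qed simp

lemma integrable_sing: "\<delta> \<le> 1 \<Longrightarrow> integrable lborel (\<lambda>w. sing_ball q \<delta> (w - z))"
  using integrable_lborel_translate_iff[of "sing_ball q \<delta>" "-z"] integrable_sing_ball[OF q_bounds(2,3)]
  by simp

lemma integral_sing: "(\<integral>w. sing_ball q \<delta> (w - z) \<partial>lborel) = (\<integral>w. sing_ball q \<delta> w \<partial>lborel)"
  using integral_lborel_translate[of "sing_ball q \<delta>" "-z"] by simp

text \<open>Free of the pole z, as translating \<open>sing_ball\<close> does not change its
  integral. The last summand pays for points at distance at least 1 from the pole, where the kernel
  is at most 1.\<close>

definition bound :: real where
  "bound = (\<integral>w. norm (G w) powr p \<partial>lborel) + (\<integral>w. sing_ball q 1 w \<partial>lborel) + measure lborel (ball 0 \<rho> :: complex set)"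

lemma norm_cauchy_le:
  "norm (G w) * (1 / norm (w - z)) \<le> norm (G w) powr p + sing_ball q 1 (w - z) + indicator (ball 0 \<rho>) w"
proof (cases "G w = 0")
  case False
  then have w: "w \<in> ball 0 \<rho>" using supp by auto
  have "norm (G w) * (1 / norm (w - z)) \<le> norm (G w) powr p + (1 / norm (w - z)) powr q"
    using weighted_Young[of p q "norm (G w)" "1 / norm (w - z)" 1] p q by simp
  moreover have "(1 / norm (w - z)) powr q \<le> sing_ball q 1 (w - z) + indicator (ball 0 \<rho>) w"
  proof (cases "norm (w - z) < 1")
    case True
    then have "w - z \<in> ball 0 1" by simp
    then show ?thesis by (simp add: sing_ball_def powr_divide powr_minus_divide)
  next
    case False
    then have "1 / norm (w - z) \<le> 1 / 1"
      by (intro divide_left_mono) auto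
    then have "(1 / norm (w - z)) powr q \<le> 1 powr q"
      using q_bounds by (intro powr_mono2) auto
    then show ?thesis using w sing_ball_nonneg[of q 1 "w - z"] by simp
  qed
  ultimately show ?thesis by linarith
qed (auto simp: sing_ball_nonneg)

lemma integrable_cauchy: "integrable lborel (\<lambda>w. G w / (w - z))"
proof (rule Bochner_Integration.integrable_bound)
  show "integrable lborel (\<lambda>w. norm (G w) powr p + sing_ball q 1 (w - z) + indicator (ball 0 \<rho>) w)"
    using Gp integrable_ball integrable_sing by auto
  show "AE w in lborel. norm (G w / (w - z)) \<le> norm (norm (G w) powr p + sing_ball q 1 (w - z) + indicator (ball 0 \<rho>) w)"
  proof (intro AE_I2)
    fix w
    show "norm (G w / (w - z)) \<le> norm (norm (G w) powr p + sing_ball q 1 (w - z) + indicator (ball 0 \<rho>) w)"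
      using norm_cauchy_le[of w z] by (simp add: norm_divide)
  qed
qed simp

text \<open>Uniformity in \<open>z\<close> is what the Fubini argument for the weak derivative
  consumes.\<close>

lemma integral_norm_cauchy_le: "(\<integral>w. norm (G w / (w - z)) \<partial>lborel) \<le> bound"
proof -
  have "(\<integral>w. norm (G w / (w - z)) \<partial>lborel) 
     \<le> (\<integral>w. norm (G w) powr p + sing_ball q 1 (w - z) + indicator (ball 0 \<rho>) w \<partial>lborel)"
    using norm_cauchy_le[of _ z] Gp integrable_ball integrable_sing
    by (intro integral_mono integrable_norm integrable_cauchy) (auto simp: norm_divide)
  also have "\<dots> = bound"
    using Gp integrable_ball integrable_sing integral_sing[of 1 z] by (simp add: bound_def)
  finally show ?thesis .
qed

definition cauchy :: "complex \<Rightarrow> complex" where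
  "cauchy z = (\<integral>w. G w / (w - z) \<partial>lborel)"

definition cauchy_cut :: "real \<Rightarrow> complex \<Rightarrow> complex" where
  "cauchy_cut \<delta> z = (\<integral>w. G w * cut_kernel \<delta> (w - z) \<partial>lborel)"

lemma cut_kernel_measurable: "\<delta> > 0 \<Longrightarrow> cut_kernel \<delta> \<in> borel_measurable borel"
  by (intro borel_measurable_continuous_onI continuous_on_cut_kernel)

lemma integrable_cauchy_cut:
  assumes "\<delta> > 0" shows "integrable lborel (\<lambda>w. G w * cut_kernel \<delta> (w - z))"
proof (rule Bochner_Integration.integrable_bound)
  note [measurable] = cut_kernel_measurable[OF assms]
  show "(\<lambda>w. G w * cut_kernel \<delta> (w - z)) \<in> borel_measurable lborel" by measurable
  show "integrable lborel (\<lambda>w. norm (G w) * (1 / \<delta>))"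
    using integrable_G by (intro integrable_mult_left integrable_norm)
  have "norm (G w * cut_kernel \<delta> (w - z)) \<le> norm (G w) * (1 / \<delta>)" for w
    unfolding norm_mult by (intro mult_left_mono norm_cut_kernel_le assms norm_ge_zero)
  then show "AE w in lborel. norm (G w * cut_kernel \<delta> (w - z)) \<le> norm (norm (G w) * (1 / \<delta>))"
    using assms by (intro AE_I2) simp
qed

lemma continuous_on_cauchy_cut:
  assumes d: "\<delta> > 0" shows "continuous_on UNIV (cauchy_cut \<delta>)"
  unfolding continuous_on_sequentially
proof (intro allI impI ballI, elim conjE)
  note [measurable] = cut_kernel_measurable[OF d]
  fix x :: "nat \<Rightarrow> complex" and a assume x: "x \<longlonglongrightarrow> a"
  show "(cauchy_cut \<delta> \<circ> x) \<longlonglongrightarrow> cauchy_cut \<delta> a"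
    unfolding o_def cauchy_cut_def
  proof (rule integral_dominated_convergence)
    show "integrable lborel (\<lambda>w. norm (G w) * (1 / \<delta>))"
      using integrable_G by (intro integrable_mult_left integrable_norm)
    show "AE w in lborel. norm (G w * cut_kernel \<delta> (w - x n)) \<le> norm (G w) * (1 / \<delta>)" for n
      unfolding norm_mult by (intro AE_I2 mult_left_mono norm_cut_kernel_le d norm_ge_zero)
    have "isCont (cut_kernel \<delta>) u" for u
      using continuous_on_cut_kernel[OF d] by (simp add: continuous_on_eq_continuous_at)
    then show "AE w in lborel. (\<lambda>n. G w * cut_kernel \<delta> (w - x n)) \<longlonglongrightarrow> G w * cut_kernel \<delta> (w - a)"
      by (intro AE_I2 tendsto_mult tendsto_const isCont_tendsto_compose[of _ "cut_kernel \<delta>"] tendsto_diff x)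
  qed measurable
qed

text \<open>The kernels differ only on the ball of radius \<delta> about the pole, and there by at
  most 1/|w - z|; \<open>weighted_Young\<close> does the rest, and no term of the bound depends on
  \<open>z\<close>.\<close>

lemma norm_cauchy_diff_le:
  assumes d: "0 < \<delta>" "\<delta> \<le> 1" and l: "l > 0"
  shows "norm (cauchy_cut \<delta> z - cauchy z)
     \<le> l powr p * (\<integral>w. norm (G w) powr p \<partial>lborel) + l powr (-q) * (\<integral>w. sing_ball q \<delta> w \<partial>lborel)"
proof -
  have "cauchy_cut \<delta> z - cauchy z = (\<integral>w. G w * cut_kernel \<delta> (w - z) - G w / (w - z) \<partial>lborel)"
    unfolding cauchy_def cauchy_cut_def
    by (intro Bochner_Integration.integral_diff[symmetric] integrable_cauchy integrable_cauchy_cut d)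
  also have "norm \<dots> \<le> (\<integral>w. l powr p * norm (G w) powr p + l powr (-q) * sing_ball q \<delta> (w - z) \<partial>lborel)"
  proof (rule order_trans[OF integral_norm_bound integral_mono])
    show "integrable lborel (\<lambda>w. norm (G w * cut_kernel \<delta> (w - z) - G w / (w - z)))"
      by (intro integrable_norm Bochner_Integration.integrable_diff integrable_cauchy integrable_cauchy_cut d)
    show "integrable lborel (\<lambda>w. l powr p * norm (G w) powr p + l powr (-q) * sing_ball q \<delta> (w - z))"
      using Gp integrable_sing[OF d(2)] by auto
    fix w
    have "norm (G w * cut_kernel \<delta> (w - z) - G w / (w - z)) = norm (G w) * norm (1 / (w - z) - cut_kernel \<delta> (w - z))"
      by (subst norm_minus_commute) (simp add: right_diff_distrib flip: norm_mult)
    also have "\<dots> \<le> norm (G w) * (indicator (ball 0 \<delta>) (w - z) * (1 / norm (w - z)))"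
      by (intro mult_left_mono norm_inverse_diff_cut_kernel_le d) auto
    also have "\<dots> \<le> l powr p * norm (G w) powr p + l powr (-q) * (indicator (ball 0 \<delta>) (w - z) * (1 / norm (w - z))) powr q"
      using p by (intro weighted_Young[OF _ q _ _ l]) auto
    also have "(indicator (ball 0 \<delta>) (w - z) * (1 / norm (w - z))) powr q = sing_ball q \<delta> (w - z)"
      by (auto simp: sing_ball_def indicator_def powr_divide powr_minus_divide)
    finally show "norm (G w * cut_kernel \<delta> (w - z) - G w / (w - z)) 
        \<le> l powr p * norm (G w) powr p + l powr (-q) * sing_ball q \<delta> (w - z)" .
  qed
  also have "\<dots> = l powr p * (\<integral>w. norm (G w) powr p \<partial>lborel) + l powr (-q) * (\<integral>w. sing_ball q \<delta> w \<partial>lborel)"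
    using Gp integrable_sing[OF d(2)] by (simp add: integral_sing)
  finally show ?thesis .
qed

text \<open>A uniform limit of continuous functions: \<open>l\<close> is fixed first to make the L^p
  term small, then \<delta> = 1/(n + 1) is shrunk.\<close>

lemma continuous_on_cauchy: "continuous_on UNIV cauchy"
proof (rule uniform_limit_theorem)
  show "\<forall>\<^sub>F n in sequentially. continuous_on UNIV (cauchy_cut (1 / real (Suc n)))"
    by (intro always_eventually allI continuous_on_cauchy_cut) simp
  show "uniform_limit UNIV (\<lambda>n. cauchy_cut (1 / real (Suc n))) cauchy sequentially"
  proof (rule uniform_limitI)
    fix e :: real assume e: "e > 0"
    define A where "A = (\<integral>w. norm (G w) powr p \<partial>lborel)"
    have A: "A \<ge> 0" by (auto simp: A_def)
    \<comment> \<open>Chosen so that l^p = e / (2 (A + 1)); the added 1 covers A = 0.\<close>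
    define l where "l = (e / (2 * (A + 1))) powr (1 / p)"
    have l: "l > 0" "l powr p = e / (2 * (A + 1))" using e A p by (auto simp: l_def powr_powr)
    have lA: "l powr p * A < e / 2" using e A unfolding l by (simp add: field_simps)
    have "(\<lambda>n. l powr (-q) * (\<integral>w. sing_ball q (1 / real (Suc n)) w \<partial>lborel)) \<longlonglongrightarrow> l powr (-q) * 0"
      by (intro tendsto_mult tendsto_const tendsto_integral_sing_ball q_bounds)
    then have "\<forall>\<^sub>F n in sequentially. l powr (-q) * (\<integral>w. sing_ball q (1 / real (Suc n)) w \<partial>lborel) < e / 2"
      using e by (intro order_tendstoD) auto
    then show "\<forall>\<^sub>F n in sequentially. \<forall>z\<in>UNIV. dist (cauchy_cut (1 / real (Suc n)) z) (cauchy z) < e"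
    proof eventually_elim
      case (elim n)
      show ?case
      proof
        fix z
        have "norm (cauchy_cut (1 / real (Suc n)) z - cauchy z)
          \<le> l powr p * A + l powr (-q) * (\<integral>w. sing_ball q (1 / real (Suc n)) w \<partial>lborel)"
          unfolding A_def by (rule norm_cauchy_diff_le) (use l in auto)
        also have "\<dots> < e" using elim lA by linarith
        finally show "dist (cauchy_cut (1 / real (Suc n)) z) (cauchy z) < e"
          by (simp add: dist_norm)
      qed
    qed
  qed
qed auto

end

section \<open>The Cauchy-Pompeiu formula\<close>

lemma integrable_compact_support:
  fixes f :: "'a::euclidean_space \<Rightarrow> 'b::{banach, second_countable_topology}"
  assumes "continuous_on UNIV f" "\<And>x. x \<notin> cbox a b \<Longrightarrow> f x = 0"
  shows "integrable lborel f"
proof -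
  have "integrable lborel (\<lambda>x. indicator (cbox a b) x *\<^sub>R f x)"
    using borel_integrable_compact[of "cbox a b" f] assms(1) continuous_on_subset
    by (fastforce simp: indicator_def if_distrib cong: if_cong)
  moreover have "(\<lambda>x. indicator (cbox a b) x *\<^sub>R f x) = f"
    using assms(2) by (auto simp: indicator_def fun_eq_iff)
  ultimately show ?thesis by simp
qed

lemma integral_derivative_compact_support:
  fixes f :: "real \<Rightarrow> complex"
  assumes der: "\<And>x. (f has_vector_derivative f' x) (at x)" and cont: "continuous_on UNIV f'"
    and supp: "\<And>x. \<bar>x\<bar> > R \<Longrightarrow> f x = 0"
  shows "(\<integral>x. f' x \<partial>lborel) = 0"
proof -
  \<comment> \<open>\<open>R\<close> may be negative, and the end points must lie strictly beyond
    the support bound.\<close>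
  define a where "a = \<bar>R\<bar> + 1"
  have f'0: "f' x = 0" if "\<bar>x\<bar> > R" for x
  proof -
    have op: "open {x::real. \<bar>x\<bar> > R}" by (intro open_Collect_less continuous_intros)
    have "(f has_vector_derivative 0) (at x)"
      using that supp
      by (intro has_vector_derivative_transform_within_open[OF has_vector_derivative_const op]) auto
    then show ?thesis using der vector_derivative_at by metis
  qed
  have "(f' has_integral (f a - f (-a))) {-a..a}"
    by (intro fundamental_theorem_of_calculus) (auto simp: a_def intro: has_vector_derivative_at_within der)
  moreover have "f a = 0" "f (-a) = 0" using supp by (auto simp: a_def)
  moreover have "f' x = 0" if "x \<notin> {-a..a}" for x
    using that f'0 by (auto simp: a_def)
  ultimately have "(f' has_integral 0) UNIV"
    by (intro has_integral_on_superset[of f' 0 "{-a..a}" UNIV]) auto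
  moreover have "integrable lborel f'"
    using cont f'0 by (intro integrable_compact_support[of f' "-a" a]) (auto simp: a_def)
  then have "(f' has_integral (\<integral>x. f' x \<partial>lborel)) UNIV"
    by (rule has_integral_integral_lborel)
  ultimately show ?thesis by (rule has_integral_unique[symmetric])
qed

lemma integral_lborel_complex_eq:
  fixes f :: "complex \<Rightarrow> complex"
  assumes "integrable lborel f"
  shows "(\<integral>z. f z \<partial>lborel) = (\<integral>x. (\<integral>y. f (Complex x y) \<partial>lborel) \<partial>lborel)"
    and "(\<integral>z. f z \<partial>lborel) = (\<integral>y. (\<integral>x. f (Complex x y) \<partial>lborel) \<partial>lborel)"
    and "integrable (lborel \<Otimes>\<^sub>M lborel) (\<lambda>(x, y). f (Complex x y))"
proof -
  have [measurable]: "f \<in> borel_measurable borel" using assms by auto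
  have "integrable (distr (lborel \<Otimes>\<^sub>M lborel) borel (\<lambda>(x, y). Complex x y)) f"
    using assms lborel_eq_distr_Complex by simp
  then have int: "integrable (lborel \<Otimes>\<^sub>M lborel) (\<lambda>(x, y). f (Complex x y))"
    by (subst (asm) integrable_distr_eq) (simp_all add: case_prod_beta')
  then show "integrable (lborel \<Otimes>\<^sub>M lborel) (\<lambda>(x, y). f (Complex x y))" .
  have eq: "(\<integral>z. f z \<partial>lborel) = (\<integral>(x, y). f (Complex x y) \<partial>(lborel \<Otimes>\<^sub>M lborel))"
    by (subst lborel_eq_distr_Complex, subst integral_distr) (simp_all add: case_prod_beta')
  show "(\<integral>z. f z \<partial>lborel) = (\<integral>x. (\<integral>y. f (Complex x y) \<partial>lborel) \<partial>lborel)"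
    unfolding eq using lborel_pair.integral_fst'[OF int] by simp
  show "(\<integral>z. f z \<partial>lborel) = (\<integral>y. (\<integral>x. f (Complex x y) \<partial>lborel) \<partial>lborel)"
    unfolding eq using lborel_pair.integral_snd[OF int] by simp
qed

lemma frechet_derivative_eq_0_outside:
  assumes "open S" "\<And>z. z \<in> S \<Longrightarrow> g z = 0" "z \<in> S"
  shows "frechet_derivative g (at z) = (\<lambda>_. 0)"
proof -
  have "(g has_derivative (\<lambda>_. 0)) (at z)"
    using assms by (intro has_derivative_transform_within_open[OF has_derivative_const assms(1,3)]) auto
  then show ?thesis by (simp add: frechet_derivative_at[symmetric])
qed

text \<open>Fubini is used in the order that integrates each partial derivative along its own
  direction first, where the fundamental theorem gives 0.\<close>

lemma integral_dbar_eq_0: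
  assumes diff: "\<And>z. g differentiable (at z)"
    and cont: "\<And>v. continuous_on UNIV (\<lambda>z. frechet_derivative g (at z) v)"
    and supp: "\<And>z. norm z > R \<Longrightarrow> g z = 0"
  shows "(\<integral>z. dbar g z \<partial>lborel) = 0" "integrable lborel (dbar g)"
proof -
  define d where "d = (\<lambda>v z. frechet_derivative g (at z) v)"
  have der: "(g has_derivative (\<lambda>v. d v z)) (at z)" for z
    using diff[of z] unfolding d_def by (simp add: frechet_derivative_works)
  have op: "open {z::complex. norm z > R}" by (intro open_Collect_less continuous_intros)
  have d0: "d v z = 0" if "norm z > R" for v z
    using frechet_derivative_eq_0_outside[OF op, of g z] supp that by (simp add: d_def)
  have int: "integrable lborel (d v)" for v
  proof (rule integrable_compact_support)
    show "continuous_on UNIV (d v)" using cont by (simp add: d_def)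
    show "d v z = 0" if "z \<notin> cbox (Complex (-R) (-R)) (Complex R R)" for z
    proof (rule d0, rule ccontr)
      assume "\<not> norm z > R"
      then show False using that abs_Re_le_cmod[of z] abs_Im_le_cmod[of z]
        by (auto simp: in_cbox_complex_iff)
    qed
  qed
  have dbar: "dbar g = (\<lambda>z. (d 1 z + \<i> * d \<i> z) / 2)"
    by (simp add: dbar_def d_def fun_eq_iff)
  show "integrable lborel (dbar g)" unfolding dbar using int by auto
  have C: "continuous_on UNIV (\<lambda>x. d v (Complex x y))" "continuous_on UNIV (\<lambda>y. d v (Complex x y))" for v x y
    unfolding Complex_eq d_def
    by (auto intro!: continuous_on_compose2[OF cont] continuous_intros)
  have x: "(\<integral>x. d 1 (Complex x y) \<partial>lborel) = 0" for y
  proof (rule integral_derivative_compact_support)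
    show "((\<lambda>x. g (Complex x y)) has_vector_derivative d 1 (Complex x y)) (at x)" for x
    proof -
      have "((\<lambda>x. Complex x y) has_vector_derivative 1) (at x)"
        unfolding Complex_eq by (auto intro!: derivative_eq_intros)
      from vector_derivative_diff_chain_within[OF this has_derivative_at_withinI[OF der]]
      show ?thesis by (simp add: o_def)
    qed
    show "continuous_on UNIV (\<lambda>x. d 1 (Complex x y))" by (rule C)
    show "g (Complex x y) = 0" if "\<bar>x\<bar> > R" for x
      using that abs_Re_le_cmod[of "Complex x y"] by (intro supp) simp
  qed
  have y: "(\<integral>y. d \<i> (Complex x y) \<partial>lborel) = 0" for x
  proof (rule integral_derivative_compact_support)
    show "((\<lambda>y. g (Complex x y)) has_vector_derivative d \<i> (Complex x y)) (at y)" for y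
    proof -
      have "((\<lambda>y. Complex x y) has_vector_derivative \<i>) (at y)"
        unfolding Complex_eq by (auto intro!: derivative_eq_intros)
      from vector_derivative_diff_chain_within[OF this has_derivative_at_withinI[OF der]]
      show ?thesis by (simp add: o_def)
    qed
    show "continuous_on UNIV (\<lambda>y. d \<i> (Complex x y))" by (rule C)
    show "g (Complex x y) = 0" if "\<bar>y\<bar> > R" for y
      using that abs_Im_le_cmod[of "Complex x y"] by (intro supp) simp
  qed
  have "(\<integral>z. d 1 z \<partial>lborel) = 0"
    by (simp add: integral_lborel_complex_eq(2)[OF int] x)
  moreover have "(\<integral>z. d \<i> z \<partial>lborel) = 0"
    by (simp add: integral_lborel_complex_eq(1)[OF int] y)
  ultimately show "(\<integral>z. dbar g z \<partial>lborel) = 0"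
    unfolding dbar using int by simp
qed

text \<open>For a nonnegative integrand the finite limits of the primitive already force
  integrability, so the value can be stated as a nonnegative integral.\<close>

lemma nn_integral_real_line_FTC:
  fixes F f :: "real \<Rightarrow> real"
  assumes "\<And>x. (F has_real_derivative f x) (at x)" "continuous_on UNIV f" "\<And>x. 0 \<le> f x"
    and "(F \<longlongrightarrow> A) at_bot" "(F \<longlongrightarrow> B) at_top"
  shows "(\<integral>\<^sup>+x. ennreal (f x) \<partial>lborel) = ennreal (B - A)"
proof -
  have c: "isCont f x" for x using assms(2) by (simp add: continuous_on_eq_continuous_at)
  have lim: "((F \<circ> real_of_ereal) \<longlongrightarrow> A) (at_right (-\<infinity>))" "((F \<circ> real_of_ereal) \<longlongrightarrow> B) (at_left \<infinity>)"
    using assms(4,5) by (simp_all add: ereal_tendsto_simps)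
  have "set_integrable lborel (einterval (-\<infinity>) \<infinity>) f" "(LBINT x=-\<infinity>..\<infinity>. f x) = B - A"
    by (rule interval_integral_FTC_nonneg[where F=F, OF _ assms(1) c _ lim]; use assms(3) in simp)+
  then have "integrable lborel f" "(\<integral>x. f x \<partial>lborel) = B - A"
    by (simp_all add: set_integrable_def interval_lebesgue_integral_def set_lebesgue_integral_def)
  then show ?thesis using assms(3) by (simp add: nn_integral_eq_integral)
qed

text \<open>The function e^2/(|w|^2 + e^2)^2 equals e^(-2) \<open>bump (w / e)\<close>. The mass
  \<pi> of this profile is the constant of the Cauchy-Pompeiu formula, and both of its iterated
  integrals have elementary primitives.\<close>

definition bump :: "complex \<Rightarrow> real" where
  "bump u = 1 / (1 + (norm u)\<^sup>2)\<^sup>2"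

lemma nn_integral_inverse_square_quadratic:
  fixes a :: real assumes a: "a > 0"
  shows "(\<integral>\<^sup>+y. ennreal (1 / (a\<^sup>2 + y\<^sup>2)\<^sup>2) \<partial>lborel) = ennreal (pi / (2 * a ^ 3))"
proof -
  have pos: "a\<^sup>2 + y\<^sup>2 > 0" for y using a by (simp add: add_pos_nonneg)
  \<comment> \<open>The usual reduction formula; the rational part vanishes at both ends, leaving
    \<pi>/(2 a^3) from arctan.\<close>
  define F where "F = (\<lambda>y. y / (2 * a\<^sup>2 * (a\<^sup>2 + y\<^sup>2)) + arctan (y / a) / (2 * a ^ 3))"
  have "(\<integral>\<^sup>+y. ennreal (1 / (a\<^sup>2 + y\<^sup>2)\<^sup>2) \<partial>lborel) = ennreal (pi / (4 * a ^ 3) - (- (pi / (4 * a ^ 3))))"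
  proof (rule nn_integral_real_line_FTC)
    show "(F has_real_derivative 1 / (a\<^sup>2 + y\<^sup>2)\<^sup>2) (at y)" for y
    proof -
      have "(F has_real_derivative ((2 * a\<^sup>2 * (a\<^sup>2 + y\<^sup>2) - y * (2 * a\<^sup>2 * (2 * y))) / (2 * a\<^sup>2 * (a\<^sup>2 + y\<^sup>2))\<^sup>2
          + (inverse (1 + (y / a)\<^sup>2) / a) / (2 * a ^ 3))) (at y)"
        unfolding F_def
      proof (intro DERIV_add DERIV_cdivide)
        show "((\<lambda>y. y / (2 * a\<^sup>2 * (a\<^sup>2 + y\<^sup>2))) has_real_derivative
            (2 * a\<^sup>2 * (a\<^sup>2 + y\<^sup>2) - y * (2 * a\<^sup>2 * (2 * y))) / (2 * a\<^sup>2 * (a\<^sup>2 + y\<^sup>2))\<^sup>2) (at y)"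
          using a pos[of y] by (auto intro!: derivative_eq_intros simp: power2_eq_square mult_ac)
        show "((\<lambda>y. arctan (y / a)) has_real_derivative inverse (1 + (y / a)\<^sup>2) / a) (at y)"
          using a by (auto intro!: derivative_eq_intros)
      qed
      also have "inverse (1 + (y / a)\<^sup>2) = a\<^sup>2 / (a\<^sup>2 + y\<^sup>2)"
        using a pos[of y] by (simp add: field_simps)
      also have "(2 * a\<^sup>2 * (a\<^sup>2 + y\<^sup>2) - y * (2 * a\<^sup>2 * (2 * y))) / (2 * a\<^sup>2 * (a\<^sup>2 + y\<^sup>2))\<^sup>2
          + (a\<^sup>2 / (a\<^sup>2 + y\<^sup>2) / a) / (2 * a ^ 3) = 1 / (a\<^sup>2 + y\<^sup>2)\<^sup>2"
      proof -
        define S where "S = a\<^sup>2 + y\<^sup>2"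
        have y2: "y * y = S - a\<^sup>2" by (simp add: S_def power2_eq_square)
        have "S > 0" using pos by (simp add: S_def)
        have "y * (2 * a\<^sup>2 * (2 * y)) = 4 * a\<^sup>2 * (S - a\<^sup>2)" by (simp flip: y2)
        moreover have "(2 * A * S - 4 * A * (S - A)) / (2 * A * S)\<^sup>2 = 1 / S\<^sup>2 - 1 / (2 * A * S)" if "A > 0" for A
          using that \<open>S > 0\<close> by (simp add: field_simps power2_eq_square)
        then have "(2 * a\<^sup>2 * S - 4 * a\<^sup>2 * (S - a\<^sup>2)) / (2 * a\<^sup>2 * S)\<^sup>2 = 1 / S\<^sup>2 - 1 / (2 * a\<^sup>2 * S)"
          using a by simp
        moreover have "(a\<^sup>2 / S / a) / (2 * a ^ 3) = 1 / (2 * a\<^sup>2 * S)"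
          using a \<open>S > 0\<close> by (simp add: field_simps power2_eq_square power3_eq_cube)
        ultimately show ?thesis
          unfolding S_def[symmetric] by (simp only:)
      qed
      finally show ?thesis .
    qed
    show "continuous_on UNIV (\<lambda>y. 1 / (a\<^sup>2 + y\<^sup>2)\<^sup>2)"
      using pos by (intro continuous_intros) (auto simp: less_imp_neq[symmetric])
    show "(F \<longlongrightarrow> - (pi / (4 * a ^ 3))) at_bot" "(F \<longlongrightarrow> pi / (4 * a ^ 3)) at_top"
      unfolding F_def using a by (real_asymp simp: field_simps)+
  qed simp
  then show ?thesis by simp
qed

text \<open>Integrating first over the imaginary part, with a = sqrt(1 + x^2), leaves (\<pi>/2)(1 +
  x^2)^(-3/2), whose primitive is (\<pi>/2) x / sqrt(1 + x^2).\<close>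

lemma nn_integral_bump: "(\<integral>\<^sup>+u. ennreal (bump u) \<partial>lborel) = ennreal pi"
proof -
  have [measurable]: "bump \<in> borel_measurable borel" unfolding bump_def by measurable
  have "(\<integral>\<^sup>+u. ennreal (bump u) \<partial>lborel) = (\<integral>\<^sup>+p. ennreal (bump (case p of (x, y) \<Rightarrow> Complex x y)) \<partial>(lborel \<Otimes>\<^sub>M lborel))"
    by (subst lborel_eq_distr_Complex, subst nn_integral_distr) auto
  also have "\<dots> = (\<integral>\<^sup>+x. \<integral>\<^sup>+y. ennreal (bump (Complex x y)) \<partial>lborel \<partial>lborel)"
    by (subst lborel.nn_integral_fst[symmetric]) auto
  also have "\<dots> = (\<integral>\<^sup>+x. ennreal (pi / (2 * sqrt (1 + x\<^sup>2) ^ 3)) \<partial>lborel)"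
  proof (rule nn_integral_cong)
    fix x :: real
    have "(\<integral>\<^sup>+y. ennreal (bump (Complex x y)) \<partial>lborel) = (\<integral>\<^sup>+y. ennreal (1 / ((sqrt (1 + x\<^sup>2))\<^sup>2 + y\<^sup>2)\<^sup>2) \<partial>lborel)"
      by (simp add: bump_def cmod_power2 add.assoc)
    also have "\<dots> = ennreal (pi / (2 * sqrt (1 + x\<^sup>2) ^ 3))"
      by (rule nn_integral_inverse_square_quadratic) (simp add: add_pos_nonneg)
    finally show "(\<integral>\<^sup>+y. ennreal (bump (Complex x y)) \<partial>lborel) = ennreal (pi / (2 * sqrt (1 + x\<^sup>2) ^ 3))" .
  qed
  also have "\<dots> = ennreal (pi / 2 - (- (pi / 2)))"
  proof (rule nn_integral_real_line_FTC)
    define F where "F = (\<lambda>x. pi / 2 * (x / sqrt (1 + x\<^sup>2)))"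
    show "(F has_real_derivative pi / (2 * sqrt (1 + x\<^sup>2) ^ 3)) (at x)" for x
    proof -
      define s where "s = sqrt (1 + x\<^sup>2)"
      have s: "s > 0" "s\<^sup>2 = 1 + x\<^sup>2" by (simp_all add: s_def add_pos_nonneg)
      have "(F has_real_derivative (pi / 2 * ((s - x * (x / s)) / s\<^sup>2))) (at x)"
      proof -
        have "((\<lambda>x. sqrt (1 + x\<^sup>2)) has_real_derivative x / s) (at x)"
          using s add_pos_nonneg[of 1 "x\<^sup>2"] by (auto intro!: derivative_eq_intros simp flip: s_def) (simp_all add: field_simps)
        moreover have "sqrt (1 + x\<^sup>2) \<noteq> 0" using s(1) by (simp add: s_def)
        ultimately have "(F has_real_derivative pi / 2 * ((1 * sqrt (1 + x\<^sup>2) - x * (x / s)) / (sqrt (1 + x\<^sup>2) * sqrt (1 + x\<^sup>2)))) (at x)"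
          unfolding F_def by (intro DERIV_cmult DERIV_divide DERIV_ident)
        then show ?thesis unfolding s_def[symmetric] by (simp add: power2_eq_square)
      qed
      also have "s - x * (x / s) = (s\<^sup>2 - x\<^sup>2) / s" using s(1) by (simp add: field_simps power2_eq_square)
      also have "\<dots> = 1 / s" by (simp add: s(2))
      also have "pi / 2 * (1 / s / s\<^sup>2) = pi / (2 * s ^ 3)" by (simp add: power2_eq_square power3_eq_cube)
      finally show ?thesis by (simp add: s_def)
    qed
    show "continuous_on UNIV (\<lambda>x::real. pi / (2 * sqrt (1 + x\<^sup>2) ^ 3))"
      by (intro continuous_intros) (auto simp: add_nonneg_eq_0_iff)
    show "(F \<longlongrightarrow> - (pi / 2)) at_bot" "(F \<longlongrightarrow> pi / 2) at_top"
      unfolding F_def by real_asymp+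
  qed simp
  finally show ?thesis by simp
qed

lemma integrable_bump: "integrable lborel bump" and integral_bump: "(\<integral>u. bump u \<partial>lborel) = pi"
proof -
  have [measurable]: "bump \<in> borel_measurable borel" unfolding bump_def by measurable
  have b0: "bump u \<ge> 0" for u by (simp add: bump_def)
  show "integrable lborel bump"
    by (intro integrableI_nonneg) (auto simp: nn_integral_bump b0)
  show "(\<integral>u. bump u \<partial>lborel) = pi"
    by (subst integral_eq_nn_integral) (auto simp: nn_integral_bump b0)
qed

lemma integral_lborel_affine:
  fixes f :: "'a::euclidean_space \<Rightarrow> 'b::{banach, second_countable_topology}"
  assumes [measurable]: "f \<in> borel_measurable borel" and c: "c \<noteq> 0"
  shows "(\<integral>x. f x \<partial>lborel) = \<bar>c\<bar> ^ DIM('a) *\<^sub>R (\<integral>x. f (t + c *\<^sub>R x) \<partial>lborel)"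
  by (subst lborel_affine[OF c, of t]) (simp add: integral_density integral_distr)

text \<open>A smooth substitute for \<open>1/w\<close> whose \<open>\<partial>/\<partial>w\<^sup>*\<close> derivative is the approximate identity
  \<open>e\<^sup>2 / (\<bar>w\<bar>\<^sup>2 + e\<^sup>2)\<^sup>2\<close>, a rescaling of \<open>bump\<close>.\<close>

definition smooth_kernel :: "real \<Rightarrow> complex \<Rightarrow> complex" where
  "smooth_kernel e w = cnj w / (w * cnj w + of_real (e\<^sup>2))"

lemma smooth_kernel_denom: "w * cnj w + of_real (e\<^sup>2) = of_real ((norm w)\<^sup>2 + e\<^sup>2)"
  using complex_norm_square[of w] by simp

lemma smooth_kernel_denom_nz: "e \<noteq> 0 \<Longrightarrow> w * cnj w + of_real (e\<^sup>2) \<noteq> 0"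
  unfolding smooth_kernel_denom of_real_eq_0_iff by (simp add: add_nonneg_eq_0_iff)

lemma smooth_kernel_has_derivative:
  fixes w :: complex
  assumes e: "e \<noteq> 0"
  defines "N \<equiv> w * cnj w + of_real (e\<^sup>2)"
  shows "(smooth_kernel e has_derivative (\<lambda>v. cnj v / N - cnj w * (v * cnj w + w * cnj v) / N\<^sup>2)) (at w)"
proof -
  have c: "(cnj has_derivative cnj) (at w)"
    by (rule bounded_linear_imp_has_derivative[OF bounded_linear_cnj])
  have N: "N \<noteq> 0" unfolding N_def by (rule smooth_kernel_denom_nz[OF e])
  have "((\<lambda>w. w * cnj w + of_real (e\<^sup>2)) has_derivative (\<lambda>v. w * cnj v + v * cnj w + 0)) (at w)"
    by (intro has_derivative_add has_derivative_mult has_derivative_ident c has_derivative_const)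
  from has_derivative_divide[OF c this] N
  have "(smooth_kernel e has_derivative
      (\<lambda>v. - cnj w * (inverse N * (w * cnj v + v * cnj w + 0) * inverse N) + cnj v / N)) (at w)"
    unfolding smooth_kernel_def[abs_def] N_def by simp
  then show ?thesis
    by (rule has_derivative_eq_rhs) (use N in \<open>auto simp: fun_eq_iff field_simps power2_eq_square\<close>)
qed

text \<open>Integration by parts: dbar of the compactly supported product of g(z) and
  \<open>smooth_kernel e (\<zeta> - z)\<close> integrates to 0. The reflection in \<zeta> - z
  supplies a minus sign, so the derivative of the kernel ends up with a plus; substituting z =
  \<zeta> + e u rescales it to \<open>bump\<close>, the Jacobian e^2 cancelling its scale.\<close>

lemma integral_dbar_smooth_kernel:
  assumes e: "e > 0"
    and diff: "\<And>z. g differentiable (at z)"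
    and cont: "\<And>v. continuous_on UNIV (\<lambda>z. frechet_derivative g (at z) v)"
    and supp: "\<And>z. norm z > R \<Longrightarrow> g z = 0"
  shows "(\<integral>z. dbar g z * smooth_kernel e (\<zeta> - z) \<partial>lborel) = (\<integral>u. g (\<zeta> + e *\<^sub>R u) * of_real (bump u) \<partial>lborel)"
proof -
  define N where "N = (\<lambda>w. w * cnj w + complex_of_real (e\<^sup>2))"
  have N: "N w \<noteq> 0" for w unfolding N_def using e by (intro smooth_kernel_denom_nz) simp
  have contN: "continuous_on UNIV (\<lambda>z. N (\<zeta> - z))" unfolding N_def by (intro continuous_intros)
  define D where "D = (\<lambda>w v. cnj v / N w - cnj w * (v * cnj w + w * cnj v) / (N w)\<^sup>2)"
  have gd: "(g has_derivative frechet_derivative g (at z)) (at z)" for z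
    using diff[of z] by (simp add: frechet_derivative_works)
  have kd: "((\<lambda>z. smooth_kernel e (\<zeta> - z)) has_derivative (\<lambda>v. - D (\<zeta> - z) v)) (at z)" for z
  proof -
    have "((\<lambda>z. \<zeta> - z) has_derivative (\<lambda>v. - v)) (at z)" by (auto intro!: derivative_eq_intros)
    moreover have "(smooth_kernel e has_derivative D (\<zeta> - z)) (at (\<zeta> - z))"
      using smooth_kernel_has_derivative[of e "\<zeta> - z"] e by (simp add: D_def N_def)
    ultimately have "(smooth_kernel e \<circ> (\<lambda>z. \<zeta> - z) has_derivative D (\<zeta> - z) \<circ> (\<lambda>v. - v)) (at z)"
      by (rule diff_chain_at)
    moreover have "D (\<zeta> - z) \<circ> (\<lambda>v. - v) = (\<lambda>v. - D (\<zeta> - z) v)"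
      by (auto simp: D_def fun_eq_iff diff_divide_distrib add_divide_distrib algebra_simps)
    ultimately show ?thesis by (simp add: o_def)
  qed
  define h where "h = (\<lambda>z. g z * smooth_kernel e (\<zeta> - z))"
  have hd: "(h has_derivative (\<lambda>v. g z * (- D (\<zeta> - z) v) + frechet_derivative g (at z) v * smooth_kernel e (\<zeta> - z))) (at z)" for z
    unfolding h_def by (rule has_derivative_mult[OF gd kd])
  note fd = frechet_derivative_at[OF hd, symmetric]
  have gc: "continuous_on UNIV g"
    using has_derivative_continuous[OF gd] by (simp add: continuous_on_eq_continuous_at)
  have kc: "continuous_on UNIV (\<lambda>z. smooth_kernel e (\<zeta> - z))"
    using has_derivative_continuous[OF kd] by (simp add: continuous_on_eq_continuous_at)
  have "dbar h z = dbar g z * smooth_kernel e (\<zeta> - z) - g z * (of_real (e\<^sup>2) / (N (\<zeta> - z))\<^sup>2)" for z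
  proof -
    define w where "w = \<zeta> - z"
    \<comment> \<open>This combination kills the part of \<open>D w v\<close> that is complex linear
      in v, so only the terms with cnj v survive.\<close>
    have "(D w 1 + \<i> * D w \<i>) / 2 = (N w - w * cnj w) / (N w)\<^sup>2"
      using N[of w] by (simp add: D_def field_simps power2_eq_square)
    also have "\<dots> = of_real (e\<^sup>2) / (N w)\<^sup>2" by (simp add: N_def)
    finally have *: "(D w 1 + \<i> * D w \<i>) / 2 = of_real (e\<^sup>2) / (N w)\<^sup>2" .
    have "dbar h z = dbar g z * smooth_kernel e w - g z * ((D w 1 + \<i> * D w \<i>) / 2)"
      unfolding dbar_def fd w_def by (simp add: field_simps)
    then have "dbar h z = dbar g z * smooth_kernel e w - g z * (of_real (e\<^sup>2) / (N w)\<^sup>2)"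
      unfolding * .
    then show ?thesis unfolding w_def .
  qed
  note dh = this
  have 1: "(\<integral>z. dbar h z \<partial>lborel) = 0"
  proof (rule integral_dbar_eq_0)
    show "h differentiable (at z)" for z using hd by (auto simp: differentiable_def)
    show "continuous_on UNIV (\<lambda>z. frechet_derivative h (at z) v)" for v
      unfolding fd D_def using N by (intro continuous_intros gc kc cont contN) auto
    show "h z = 0" if "norm z > R" for z using supp[OF that] by (simp add: h_def)
  qed
  have out: "z \<in> cbox (Complex (-R) (-R)) (Complex R R)" if "norm z \<le> R" for z
    using that abs_Re_le_cmod[of z] abs_Im_le_cmod[of z] by (auto simp: in_cbox_complex_iff)
  have op: "open {z::complex. norm z > R}" by (intro open_Collect_less continuous_intros)
  have dbg0: "dbar g z = 0" if "norm z > R" for z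
    using frechet_derivative_eq_0_outside[OF op, of g z] supp that by (simp add: dbar_def)
  have dbc: "continuous_on UNIV (dbar g)" unfolding dbar_def[abs_def] by (intro continuous_intros cont) auto
  have i1: "integrable lborel (\<lambda>z. dbar g z * smooth_kernel e (\<zeta> - z))"
    by (rule integrable_compact_support[where a="Complex (-R) (-R)" and b="Complex R R"])
      (use out dbg0 in \<open>force intro!: continuous_intros kc dbc\<close>)+
  have i2: "integrable lborel (\<lambda>z. g z * (of_real (e\<^sup>2) / (N (\<zeta> - z))\<^sup>2))"
    by (rule integrable_compact_support[where a="Complex (-R) (-R)" and b="Complex R R"])
      (use out supp N in \<open>force intro!: continuous_intros gc contN\<close>)+
  have "(\<integral>z. dbar g z * smooth_kernel e (\<zeta> - z) \<partial>lborel) = (\<integral>z. g z * (of_real (e\<^sup>2) / (N (\<zeta> - z))\<^sup>2) \<partial>lborel)"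
    using 1 Bochner_Integration.integral_diff[OF i1 i2] by (simp add: dh)
  also have "\<dots> = \<bar>e\<bar> ^ 2 *\<^sub>R (\<integral>u. g (\<zeta> + e *\<^sub>R u) * (of_real (e\<^sup>2) / (N (\<zeta> - (\<zeta> + e *\<^sub>R u)))\<^sup>2) \<partial>lborel)"
    using integral_lborel_affine[OF borel_measurable_integrable[OF i2, simplified], of e \<zeta>] e by simp
  also have "\<dots> = (\<integral>u. \<bar>e\<bar> ^ 2 *\<^sub>R (g (\<zeta> + e *\<^sub>R u) * (of_real (e\<^sup>2) / (N (\<zeta> - (\<zeta> + e *\<^sub>R u)))\<^sup>2)) \<partial>lborel)"
    by simp
  also have "\<dots> = (\<integral>u. g (\<zeta> + e *\<^sub>R u) * of_real (bump u) \<partial>lborel)"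
  proof (rule Bochner_Integration.integral_cong[OF refl])
    fix u
    have "N (\<zeta> - (\<zeta> + e *\<^sub>R u)) = of_real (e\<^sup>2 * (1 + (norm u)\<^sup>2))"
      unfolding N_def smooth_kernel_denom by (simp add: power_mult_distrib algebra_simps)
    moreover have "1 + (norm u)\<^sup>2 \<noteq> 0" by (simp add: add_nonneg_eq_0_iff)
    then have "e\<^sup>2 * (e\<^sup>2 / (e\<^sup>2 * (1 + (norm u)\<^sup>2))\<^sup>2) = bump u"
      using e by (simp add: bump_def power_mult_distrib)
    then have "of_real (e\<^sup>2) * (of_real (e\<^sup>2) / (of_real (e\<^sup>2 * (1 + (norm u)\<^sup>2)))\<^sup>2) = complex_of_real (bump u)"
      by (metis of_real_divide of_real_mult of_real_power)
    ultimately show "\<bar>e\<bar> ^ 2 *\<^sub>R (g (\<zeta> + e *\<^sub>R u) * (of_real (e\<^sup>2) / (N (\<zeta> - (\<zeta> + e *\<^sub>R u)))\<^sup>2)) = g (\<zeta> + e *\<^sub>R u) * of_real (bump u)"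
      unfolding scaleR_conv_of_real power2_abs by (metis mult.left_commute)
  qed
  finally show ?thesis .
qed

text \<open>Let e tend to 0 in \<open>integral_dbar_smooth_kernel\<close>: on the left
  \<open>smooth_kernel e w\<close> is at most 1/|w| in modulus, on the right a multiple of
  \<open>bump\<close> dominates because \<open>g\<close> is bounded. With \<zeta> - z in the
  denominator, instead of z - \<zeta>, the constant is +\<pi>.\<close>

lemma cauchy_pompeiu:
  assumes diff: "\<And>z. g differentiable (at z)"
    and cont: "\<And>v. continuous_on UNIV (\<lambda>z. frechet_derivative g (at z) v)"
    and supp: "\<And>z. norm z > R \<Longrightarrow> g z = 0"
  shows "integrable lborel (\<lambda>z. dbar g z / (\<zeta> - z))"
    and "(\<integral>z. dbar g z / (\<zeta> - z) \<partial>lborel) = of_real pi * g \<zeta>"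
proof -
  have gc: "continuous_on UNIV g"
    using diff differentiable_imp_continuous_within by (auto simp: continuous_on_eq_continuous_at)
  have op: "open {z::complex. norm z > R}" by (intro open_Collect_less continuous_intros)
  have dbg0: "dbar g z = 0" if "norm z > R" for z
    using frechet_derivative_eq_0_outside[OF op, of g z] supp that by (simp add: dbar_def)
  have dbc: "continuous_on UNIV (dbar g)" unfolding dbar_def[abs_def] by (intro continuous_intros cont) auto
  have out: "z \<in> cbox (Complex (-R) (-R)) (Complex R R)" if "norm z \<le> R" for z
    using that abs_Re_le_cmod[of z] abs_Im_le_cmod[of z] by (auto simp: in_cbox_complex_iff)
  \<comment> \<open>\<open>dbar g\<close> is continuous with compact support, so any exponent above
    2 serves; 3 has the conjugate 3/2. The locale supplies integrability at the pole.\<close>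
  interpret Lp_compact_support "dbar g" 3 "3/2" "\<bar>R\<bar> + 1"
  proof
    show "dbar g \<in> borel_measurable borel" using dbc by (rule borel_measurable_continuous_onI)
    have "continuous_on UNIV (\<lambda>z. norm (dbar g z) powr 3)" 
      by (intro continuous_intros continuous_on_powr' dbc) auto
    then show "integrable lborel (\<lambda>w. norm (dbar g w) powr 3)"
      by (rule integrable_compact_support[where a="Complex (-R) (-R)" and b="Complex R R"])
        (use out dbg0 in force)
    show "dbar g w = 0" if "w \<notin> ball 0 (\<bar>R\<bar> + 1)" for w using that by (intro dbg0) auto
  qed auto
  have "integrable lborel (\<lambda>z. - (dbar g z / (z - \<zeta>)))"
    using integrable_cauchy by (rule integrable_minus)
  then show int: "integrable lborel (\<lambda>z. dbar g z / (\<zeta> - z))"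
    by (simp flip: divide_minus_right)
  define e where "e = (\<lambda>n. 1 / real (Suc n))"
  have e: "e n > 0" for n by (simp add: e_def)
  have elim: "e \<longlonglongrightarrow> 0" unfolding e_def by (rule LIMSEQ_Suc[OF lim_1_over_n])
  have "(\<lambda>n. \<integral>z. dbar g z * smooth_kernel (e n) (\<zeta> - z) \<partial>lborel) \<longlonglongrightarrow> (\<integral>z. dbar g z / (\<zeta> - z) \<partial>lborel)"
  proof (rule integral_dominated_convergence)
    show "integrable lborel (\<lambda>z. norm (dbar g z / (\<zeta> - z)))" by (rule integrable_norm[OF int])
    show "(\<lambda>z. dbar g z * smooth_kernel (e n) (\<zeta> - z)) \<in> borel_measurable lborel" for n
    proof -
      have [measurable]: "smooth_kernel (e n) \<in> borel_measurable borel"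
        unfolding smooth_kernel_def[abs_def] using e[of n]
        by (intro borel_measurable_continuous_onI continuous_intros ballI smooth_kernel_denom_nz) auto
      show ?thesis by measurable
    qed
    show "AE z in lborel. norm (dbar g z * smooth_kernel (e n) (\<zeta> - z)) \<le> norm (dbar g z / (\<zeta> - z))" for n
    proof (intro AE_I2)
      fix z
      define w where "w = \<zeta> - z"
      have "norm (smooth_kernel (e n) w) = norm w / ((norm w)\<^sup>2 + (e n)\<^sup>2)"
        unfolding smooth_kernel_def smooth_kernel_denom norm_divide norm_of_real by simp
      also have "\<dots> \<le> 1 / norm w"
      proof (cases "w = 0")
        case False
        then have "norm w / ((norm w)\<^sup>2 + (e n)\<^sup>2) \<le> norm w / (norm w)\<^sup>2"
          by (intro divide_left_mono mult_pos_pos add_pos_nonneg) auto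
        then show ?thesis using False by (simp add: power2_eq_square)
      qed simp
      finally show "norm (dbar g z * smooth_kernel (e n) (\<zeta> - z)) \<le> norm (dbar g z / (\<zeta> - z))"
        unfolding norm_mult norm_divide w_def[symmetric]
        using mult_left_mono[of "norm (smooth_kernel (e n) w)" "1 / norm w" "norm (dbar g z)"] by simp
    qed
    show "AE z in lborel. (\<lambda>n. dbar g z * smooth_kernel (e n) (\<zeta> - z)) \<longlonglongrightarrow> dbar g z / (\<zeta> - z)"
    proof (intro AE_I2)
      fix z
      define w where "w = \<zeta> - z"
      have "(\<lambda>n. smooth_kernel (e n) w) \<longlonglongrightarrow> 1 / w"
      proof (cases "w = 0")
        case False
        have "(\<lambda>n. smooth_kernel (e n) w) \<longlonglongrightarrow> cnj w / (w * cnj w + of_real (0\<^sup>2))"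
          unfolding smooth_kernel_def using False by (intro tendsto_intros elim) auto
        then show ?thesis using False by simp
      qed (simp add: smooth_kernel_def)
      then have "(\<lambda>n. dbar g z * smooth_kernel (e n) w) \<longlonglongrightarrow> dbar g z * (1 / w)"
        by (intro tendsto_mult tendsto_const)
      then show "(\<lambda>n. dbar g z * smooth_kernel (e n) (\<zeta> - z)) \<longlonglongrightarrow> dbar g z / (\<zeta> - z)"
        by (simp add: w_def)
    qed
  qed measurable
  moreover have "(\<lambda>n. \<integral>u. g (\<zeta> + e n *\<^sub>R u) * of_real (bump u) \<partial>lborel) \<longlonglongrightarrow> (\<integral>u. g \<zeta> * of_real (bump u) \<partial>lborel)"
  proof -
    have "bounded (range g)"
    proof -
      have "bounded (g ` cbox (Complex (-R) (-R)) (Complex R R))"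
        by (intro compact_imp_bounded compact_continuous_image continuous_on_subset[OF gc]) auto
      then have "bounded (insert 0 (g ` cbox (Complex (-R) (-R)) (Complex R R)))" by simp
      then show ?thesis
      proof (rule bounded_subset, intro subsetI)
        fix y assume "y \<in> range g"
        then obtain z where "y = g z" by auto
        then show "y \<in> insert 0 (g ` cbox (Complex (-R) (-R)) (Complex R R))"
          using assms(3)[of z] out[of z] by (cases "norm z > R") auto
      qed
    qed
    then obtain B where B: "norm (g z) \<le> B" for z by (auto simp: bounded_iff)
    have [measurable]: "bump \<in> borel_measurable borel" using integrable_bump by auto
    have [measurable]: "g \<in> borel_measurable borel" by (rule borel_measurable_continuous_onI[OF gc])
    show ?thesis
    proof (rule integral_dominated_convergence)
      show "integrable lborel (\<lambda>u. B * bump u)" using integrable_bump by simp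
      show "AE u in lborel. norm (g (\<zeta> + e n *\<^sub>R u) * of_real (bump u)) \<le> B * bump u" for n
      proof (intro AE_I2)
        fix u
        have "bump u \<ge> 0" by (simp add: bump_def)
        then show "norm (g (\<zeta> + e n *\<^sub>R u) * of_real (bump u)) \<le> B * bump u"
          unfolding norm_mult norm_of_real by (simp add: mult_right_mono[OF B])
      qed
      have "isCont g \<zeta>" using gc by (simp add: continuous_on_eq_continuous_at)
      then have "(\<lambda>n. g (\<zeta> + e n *\<^sub>R u)) \<longlonglongrightarrow> g \<zeta>" for u
        by (rule isCont_tendsto_compose) (auto intro!: tendsto_eq_intros elim)
      then show "AE u in lborel. (\<lambda>n. g (\<zeta> + e n *\<^sub>R u) * of_real (bump u)) \<longlonglongrightarrow> g \<zeta> * of_real (bump u)"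
        by (intro AE_I2 tendsto_intros)
    qed measurable
  qed
  moreover have "(\<integral>u. g \<zeta> * of_real (bump u) \<partial>lborel) = of_real pi * g \<zeta>"
    using integrable_bump by (simp add: integral_bump)
  moreover have "(\<integral>z. dbar g z * smooth_kernel (e n) (\<zeta> - z) \<partial>lborel)
      = (\<integral>u. g (\<zeta> + e n *\<^sub>R u) * of_real (bump u) \<partial>lborel)" for n
    by (rule integral_dbar_smooth_kernel[OF e diff cont assms(3)])
  ultimately show "(\<integral>z. dbar g z / (\<zeta> - z) \<partial>lborel) = of_real pi * g \<zeta>"
    by (simp only: LIMSEQ_unique)
qed

section \<open>Poisson kernels and tempered growth\<close>

lemma poisson_nonneg: "y > 0 \<Longrightarrow> poisson x y \<ge> 0"
  by (simp add: poisson_def)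

lemma continuous_on_poisson: "y > 0 \<Longrightarrow> continuous_on UNIV (\<lambda>t. poisson (x - t) y)"
  unfolding poisson_def by (intro continuous_intros) (auto simp: add_nonneg_eq_0_iff)

lemma poisson_integral_kernel:
  assumes y: "y > 0"
  shows "integrable lborel (\<lambda>t. poisson (x - t) y)" "(\<integral>t. poisson (x - t) y \<partial>lborel) = pi"
proof -
  have nn: "(\<integral>\<^sup>+t. ennreal (poisson (x - t) y) \<partial>lborel) = ennreal (pi / 2 - (- (pi / 2)))"
  proof (rule nn_integral_real_line_FTC)
    show "((\<lambda>t. arctan ((t - x) / y)) has_real_derivative poisson (x - t) y) (at t)" for t
    proof -
      have "((\<lambda>t. arctan ((t - x) / y)) has_real_derivative inverse (1 + ((t - x) / y)\<^sup>2) * (1 / y)) (at t)"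
        using y by (auto intro!: derivative_eq_intros)
      also have "inverse (1 + ((t - x) / y)\<^sup>2) * (1 / y) = poisson (x - t) y"
      proof -
        have "1 + ((t - x) / y)\<^sup>2 = ((x - t)\<^sup>2 + y\<^sup>2) / y\<^sup>2"
          using y by (simp add: power_divide add_divide_distrib power2_commute)
        then show ?thesis using y by (simp add: poisson_def power2_eq_square)
      qed
      finally show ?thesis .
    qed
    show "((\<lambda>t. arctan ((t - x) / y)) \<longlongrightarrow> - (pi / 2)) at_bot" "((\<lambda>t. arctan ((t - x) / y)) \<longlongrightarrow> pi / 2) at_top"
      using y by real_asymp+
  qed (use y in \<open>auto intro!: continuous_on_poisson poisson_nonneg\<close>)
  have [measurable]: "(\<lambda>t. poisson (x - t) y) \<in> borel_measurable borel"
    by (intro borel_measurable_continuous_onI continuous_on_poisson y)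
  show "integrable lborel (\<lambda>t. poisson (x - t) y)"
    by (intro integrableI_nonneg) (auto simp: nn poisson_nonneg y)
  show "(\<integral>t. poisson (x - t) y \<partial>lborel) = pi"
    by (subst integral_eq_nn_integral) (auto simp: nn poisson_nonneg y)
qed

text \<open>Subtracting \<open>g z0\<close> removes the pole at \<open>z0\<close>, so the difference quotient \<open>Q\<close> has a primitive, whose
  increment from \<open>-R\<close> to \<open>R\<close> is estimated along the two sides of the triangle through \<open>i R\<close>.\<close>

lemma poisson_representation:
  assumes d: "\<delta> > 0" and hol: "g holomorphic_on {z. Im z > -\<delta>}"
    and M: "\<And>z. Im z > -\<delta> \<Longrightarrow> norm (g z) \<le> M" and y: "Im z0 > 0"
  shows "integrable lborel (\<lambda>t. g (of_real t) * of_real (poisson (Re z0 - t) (Im z0)))" (is "integrable _ ?f")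
    and "(\<integral>t. g (of_real t) * of_real (poisson (Re z0 - t) (Im z0)) \<partial>lborel) = of_real pi * g z0"
proof -
  define P where "P = (\<lambda>t. poisson (Re z0 - t) (Im z0))"
  have P0: "P t \<ge> 0" for t using y by (simp add: P_def poisson_nonneg)
  have intP: "integrable lborel P" "(\<integral>t. P t \<partial>lborel) = pi"
    using poisson_integral_kernel[OF y] by (simp_all add: P_def)
  have [measurable]: "P \<in> borel_measurable borel" using intP(1) by auto
  \<comment> \<open>Keeping \<open>e\<close> below Im z0 leaves \<open>cnj z0\<close>, the other
    zero of the denominator, outside \<open>H\<close>.\<close>
  define e H where "e = min \<delta> (Im z0 / 2)" and "H = {z. Im z > -e}"
  have e: "e > 0" "e \<le> \<delta>" "e < Im z0" using d y by (auto simp: e_def)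
  have H: "open H" "convex H" 
    using open_halfspace_Im_gt[of "-e"] convex_halfspace_Im_gt[of "-e"] by (simp_all add: H_def)
  have holH: "g holomorphic_on H" by (rule holomorphic_on_subset[OF hol]) (use e in \<open>auto simp: H_def\<close>)
  have MH: "norm (g z) \<le> M" if "z \<in> H" for z using M e that by (auto simp: H_def)
  have z0H: "z0 \<in> H" using e y by (simp add: H_def)
  have M0: "M \<ge> 0" using MH[OF z0H] norm_ge_zero order_trans by blast
  have realH: "complex_of_real t \<in> H" for t using e by (simp add: H_def)
  have gc: "continuous_on UNIV (\<lambda>t. g (of_real t))"
    by (rule continuous_on_compose2[OF holomorphic_on_imp_continuous_on[OF holH]])
       (auto intro!: continuous_intros simp: realH)
  have [measurable]: "(\<lambda>t. g (of_real t)) \<in> borel_measurable borel"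
    by (rule borel_measurable_continuous_onI[OF gc])
  have intgP: "integrable lborel (\<lambda>t. g (of_real t) * of_real (P t))"
  proof (rule Bochner_Integration.integrable_bound)
    show "integrable lborel (\<lambda>t. M * P t)" using intP by simp
    show "AE t in lborel. norm (g (of_real t) * of_real (P t)) \<le> norm (M * P t)"
      using MH[OF realH] M0 P0 by (intro AE_I2) (simp add: norm_mult mult_right_mono)
  qed measurable
  then show "integrable lborel ?f" by (simp add: P_def)
  define r where "r = (\<lambda>z. if z = z0 then deriv g z0 else g z / (z - z0) - g z0 / (z - z0))"
  have rhol: "r holomorphic_on H"
    unfolding r_def by (rule pole_theorem_open[OF holH H(1)]) auto
  have cz: "z \<noteq> cnj z0" if "z \<in> H" for z using that e by (auto simp: H_def)
  define Q where "Q = (\<lambda>z. r z / (z - cnj z0))"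
  have Qhol: "Q holomorphic_on H"
    unfolding Q_def using cz by (intro holomorphic_intros rhol) auto
  obtain A where A: "\<And>z. z \<in> H \<Longrightarrow> (A has_field_derivative Q z) (at z)"
    using holomorphic_convex_primitive'[OF H(2) H(1) Qhol] by (auto simp: at_within_open[OF _ H(1)])
  \<comment> \<open>Beyond 2 |z0| both factors of the denominator are at least |z|/2, and the
    numerator is at most 2 M.\<close>
  have Qbound: "norm (Q z) \<le> 8 * M / (norm z)\<^sup>2" if "z \<in> H" "norm z \<ge> 2 * norm z0" "z \<noteq> 0" for z
  proof -
    have n: "norm (z - z0) \<ge> norm z / 2" "norm (z - cnj z0) \<ge> norm z / 2"
      using that norm_triangle_ineq2[of z z0] norm_triangle_ineq2[of z "cnj z0"] by auto
    have pos: "norm z > 0" using that by simp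
    then have "z \<noteq> z0" using that by (auto simp: norm_minus_commute)
    then have "Q z = (g z - g z0) / ((z - z0) * (z - cnj z0))"
      by (simp add: Q_def r_def diff_divide_distrib)
    then have "norm (Q z) = norm (g z - g z0) / (norm (z - z0) * norm (z - cnj z0))"
      by (simp add: norm_divide norm_mult)
    also have "\<dots> \<le> (2 * M) / (norm z / 2 * (norm z / 2))"
    proof (rule frac_le)
      show "norm (g z - g z0) \<le> 2 * M"
        using norm_triangle_ineq4[of "g z" "g z0"] MH[OF that(1)] MH[OF z0H] by linarith
      show "norm z / 2 * (norm z / 2) \<le> norm (z - z0) * norm (z - cnj z0)"
        using n by (intro mult_mono) auto
    qed (use pos M0 in auto)
    also have "\<dots> = 8 * M / (norm z)\<^sup>2" by (simp add: power2_eq_square)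
    finally show ?thesis .
  qed
  \<comment> \<open>On such a segment |z| is at least R/2, hence at least 2 |z0|, and the bound for
    \<open>Q\<close> becomes 32 M / R^2.\<close>
  have step: "norm (A a - A b) \<le> 32 * M / R\<^sup>2 * norm (a - b)"
    if R: "R > 0" "R \<ge> 4 * norm z0" and seg: "closed_segment a b \<subseteq> {z. Im z \<ge> 0 \<and> R \<le> \<bar>Re z\<bar> + Im z}" for a b R
  proof (rule field_differentiable_bound[where S="closed_segment a b"])
    fix z assume z: "z \<in> closed_segment a b"
    then have zz: "Im z \<ge> 0" "R \<le> \<bar>Re z\<bar> + Im z" using seg by auto
    then have zH: "z \<in> H" using e by (simp add: H_def)
    show "(A has_field_derivative Q z) (at z within closed_segment a b)"
      by (rule has_field_derivative_at_within[OF A[OF zH]])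
    have n: "norm z \<ge> R / 2" using zz abs_Re_le_cmod[of z] abs_Im_le_cmod[of z] by linarith
    then have "norm (Q z) \<le> 8 * M / (norm z)\<^sup>2" using R by (intro Qbound zH) auto
    also have "\<dots> \<le> 8 * M / (R / 2)\<^sup>2"
      using n R M0 by (intro divide_left_mono power_mono mult_pos_pos zero_less_power) auto
    also have "\<dots> = 32 * M / R\<^sup>2" by (simp add: power2_eq_square)
    finally show "norm (Q z) \<le> 32 * M / R\<^sup>2" .
  qed auto
  \<comment> \<open>Two sides of length at most 2 R contribute 64 M / R each.\<close>
  have diffA: "norm (A (of_real R) - A (of_real (-R))) \<le> 128 * M / R" if R: "R > 0" "R \<ge> 4 * norm z0" for R
  proof -
    have cs: "closed_segment (of_real R) (\<i> * of_real R) \<subseteq> {z. Im z \<ge> 0 \<and> R \<le> \<bar>Re z\<bar> + Im z}"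
      "closed_segment (\<i> * of_real R) (of_real (-R)) \<subseteq> {z. Im z \<ge> 0 \<and> R \<le> \<bar>Re z\<bar> + Im z}"
    proof safe
      fix z assume "z \<in> closed_segment (of_real R) (\<i> * of_real R)"
      then obtain u where u: "0 \<le> u" "u \<le> 1" "z = (1 - u) *\<^sub>R of_real R + u *\<^sub>R (\<i> * of_real R)"
        by (auto simp: closed_segment_def)
      have "Re z = R - u * R" "Im z = u * R" unfolding u(3) by (simp_all add: algebra_simps)
      moreover have "u * R \<ge> 0" using u R by simp
      ultimately show "Im z \<ge> 0" "R \<le> \<bar>Re z\<bar> + Im z" by linarith+
    next
      fix z assume "z \<in> closed_segment (\<i> * of_real R) (of_real (-R))"
      then obtain u where u: "0 \<le> u" "u \<le> 1" "z = (1 - u) *\<^sub>R (\<i> * of_real R) + u *\<^sub>R of_real (-R)"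
        by (auto simp: closed_segment_def)
      have "Re z = - (u * R)" "Im z = R - u * R" unfolding u(3) by (simp_all add: algebra_simps)
      moreover have "u * R \<le> 1 * R" using u R by (intro mult_right_mono) auto
      ultimately show "Im z \<ge> 0" "R \<le> \<bar>Re z\<bar> + Im z" by linarith+
    qed
    have nn: "norm (of_real R - \<i> * of_real R) \<le> 2 * R" "norm (\<i> * of_real R - of_real (-R)) \<le> 2 * R"
      using R norm_triangle_ineq4[of "of_real R" "\<i> * of_real R"] norm_triangle_ineq4[of "\<i> * of_real R" "of_real (-R)"]
      by (auto simp: norm_mult)
    have "norm (A (of_real R) - A (of_real (-R)))
       \<le> norm (A (of_real R) - A (\<i> * of_real R)) + norm (A (\<i> * of_real R) - A (of_real (-R)))"
      using norm_triangle_ineq[of "A (of_real R) - A (\<i> * of_real R)" "A (\<i> * of_real R) - A (of_real (-R))"] by simp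
    also have "\<dots> \<le> 32 * M / R\<^sup>2 * (2 * R) + 32 * M / R\<^sup>2 * (2 * R)"
      using M0 by (intro add_mono order_trans[OF step[OF R cs(1)]] order_trans[OF step[OF R cs(2)]] mult_left_mono nn) auto
    also have "\<dots> = 128 * M / R" using R by (simp add: power2_eq_square)
    finally show ?thesis .
  qed
  \<comment> \<open>For real t the denominator (t - z0)(t - cnj z0) is |t - z0|^2, which is how the
    Poisson kernel enters.\<close>
  have Qeq: "Q (of_real t) = (g (of_real t) - g z0) * of_real (P t) / of_real (Im z0)" for t
  proof -
    have ne: "of_real t \<noteq> z0" using y by auto
    have "(of_real t - z0) * (of_real t - cnj z0) = of_real ((Re z0 - t)\<^sup>2 + (Im z0)\<^sup>2)"
      by (simp add: complex_eq_iff power2_eq_square algebra_simps)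
    moreover have "Q (of_real t) = (g (of_real t) - g z0) / ((of_real t - z0) * (of_real t - cnj z0))"
      using ne by (simp add: Q_def r_def diff_divide_distrib)
    ultimately show ?thesis using y by (simp add: P_def poisson_def)
  qed
  have intQ: "integrable lborel (\<lambda>t. Q (of_real t))"
    unfolding Qeq left_diff_distrib diff_divide_distrib using intgP intP
    by (intro Bochner_Integration.integrable_diff integrable_divide integrable_mult_right integrable_of_real) auto
  have "(\<lambda>n. \<integral>t. indicator {- real n..real n} t *\<^sub>R Q (of_real t) \<partial>lborel) \<longlonglongrightarrow> (\<integral>t. Q (of_real t) \<partial>lborel)"
  proof (rule integral_dominated_convergence)
    show "integrable lborel (\<lambda>t. norm (Q (of_real t)))" by (rule integrable_norm[OF intQ])
    show "AE t in lborel. (\<lambda>n. indicator {- real n..real n} t *\<^sub>R Q (of_real t)) \<longlonglongrightarrow> Q (of_real t)"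
    proof (intro AE_I2 tendsto_eventually)
      fix t :: real
      have "eventually (\<lambda>n. real n \<ge> \<bar>t\<bar>) sequentially"
        by (rule eventually_sequentiallyI[of "nat \<lceil>\<bar>t\<bar>\<rceil>"]) linarith
      then show "\<forall>\<^sub>F n in sequentially. indicator {- real n..real n} t *\<^sub>R Q (of_real t) = Q (of_real t)"
        by eventually_elim (auto simp: indicator_def)
    qed
  qed (use intQ in \<open>auto simp: indicator_def\<close>)
  moreover have "(\<integral>t. indicator {- real n..real n} t *\<^sub>R Q (of_real t) \<partial>lborel) = A (of_real (real n)) - A (of_real (- real n))" for n
  proof (rule integral_FTC_atLeastAtMost)
    show "((\<lambda>t. A (of_real t)) has_vector_derivative Q (of_real t)) (at t within {- real n..real n})" for t
      using field_vector_diff_chain_at[OF has_vector_derivative_of_real[OF DERIV_ident] A[OF realH], of t]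
      by (simp add: o_def has_vector_derivative_at_within)
    show "continuous_on {- real n..real n} (\<lambda>t. Q (of_real t))"
      by (rule continuous_on_compose2[OF holomorphic_on_imp_continuous_on[OF Qhol]])
        (auto intro!: continuous_intros simp: realH)
  qed simp
  ultimately have "(\<lambda>n. A (of_real (real n)) - A (of_real (- real n))) \<longlonglongrightarrow> (\<integral>t. Q (of_real t) \<partial>lborel)"
    by simp
  moreover have "(\<lambda>n. A (of_real (real n)) - A (of_real (- real n))) \<longlonglongrightarrow> 0"
  proof (rule Lim_null_comparison)
    show "(\<lambda>n. 128 * M / real n) \<longlonglongrightarrow> 0" by (rule lim_const_over_n)
    show "\<forall>\<^sub>F n in sequentially. norm (A (of_real (real n)) - A (of_real (- real n))) \<le> 128 * M / real n"
    proof (rule eventually_sequentiallyI[of "Suc (nat \<lceil>4 * norm z0\<rceil>)"])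
      fix n assume "Suc (nat \<lceil>4 * norm z0\<rceil>) \<le> n"
      then have "real n > 0" "real n \<ge> 4 * norm z0" by linarith+
      then show "norm (A (of_real (real n)) - A (of_real (- real n))) \<le> 128 * M / real n"
        by (rule diffA)
    qed
  qed
  ultimately have "(\<integral>t. Q (of_real t) \<partial>lborel) = 0" by (rule LIMSEQ_unique)
  then have "(\<integral>t. g (of_real t) * of_real (P t) - g z0 * of_real (P t) \<partial>lborel) = 0"
    unfolding Qeq left_diff_distrib using y by simp
  then have "(\<integral>t. g (of_real t) * of_real (P t) \<partial>lborel) = (\<integral>t. g z0 * of_real (P t) \<partial>lborel)"
    using Bochner_Integration.integral_diff[OF intgP, of "\<lambda>t. g z0 * of_real (P t)"] intP by simp
  also have "\<dots> = of_real pi * g z0" using intP by simp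
  finally show "(\<integral>t. g (of_real t) * of_real (poisson (Re z0 - t) (Im z0)) \<partial>lborel) = of_real pi * g z0"
    by (simp add: P_def)
qed

section \<open>Slices of functions of tempered growth\<close>

lemma H_tg_bounded:
  assumes "h \<in> H_tg" "s > 0"
  obtains M where "\<And>z. Im z \<ge> s \<Longrightarrow> norm (h z) \<le> M"
proof -
  obtain C N where C: "\<And>z. Im z > 0 \<Longrightarrow> norm (h z) \<le> C / Im z ^ N"
    using assms by (auto simp: H_tg_def)
  have "0 \<le> norm (h \<i>)" by simp
  also have "\<dots> \<le> C" using C[of \<i>] by simp
  finally have C0: "C \<ge> 0" .
  have "norm (h z) \<le> C / s ^ N" if "Im z \<ge> s" for z
  proof -
    have "C / Im z ^ N \<le> C / s ^ N"
      using that assms(2) C0 by (intro divide_left_mono power_mono mult_pos_pos zero_less_power) auto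
    then show ?thesis using C[of z] that assms(2) by linarith
  qed
  then show ?thesis by (rule that)
qed

text \<open>Shifting by \<open>s\<close> makes \<open>h\<close> holomorphic and bounded across the
  real axis. Only half of the shift serves as margin, because tempered growth bounds
  \<open>h\<close> only at a positive distance from the boundary.\<close>

lemma H_tg_poisson_slice:
  assumes h: "h \<in> H_tg" and y: "y > 0" and s: "s > 0"
  shows "integrable lborel (\<lambda>t. h (Complex t s) * of_real (poisson (x - t) y))"
    and "(\<integral>t. h (Complex t s) * of_real (poisson (x - t) y) \<partial>lborel) = of_real pi * h (Complex x (y + s))"
proof -
  define g where "g = (\<lambda>z. h (z + \<i> * of_real s))"
  obtain M where M: "\<And>z. Im z \<ge> s / 2 \<Longrightarrow> norm (h z) \<le> M"
    using H_tg_bounded[OF h, of "s/2"] s by auto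
  have hh: "h holomorphic_on Cplus" using h by (simp add: H_tg_def)
  have hol: "g holomorphic_on {z. Im z > - (s / 2)}"
    unfolding g_def by (rule holomorphic_on_compose_gen[OF _ hh, unfolded o_def])
      (use s in \<open>auto intro!: holomorphic_intros\<close>)
  have eq: "g (of_real t) = h (Complex t s)" for t by (simp add: g_def Complex_eq)
  have "norm (g z) \<le> M" if "Im z > - (s/2)" for z unfolding g_def using that by (intro M) simp
  note * = poisson_representation[OF _ hol this, of "Complex x y"]
  show "integrable lborel (\<lambda>t. h (Complex t s) * of_real (poisson (x - t) y))"
    using *(1) s y by (simp add: eq)
  show "(\<integral>t. h (Complex t s) * of_real (poisson (x - t) y) \<partial>lborel) = of_real pi * h (Complex x (y + s))"
    using *(2) s y by (simp add: eq) (simp add: g_def Complex_eq algebra_simps)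
qed

lemma bv_pairingI:
  assumes int: "\<And>s. s > 0 \<Longrightarrow> integrable lborel (\<lambda>t. g (Complex t s) * k t)"
    and lim: "((\<lambda>s. \<integral>t. g (Complex t s) * k t \<partial>lborel) \<longlongrightarrow> l) (at_right 0)"
  shows "bv_pairing_exists g k" "bv_pairing g k = l"
proof -
  have ev: "\<forall>\<^sub>F s::real in at_right 0. s > 0" by (rule eventually_at_right_less)
  have eq: "(LINT t|lebesgue. g (Complex t s) * k t) = (\<integral>t. g (Complex t s) * k t \<partial>lborel)"
    and I: "integrable lebesgue (\<lambda>t. g (Complex t s) * k t)" if "s > 0" for s
    using borel_measurable_integrable[OF int[OF that]] int[OF that]
    by (auto intro!: integral_completion simp: integrable_completion)
  have "((\<lambda>s. LINT t|lebesgue. g (Complex t s) * k t) \<longlongrightarrow> l) (at_right 0)"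
    using lim by (rule Lim_transform_eventually) (use ev in eventually_elim, simp add: eq)
  moreover have "\<forall>\<^sub>F s in at_right 0. integrable lebesgue (\<lambda>t. g (Complex t s) * k t)"
    using ev by eventually_elim (rule I)
  ultimately show "bv_pairing_exists g k" "bv_pairing g k = l"
    unfolding bv_pairing_exists_def bv_pairing_def by (auto intro: tendsto_Lim)
qed

lemma holomorphic_tendsto_vertical:
  assumes hh: "h holomorphic_on Cplus" and y: "y > 0"
  shows "((\<lambda>s. h (Complex x (y + s))) \<longlongrightarrow> h (Complex x y)) (at_right 0)"
proof -
  have "open Cplus" by (rule open_halfspace_Im_gt)
  then have "isCont h (Complex x y)"
    using holomorphic_on_imp_continuous_on[OF hh] y by (auto simp: continuous_on_eq_continuous_at)
  moreover have "((\<lambda>s. Complex x (y + s)) \<longlongrightarrow> Complex x (y + 0)) (at_right 0)"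
    unfolding Complex_eq by (intro tendsto_intros)
  ultimately show ?thesis by (intro isCont_tendsto_compose[of _ h]) auto
qed

text \<open>The Poisson kernel has no compact support, so this pairing is not an instance of
  \<open>has_distr_bv\<close>; it converges because each slice integral is exactly \<pi> h(x + i(y +
  s)).\<close>

lemma bv_pairing_poisson:
  assumes h: "h \<in> H_tg" and y: "y > 0"
  shows "bv_pairing_exists h (\<lambda>t. of_real (poisson (x - t) y))"
    "bv_pairing h (\<lambda>t. of_real (poisson (x - t) y)) = of_real pi * h (Complex x y)"
proof -
  have hh: "h holomorphic_on Cplus" using h by (simp add: H_tg_def)
  have "((\<lambda>s. \<integral>t. h (Complex t s) * of_real (poisson (x - t) y) \<partial>lborel) \<longlongrightarrow> of_real pi * h (Complex x y)) (at_right 0)"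
  proof (rule Lim_transform_eventually)
    show "((\<lambda>s. of_real pi * h (Complex x (y + s))) \<longlongrightarrow> of_real pi * h (Complex x y)) (at_right 0)"
      by (intro tendsto_intros holomorphic_tendsto_vertical hh y)
    show "\<forall>\<^sub>F s in at_right 0. of_real pi * h (Complex x (y + s)) = (\<integral>t. h (Complex t s) * of_real (poisson (x - t) y) \<partial>lborel)"
      using eventually_at_right_less[of 0] by eventually_elim (simp add: H_tg_poisson_slice(2)[OF h y])
  qed
  note * = bv_pairingI[OF H_tg_poisson_slice(1)[OF h y] this]
  show "bv_pairing_exists h (\<lambda>t. of_real (poisson (x - t) y))" by (rule *(1))
  show "bv_pairing h (\<lambda>t. of_real (poisson (x - t) y)) = of_real pi * h (Complex x y)" by (rule *(2))
qed

text \<open>Taking imaginary parts commutes with integration against a real kernel, and evenness in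
  t identifies this kernel with the case x = 0, y = 1.\<close>

lemma bv_pairing_Im_poisson:
  assumes h: "h \<in> H_tg"
  shows "bv_pairing_exists (\<lambda>z. of_real (Im (h z))) (\<lambda>t. of_real (poisson t 1))"
    "bv_pairing (\<lambda>z. of_real (Im (h z))) (\<lambda>t. of_real (poisson t 1)) = of_real (pi * Im (h \<i>))"
proof -
  have hh: "h holomorphic_on Cplus" using h by (simp add: H_tg_def)
  have eq: "complex_of_real (Im (h (Complex t s))) * of_real (poisson t 1) = of_real (Im (h (Complex t s) * of_real (poisson (0 - t) 1)))" for t s
    by (simp add: poisson_def)
  have int: "integrable lborel (\<lambda>t. complex_of_real (Im (h (Complex t s))) * of_real (poisson t 1))" if "s > 0" for s
    unfolding eq using H_tg_poisson_slice(1)[OF h zero_less_one that, of 0]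
    by (intro integrable_of_real integrable_Im)
  have "((\<lambda>s. \<integral>t. complex_of_real (Im (h (Complex t s))) * of_real (poisson t 1) \<partial>lborel) \<longlongrightarrow> of_real (pi * Im (h \<i>))) (at_right 0)"
  proof (rule Lim_transform_eventually)
    show "((\<lambda>s. of_real (pi * Im (h (Complex 0 (1 + s))))) \<longlongrightarrow> complex_of_real (pi * Im (h \<i>))) (at_right 0)"
      using holomorphic_tendsto_vertical[OF hh zero_less_one, of 0]
      by (intro tendsto_intros) (simp add: imaginary_unit.code)
    show "\<forall>\<^sub>F s in at_right 0. of_real (pi * Im (h (Complex 0 (1 + s)))) = (\<integral>t. complex_of_real (Im (h (Complex t s))) * of_real (poisson t 1) \<partial>lborel)"
      using eventually_at_right_less[of 0]
    proof eventually_elim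
      case (elim s)
      have "(\<integral>t. complex_of_real (Im (h (Complex t s))) * of_real (poisson t 1) \<partial>lborel)
        = of_real (Im (\<integral>t. h (Complex t s) * of_real (poisson (0 - t) 1) \<partial>lborel))"
        unfolding eq using H_tg_poisson_slice(1)[OF h zero_less_one elim, of 0] by (simp only: integral_complex_of_real integral_Im)
      then show ?case using H_tg_poisson_slice(2)[OF h zero_less_one elim, of 0] by simp
    qed
  qed
  note * = bv_pairingI[OF int this]
  show "bv_pairing_exists (\<lambda>z. of_real (Im (h z))) (\<lambda>t. of_real (poisson t 1))" by (rule *(1))
  show "bv_pairing (\<lambda>z. of_real (Im (h z))) (\<lambda>t. of_real (poisson t 1)) = of_real (pi * Im (h \<i>))" by (rule *(2))
qed

section \<open>Distributional boundary values\<close>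

lemma C_k_continuous: "C_k k g \<Longrightarrow> continuous_on UNIV g"
  by (cases k) (auto simp: continuous_on_eq_continuous_within intro: differentiable_imp_continuous_within)

lemma test_functions_differentiable: "\<phi> \<in> test_functions \<Omega> \<Longrightarrow> \<phi> differentiable (at x)"
  unfolding test_functions_def by (metis (mono_tags, lifting) C_k.simps(2) mem_Collect_eq)

lemma test_functions_continuous: "\<phi> \<in> test_functions \<Omega> \<Longrightarrow> continuous_on UNIV \<phi>"
  unfolding test_functions_def by (auto intro: C_k_continuous)

lemma test_functions_frechet_derivative:
  assumes "\<phi> \<in> test_functions \<Omega>"
  shows "(\<lambda>x. frechet_derivative \<phi> (at x) v) \<in> test_functions \<Omega>" (is "?d \<in> _")
proof -
  let ?S = "closure {x. \<phi> x \<noteq> 0}"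
  have \<phi>: "\<And>k. C_k k \<phi>" "compact ?S" "?S \<subseteq> \<Omega>"
    using assms by (auto simp: test_functions_def)
  have "C_k k ?d" for k using \<phi>(1)[of "Suc k"] by simp
  moreover have "?d x = 0" if "x \<notin> ?S" for x
  proof -
    have "(\<phi> has_derivative (\<lambda>_. 0)) (at x)"
      using that closure_subset[of "{x. \<phi> x \<noteq> 0}"]
      by (intro has_derivative_transform_within_open[OF has_derivative_const, of "- ?S" x 0 \<phi>]) auto
    then show ?thesis by (simp add: frechet_derivative_at[symmetric])
  qed
  then have sub: "closure {x. ?d x \<noteq> 0} \<subseteq> ?S" by (intro closure_minimal) auto
  moreover have "compact (closure {x. ?d x \<noteq> 0})"
    using \<phi>(2) sub by (metis closed_closure compact_Int_closed inf.absorb_iff2)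
  ultimately show ?thesis using \<phi>(3) by (auto simp: test_functions_def)
qed

lemma test_functions_bounded_support:
  assumes "\<phi> \<in> test_functions \<Omega>"
  obtains R where "\<And>x. norm x > R \<Longrightarrow> \<phi> x = 0"
proof -
  have "bounded (closure {x. \<phi> x \<noteq> 0})"
    using assms by (auto simp: test_functions_def compact_imp_bounded)
  then obtain R where "\<And>x. x \<in> closure {x. \<phi> x \<noteq> 0} \<Longrightarrow> norm x \<le> R" by (auto simp: bounded_iff)
  then show ?thesis using that[of R] closure_subset[of "{x. \<phi> x \<noteq> 0}"]
    by (metis (mono_tags, lifting) mem_Collect_eq not_less subset_iff)
qed

text \<open>The ordinary derivative, expressed through \<open>frechet_derivative\<close> to match
  the directional derivatives in \<open>C_k\<close>.\<close>

definition real_deriv :: "(real \<Rightarrow> complex) \<Rightarrow> real \<Rightarrow> complex" where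
  "real_deriv \<phi> t = frechet_derivative \<phi> (at t) 1"

lemma real_deriv_test_function: "\<phi> \<in> test_functions UNIV \<Longrightarrow> real_deriv \<phi> \<in> test_functions UNIV"
  unfolding real_deriv_def[abs_def] by (rule test_functions_frechet_derivative)

lemma has_vector_derivative_real_deriv:
  assumes "\<phi> \<in> test_functions UNIV" shows "(\<phi> has_vector_derivative real_deriv \<phi> t) (at t)"
proof -
  have D: "(\<phi> has_derivative frechet_derivative \<phi> (at t)) (at t)"
    using test_functions_differentiable[OF assms, of t] by (simp add: frechet_derivative_works)
  have "frechet_derivative \<phi> (at t) = (\<lambda>x. x *\<^sub>R real_deriv \<phi> t)"
  proof
    fix x
    have "frechet_derivative \<phi> (at t) (x *\<^sub>R 1) = x *\<^sub>R real_deriv \<phi> t"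
      unfolding real_deriv_def by (rule linear_scale[OF has_derivative_linear[OF D]])
    then show "frechet_derivative \<phi> (at t) x = x *\<^sub>R real_deriv \<phi> t" by (simp only: real_scaleR_def mult_1_right)
  qed
  with D show ?thesis by (simp add: has_vector_derivative_def)
qed

text \<open>The function \<open>F\<^sub>\<phi>(s)\<close> of the overview.\<close>

definition slice_pairing :: "(complex \<Rightarrow> complex) \<Rightarrow> (real \<Rightarrow> complex) \<Rightarrow> real \<Rightarrow> complex" where
  "slice_pairing h \<phi> s = (\<integral>t. h (Complex t s) * \<phi> t \<partial>lborel)"

lemma continuous_on_Complex_slice:
  fixes h :: "complex \<Rightarrow> complex"
  assumes "continuous_on Cplus h" "s > 0"
  shows "continuous_on UNIV (\<lambda>t. h (Complex t s))"
  by (rule continuous_on_compose2[OF assms(1)])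
     (use assms(2) in \<open>auto simp: Complex_eq intro!: continuous_intros\<close>)

lemma integrable_slice:
  fixes h :: "complex \<Rightarrow> complex"
  assumes "continuous_on Cplus h" "s > 0" "\<phi> \<in> test_functions UNIV"
  shows "integrable lborel (\<lambda>t. h (Complex t s) * \<phi> t)"
proof -
  obtain R where R: "\<And>t. norm t > R \<Longrightarrow> \<phi> t = 0"
    using test_functions_bounded_support[OF assms(3)] by blast
  show ?thesis
  proof (rule integrable_compact_support)
    show "continuous_on UNIV (\<lambda>t. h (Complex t s) * \<phi> t)"
      by (intro continuous_intros continuous_on_Complex_slice assms test_functions_continuous[OF assms(3)])
    show "h (Complex t s) * \<phi> t = 0" if "t \<notin> cbox (-R) R" for t
    proof -
      have "norm t > R" using that by (auto simp: abs_if)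
      then show ?thesis using R by simp
    qed
  qed
qed

text \<open>Holomorphy turns the s-derivative of h(t + is) into i times its t-derivative, and
  integration by parts moves the latter to \<phi>.\<close>

lemma slice_pairing_has_vector_derivative:
  assumes h: "h holomorphic_on Cplus" and \<phi>: "\<phi> \<in> test_functions UNIV" and s: "s > 0"
  shows "(slice_pairing h \<phi> has_vector_derivative (- (\<i> * slice_pairing h (real_deriv \<phi>) s))) (at s)"
proof -
  have oC: "open Cplus" by (rule open_halfspace_Im_gt)
  obtain R where R: "\<And>t. norm t > R \<Longrightarrow> \<phi> t = 0"
    using test_functions_bounded_support[OF \<phi>] by blast
  have hc: "continuous_on Cplus h" by (rule holomorphic_on_imp_continuous_on[OF h])
  have h': "deriv h holomorphic_on Cplus" by (rule holomorphic_deriv[OF h oC])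
  have h'c: "continuous_on Cplus (deriv h)" by (rule holomorphic_on_imp_continuous_on[OF h'])
  have \<phi>c: "continuous_on UNIV \<phi>" by (rule test_functions_continuous[OF \<phi>])
  have hd: "(h has_field_derivative deriv h z) (at z)" if "z \<in> Cplus" for z
    using holomorphic_derivI[OF h oC that] .
  \<comment> \<open>Restriction to a compact interval prepares differentiation under the integral
    sign.\<close>
  have eq: "slice_pairing h \<phi> u = integral (cbox (-R) R) (\<lambda>t. h (Complex t u) * \<phi> t)" if "u > 0" for u
  proof -
    have "slice_pairing h \<phi> u = integral UNIV (\<lambda>t. h (Complex t u) * \<phi> t)"
      unfolding slice_pairing_def by (rule integral_lborel[symmetric]) (rule integrable_slice[OF hc that \<phi>])
    also have "\<dots> = integral UNIV (\<lambda>t. if t \<in> cbox (-R) R then h (Complex t u) * \<phi> t else 0)"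
      using R by (intro integral_cong) auto
    finally show ?thesis by (simp only: integral_restrict_UNIV)
  qed
  have "((\<lambda>u. integral (cbox (-R) R) (\<lambda>t. h (Complex t u) * \<phi> t)) has_vector_derivative
      integral (cbox (-R) R) (\<lambda>t. \<i> * deriv h (Complex t s) * \<phi> t)) (at s within {0<..})"
  proof (rule leibniz_rule_vector_derivative)
    fix u t :: real assume u: "u \<in> {0<..}"
    have "((\<lambda>u. Complex t u) has_vector_derivative \<i>) (at u)"
      unfolding Complex_eq by (auto intro!: derivative_eq_intros)
    from field_vector_diff_chain_at[OF this hd[of "Complex t u"]] u
    have "((\<lambda>u. h (Complex t u)) has_vector_derivative \<i> * deriv h (Complex t u)) (at u)"
      by (simp add: o_def)
    from has_vector_derivative_mult_left[OF this, of "\<phi> t"]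
    show "((\<lambda>u. h (Complex t u) * \<phi> t) has_vector_derivative \<i> * deriv h (Complex t u) * \<phi> t) (at u within {0<..})"
      by (rule has_vector_derivative_at_within)
  next
    fix u :: real assume "u \<in> {0<..}"
    then show "(\<lambda>t. h (Complex t u) * \<phi> t) integrable_on cbox (- R) R"
      by (intro integrable_continuous continuous_on_mult continuous_on_subset[OF continuous_on_Complex_slice[OF hc]]
           continuous_on_subset[OF \<phi>c]) auto
  next
    show "continuous_on ({0<..} \<times> cbox (- R) R) (\<lambda>(u, t). \<i> * deriv h (Complex t u) * \<phi> t)"
      unfolding case_prod_beta
      by (intro continuous_on_mult continuous_on_const continuous_on_compose2[OF h'c] continuous_on_compose2[OF \<phi>c])
         (auto simp: Complex_eq intro!: continuous_intros)
  qed (use s in auto)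
  then have 1: "(slice_pairing h \<phi> has_vector_derivative integral (cbox (-R) R) (\<lambda>t. \<i> * deriv h (Complex t s) * \<phi> t)) (at s)"
    using s by (subst (asm) at_within_open) (auto intro: has_vector_derivative_transform_within_open[where S="{0<..}"] simp: eq)
  have i1: "integrable lborel (\<lambda>t. deriv h (Complex t s) * \<phi> t)"
    by (rule integrable_slice[OF h'c s \<phi>])
  have i2: "integrable lborel (\<lambda>t. h (Complex t s) * real_deriv \<phi> t)"
    by (rule integrable_slice[OF hc s real_deriv_test_function[OF \<phi>]])
  have "integral (cbox (-R) R) (\<lambda>t. \<i> * deriv h (Complex t s) * \<phi> t)
      = integral UNIV (\<lambda>t. if t \<in> cbox (-R) R then \<i> * deriv h (Complex t s) * \<phi> t else 0)"
    by (simp only: integral_restrict_UNIV)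
  also have "\<dots> = integral UNIV (\<lambda>t. \<i> * (deriv h (Complex t s) * \<phi> t))"
    using R by (intro integral_cong) (auto simp: mult.assoc)
  also have "\<dots> = (\<integral>t. \<i> * (deriv h (Complex t s) * \<phi> t) \<partial>lborel)"
    using i1 by (intro integral_lborel) simp
  finally have 2: "integral (cbox (-R) R) (\<lambda>t. \<i> * deriv h (Complex t s) * \<phi> t) = \<i> * (\<integral>t. deriv h (Complex t s) * \<phi> t \<partial>lborel)"
    by simp
  \<comment> \<open>Integration by parts, in the form of the vanishing integral of the derivative of
    the product.\<close>
  have "(\<integral>t. deriv h (Complex t s) * \<phi> t + h (Complex t s) * real_deriv \<phi> t \<partial>lborel) = 0"
  proof (rule integral_derivative_compact_support)
    fix t
    have "((\<lambda>t. Complex t s) has_vector_derivative 1) (at t)"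
      unfolding Complex_eq by (auto intro!: derivative_eq_intros)
    from field_vector_diff_chain_at[OF this hd[of "Complex t s"]] s
    have "((\<lambda>t. h (Complex t s)) has_vector_derivative deriv h (Complex t s)) (at t)"
      by (simp add: o_def)
    from has_vector_derivative_mult[OF this has_vector_derivative_real_deriv[OF \<phi>]]
    show "((\<lambda>t. h (Complex t s) * \<phi> t) has_vector_derivative deriv h (Complex t s) * \<phi> t + h (Complex t s) * real_deriv \<phi> t) (at t)"
      by (simp add: add.commute)
  next
    show "continuous_on UNIV (\<lambda>t. deriv h (Complex t s) * \<phi> t + h (Complex t s) * real_deriv \<phi> t)"
      by (intro continuous_intros continuous_on_Complex_slice hc h'c s \<phi>c test_functions_continuous[OF real_deriv_test_function[OF \<phi>]])
  qed (use R in auto)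
  then have "(\<integral>t. deriv h (Complex t s) * \<phi> t \<partial>lborel) = - slice_pairing h (real_deriv \<phi>) s"
    unfolding slice_pairing_def using i1 i2 by (simp add: add_eq_0_iff2)
  then show ?thesis using 1 2 by simp
qed

text \<open>A mean value inequality: by \<open>slice_pairing_has_vector_derivative\<close> the
  derivative is bounded by \<open>g\<close>, of which \<open>G\<close> is a primitive.\<close>

lemma slice_pairing_increment:
  assumes h: "h holomorphic_on Cplus" and \<phi>: "\<phi> \<in> test_functions UNIV" and s: "0 < r" "r < s" "s \<le> 1"
    and bd: "\<And>u. 0 < u \<Longrightarrow> u \<le> 1 \<Longrightarrow> norm (slice_pairing h (real_deriv \<phi>) u) \<le> g u"
    and G: "\<And>u. 0 < u \<Longrightarrow> (G has_vector_derivative g u) (at u)"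
  shows "norm (slice_pairing h \<phi> s - slice_pairing h \<phi> r) \<le> G s - G r"
proof (rule differentiable_bound_general[where f'="\<lambda>u. - (\<i> * slice_pairing h (real_deriv \<phi>) u)" and \<phi>'=g])
  note D = slice_pairing_has_vector_derivative[OF h \<phi>]
  show "continuous_on {r..s} (slice_pairing h \<phi>)" "continuous_on {r..s} G"
    using s by (auto intro!: continuous_at_imp_continuous_on has_vector_derivative_continuous D G)
qed (use s bd in \<open>auto intro: slice_pairing_has_vector_derivative[OF h \<phi>] G simp: norm_mult\<close>)

text \<open>Downward induction on the exponent, from the N of tempered growth to 0, for all test
  functions at once because each step passes to the derivative of \<phi>. The offset 1/2 keeps the
  exponents off the value 1, where integration would produce a logarithm, and the final s^(-1/2) is
  integrable at 0.\<close>

lemma slice_pairing_bound: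
  assumes h: "h \<in> H_tg" and \<phi>: "\<phi> \<in> test_functions UNIV"
  shows "\<exists>C. \<forall>s. 0 < s \<and> s \<le> 1 \<longrightarrow> norm (slice_pairing h \<phi> s) \<le> C * s powr (- (1/2))"
proof -
  have hh: "h holomorphic_on Cplus" using h by (simp add: H_tg_def)
  have hc: "continuous_on Cplus h" by (rule holomorphic_on_imp_continuous_on[OF hh])
  obtain C N where C: "\<And>z. Im z > 0 \<Longrightarrow> norm (h z) \<le> C / Im z ^ N"
    using h by (auto simp: H_tg_def)
  have "\<forall>\<phi>\<in>test_functions UNIV. \<exists>C. \<forall>s. 0 < s \<and> s \<le> 1 \<longrightarrow> norm (slice_pairing h \<phi> s) \<le> C * s powr (- (real n + 1/2))"
    if "n \<le> N" for n
    using that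
  proof (induction n rule: inc_induct)
    case base
    show ?case
    proof
      fix \<phi> :: "real \<Rightarrow> complex" assume \<phi>: "\<phi> \<in> test_functions UNIV"
      obtain R where R: "\<And>t. norm t > R \<Longrightarrow> \<phi> t = 0"
        using test_functions_bounded_support[OF \<phi>] by blast
      have int\<phi>: "integrable lborel (\<lambda>t. norm (\<phi> t))"
        by (intro integrable_norm integrable_compact_support[where a="-R" and b=R] test_functions_continuous[OF \<phi>]) (use R in auto)
      define A where "A = (\<integral>t. norm (\<phi> t) \<partial>lborel)"
      have "0 \<le> norm (h \<i>)" by simp
      also have "\<dots> \<le> C" using C[of \<i>] by simp
      finally have C0: "C \<ge> 0" .
      have "norm (slice_pairing h \<phi> s) \<le> (C * A) * s powr (- (real N + 1/2))" if "0 < s" "s \<le> 1" for s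
      proof -
        have "norm (slice_pairing h \<phi> s) \<le> (\<integral>t. C / s ^ N * norm (\<phi> t) \<partial>lborel)"
          unfolding slice_pairing_def
        proof (rule order_trans[OF integral_norm_bound integral_mono])
          show "norm (h (Complex t s) * \<phi> t) \<le> C / s ^ N * norm (\<phi> t)" for t
            unfolding norm_mult using C[of "Complex t s"] that by (intro mult_right_mono) auto
        qed (use int\<phi> integrable_slice[OF hc that(1) \<phi>] in auto)
        also have "\<dots> = (C * A) * (1 / s ^ N)" by (simp add: A_def)
        also have "1 / s ^ N = s powr (- real N)" using that by (simp add: powr_minus powr_realpow divide_inverse)
        \<comment> \<open>For s at most 1 the extra s^(-1/2) only weakens the bound; it starts the
          half-integer bookkeeping.\<close>
        also have "(C * A) * s powr (- real N) \<le> (C * A) * s powr (- (real N + 1/2))"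
          using that C0 by (intro mult_left_mono powr_mono') (auto simp: A_def)
        finally show ?thesis .
      qed
      then show "\<exists>C. \<forall>s. 0 < s \<and> s \<le> 1 \<longrightarrow> norm (slice_pairing h \<phi> s) \<le> C * s powr (- (real N + 1/2))" by blast
    qed
  next
    case (step n)
    show ?case
    proof
      fix \<phi> :: "real \<Rightarrow> complex" assume \<phi>: "\<phi> \<in> test_functions UNIV"
      obtain C' where C': "\<And>s. 0 < s \<Longrightarrow> s \<le> 1 \<Longrightarrow> norm (slice_pairing h (real_deriv \<phi>) s) \<le> C' * s powr (- (real (Suc n) + 1/2))"
        using step.IH real_deriv_test_function[OF \<phi>] by blast
      have C'0: "C' \<ge> 0" using order_trans[OF norm_ge_zero C'[of 1]] by simp
      define a where "a = real n + 1/2"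
      have a: "a > 0" "- (real (Suc n) + 1/2) = - a - 1" by (auto simp: a_def)
      \<comment> \<open>An increasing primitive of C' u^(-a-1); it is the positivity of a that
        leaves a bound of order u^(-a).\<close>
      define G where "G = (\<lambda>u. - (C' / a) * u powr (- a))"
      have G: "(G has_vector_derivative C' * u powr (- a - 1)) (at u)" if "0 < u" for u
        unfolding G_def has_real_derivative_iff_has_vector_derivative[symmetric] using that a
        by (auto intro!: derivative_eq_intros)
      define K where "K = norm (slice_pairing h \<phi> 1)"
      have "norm (slice_pairing h \<phi> s) \<le> (K + C' / a) * s powr (- a)" if s: "0 < s" "s \<le> 1" for s
      proof -
        \<comment> \<open>Because s^(-a) is at least 1, the constant \<open>K\<close> from the end
          point s = 1 can be absorbed.\<close>
        have one: "1 \<le> s powr (- a)" using s a powr_mono'[of "-a" 0 s] by simp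
        have "norm (slice_pairing h \<phi> s) \<le> K + C' / a * s powr (- a)"
        proof (cases "s = 1")
          case False
          then have "norm (slice_pairing h \<phi> 1 - slice_pairing h \<phi> s) \<le> G 1 - G s"
            using s C' G by (intro slice_pairing_increment[OF hh \<phi>, where g="\<lambda>u. C' * u powr (- a - 1)"]) (auto simp flip: a(2))
          also have "\<dots> \<le> C' / a * s powr (- a)" using a C'0 by (simp add: G_def)
          finally show ?thesis
            using norm_triangle_ineq2[of "slice_pairing h \<phi> s" "slice_pairing h \<phi> 1"] 
            by (simp add: K_def norm_minus_commute)
        qed (use a C'0 in \<open>simp add: K_def\<close>)
        also have "K \<le> K * s powr (- a)" using one mult_left_mono[OF one, of K] by (simp add: K_def)
        finally show ?thesis by (simp add: algebra_simps)
      qed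
      then show "\<exists>C. \<forall>s. 0 < s \<and> s \<le> 1 \<longrightarrow> norm (slice_pairing h \<phi> s) \<le> C * s powr (- (real n + 1/2))"
        unfolding a_def by blast
    qed
  qed
  from this[of 0] \<phi> show ?thesis by simp
qed

text \<open>With a derivative bounded by C s^(-1/2), increments are controlled by those of 2 C sqrt
  s. Uniform continuity on the half-open interval then yields a limit at 0.\<close>

lemma slice_pairing_convergent:
  assumes h: "h \<in> H_tg" and \<phi>: "\<phi> \<in> test_functions UNIV"
  shows "\<exists>l. (slice_pairing h \<phi> \<longlongrightarrow> l) (at_right 0)"
proof -
  have hh: "h holomorphic_on Cplus" using h by (simp add: H_tg_def)
  obtain C where C: "\<And>s. 0 < s \<Longrightarrow> s \<le> 1 \<Longrightarrow> norm (slice_pairing h (real_deriv \<phi>) s) \<le> C * s powr (- (1/2))"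
    using slice_pairing_bound[OF h real_deriv_test_function[OF \<phi>]] by blast
  have C0: "C \<ge> 0" using order_trans[OF norm_ge_zero C[of 1]] by simp
  have G: "((\<lambda>u. 2 * C * u powr (1/2)) has_vector_derivative C * u powr (- (1/2))) (at u)" if "0 < u" for u
    unfolding has_real_derivative_iff_has_vector_derivative[symmetric] using that
    by (auto intro!: derivative_eq_intros)
  have inc: "dist (slice_pairing h \<phi> s) (slice_pairing h \<phi> r) \<le> 2 * C * dist (sqrt s) (sqrt r)" if "0 < r" "r < s" "s \<le> 1" for r s
    using slice_pairing_increment[OF hh \<phi> that C G] that
    by (simp add: dist_norm powr_half_sqrt right_diff_distrib)
  then have inc': "dist (slice_pairing h \<phi> s) (slice_pairing h \<phi> r) \<le> 2 * C * dist (sqrt s) (sqrt r)" if "r \<in> {0<..1}" "s \<in> {0<..1}" for r s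
    using that inc[of r s] inc[of s r]
    by (cases r s rule: linorder_cases) (auto simp: dist_commute)
  have "uniformly_continuous_on {0<..1} (slice_pairing h \<phi>)"
    unfolding uniformly_continuous_on_def
  proof (intro allI impI)
    fix e :: real assume e: "e > 0"
    \<comment> \<open>Used with the tolerance e / (2 C + 1), the added 1 covering C = 0.\<close>
    have "uniformly_continuous_on {0..1} sqrt" 
      by (intro compact_uniformly_continuous continuous_intros) auto
    then obtain d where d: "d > 0" "\<And>x y. x \<in> {0..1} \<Longrightarrow> y \<in> {0..1} \<Longrightarrow> dist y x < d \<Longrightarrow> dist (sqrt y) (sqrt x) < e / (2 * C + 1)"
      using e C0 unfolding uniformly_continuous_on_def by (metis add_nonneg_pos divide_pos_pos mult_nonneg_nonneg zero_le_numeral zero_less_one)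
    show "\<exists>d>0. \<forall>x\<in>{0<..1}. \<forall>x'\<in>{0<..1}. dist x' x < d \<longrightarrow> dist (slice_pairing h \<phi> x') (slice_pairing h \<phi> x) < e"
    proof (intro exI[of _ d] conjI ballI impI d(1))
      fix x y :: real assume xy: "x \<in> {0<..1}" "y \<in> {0<..1}" "dist y x < d"
      have "dist (slice_pairing h \<phi> y) (slice_pairing h \<phi> x) \<le> 2 * C * dist (sqrt y) (sqrt x)"
        using xy by (intro inc') auto
      also have "\<dots> \<le> 2 * C * (e / (2 * C + 1))"
        using xy C0 by (intro mult_left_mono less_imp_le[OF d(2)]) auto
      also have "\<dots> < e" using e C0 by (simp add: field_simps)
      finally show "dist (slice_pairing h \<phi> y) (slice_pairing h \<phi> x) < e" .
    qed
  qed
  then obtain l where "(slice_pairing h \<phi> \<longlongrightarrow> l) (at 0 within {0<..1})"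
    by (rule uniformly_continuous_on_extension_at_closure[of _ _ 0]) auto
  moreover have "at (0::real) within {0<..1} = at_right 0"
    by (rule at_within_nhd[where S="{..<1}"]) auto
  ultimately show ?thesis by auto
qed

lemma H_tg_has_distr_bv: 
  assumes "h \<in> H_tg" shows "has_distr_bv h"
  unfolding has_distr_bv_def
proof
  fix \<phi> :: "real \<Rightarrow> complex" assume \<phi>: "\<phi> \<in> test_functions UNIV"
  have hc: "continuous_on Cplus h"
    using assms by (auto simp: H_tg_def intro: holomorphic_on_imp_continuous_on)
  show "bv_pairing_exists h \<phi>"
    using slice_pairing_convergent[OF assms \<phi>] bv_pairingI(1)[of h \<phi>] integrable_slice[OF hc _ \<phi>]
    unfolding slice_pairing_def by blast
qed

section \<open>Real test functions and continuous boundary values\<close>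

lemma C_k_of_real:
  fixes g :: "real \<Rightarrow> real"
  shows "C_k k g \<Longrightarrow> C_k k (\<lambda>x. complex_of_real (g x))"
proof (induction k arbitrary: g)
  case (Suc k)
  have d: "((\<lambda>x. complex_of_real (g x)) has_derivative (\<lambda>v. of_real (frechet_derivative g (at x) v))) (at x)" for x
    using Suc.prems by (auto intro!: has_derivative_of_real simp flip: frechet_derivative_works)
  show ?case
    using Suc by (auto simp: frechet_derivative_at[OF d, symmetric] intro: differentiableI[OF d])
qed (auto intro: continuous_intros)

lemma test_functions_of_real:
  fixes \<phi> :: "real \<Rightarrow> real"
  shows "\<phi> \<in> test_functions UNIV \<Longrightarrow> (\<lambda>x. complex_of_real (\<phi> x)) \<in> test_functions UNIV"
  by (auto simp: test_functions_def intro: C_k_of_real)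

text \<open>When T is continuous up to and across the real axis, its boundary value is the ordinary
  integral along the axis: a parameter integral over a compact interval is continuous in s.\<close>

lemma slice_pairing_continuous_at_0:
  assumes T: "continuous_on UNIV T" and \<phi>: "\<phi> \<in> test_functions UNIV"
  shows "integrable lborel (\<lambda>t. T (Complex t s) * \<phi> t)"
    and "((\<lambda>s. slice_pairing T \<phi> s) \<longlongrightarrow> slice_pairing T \<phi> 0) (at_right 0)"
proof -
  obtain R where R: "\<And>t. norm t > R \<Longrightarrow> \<phi> t = 0"
    using test_functions_bounded_support[OF \<phi>] by blast
  have \<phi>c: "continuous_on UNIV \<phi>" by (rule test_functions_continuous[OF \<phi>])
  have out: "\<phi> t = 0" if "t \<notin> cbox (-R) R" for t
    using that by (intro R) (auto simp: abs_if)
  have int: "integrable lborel (\<lambda>t. T (Complex t s) * \<phi> t)" for s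
    by (rule integrable_compact_support[where a="-R" and b=R])
      (auto intro!: continuous_intros continuous_on_compose2[OF T] \<phi>c out simp: Complex_eq simp del: box_real)
  then show "integrable lborel (\<lambda>t. T (Complex t s) * \<phi> t)" .
  have eq: "slice_pairing T \<phi> u = integral (cbox (-R) R) (\<lambda>t. T (Complex t u) * \<phi> t)" for u
  proof -
    have "slice_pairing T \<phi> u = integral UNIV (\<lambda>t. T (Complex t u) * \<phi> t)"
      unfolding slice_pairing_def by (rule integral_lborel[symmetric]) (rule int)
    also have "\<dots> = integral UNIV (\<lambda>t. if t \<in> cbox (-R) R then T (Complex t u) * \<phi> t else 0)"
      using out by (intro integral_cong) auto
    finally show ?thesis by (simp only: integral_restrict_UNIV)
  qed
  have "continuous_on UNIV (\<lambda>u. integral (cbox (-R) R) (\<lambda>t. T (Complex t u) * \<phi> t))"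
    by (rule integral_continuous_on_param)
      (auto intro!: continuous_intros continuous_on_compose2[OF T] continuous_on_compose2[OF \<phi>c] simp: Complex_eq case_prod_beta)
  then have "continuous_on UNIV (slice_pairing T \<phi>)" by (simp add: eq[abs_def])
  then have "isCont (slice_pairing T \<phi>) 0" by (simp add: continuous_on_eq_continuous_at)
  then show "((\<lambda>s. slice_pairing T \<phi> s) \<longlongrightarrow> slice_pairing T \<phi> 0) (at_right 0)"
    unfolding isCont_def by (rule tendsto_within_subset) auto
qed

section \<open>The Schwarz integral\<close>

text \<open>The subtracted term does not depend on z and cancels the leading decay 1/\<zeta> of the
  Cauchy kernel.\<close>

definition schwarz_kernel :: "complex \<Rightarrow> complex \<Rightarrow> complex" where
  "schwarz_kernel z \<zeta> = 1 / (\<zeta> - z) - \<zeta> / (\<zeta>\<^sup>2 + 1)"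

lemma cnj_schwarz_kernel: "cnj (schwarz_kernel z \<zeta>) = schwarz_kernel (cnj z) (cnj \<zeta>)"
  by (simp add: schwarz_kernel_def)

text \<open>At \<zeta> = i and \<zeta> = -i division by zero returns 0 and the identity fails, hence
  the exclusions. The form \<open>\<zeta> - (- \<i>)\<close> matches the Cauchy transform at
  \<open>- \<i>\<close>.\<close>

lemma schwarz_kernel_partial_fractions:
  assumes "\<zeta> \<noteq> \<i>" "\<zeta> \<noteq> - \<i>"
  shows "schwarz_kernel z \<zeta> = 1 / (\<zeta> - z) - (1 / (\<zeta> - \<i>) + 1 / (\<zeta> - (- \<i>))) / 2"
proof -
  have "\<zeta> - \<i> \<noteq> 0" "\<zeta> + \<i> \<noteq> 0" using assms by (auto simp: add_eq_0_iff2)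
  moreover have "\<zeta>\<^sup>2 + 1 = (\<zeta> - \<i>) * (\<zeta> + \<i>)" by (simp add: algebra_simps power2_eq_square)
  ultimately have "\<zeta> / (\<zeta>\<^sup>2 + 1) = (1 / (\<zeta> - \<i>) + 1 / (\<zeta> - (- \<i>))) / 2" by (simp add: add_frac_eq)
  then show ?thesis by (simp add: schwarz_kernel_def)
qed

text \<open>At z = i and z = -i the kernel is plus and minus half the difference of 1/(\<zeta> - i)
  and 1/(\<zeta> + i).\<close>

lemma schwarz_kernel_at_i:
  assumes "\<zeta> \<noteq> \<i>" "\<zeta> \<noteq> - \<i>"
  shows "schwarz_kernel (- \<i>) \<zeta> = - schwarz_kernel \<i> \<zeta>"
proof -
  have "b - (a + b) / 2 = - (a - (a + b) / 2)" for a b :: complex by (simp add: field_simps)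
  then show ?thesis unfolding schwarz_kernel_partial_fractions[OF assms] .
qed

text \<open>Over a common denominator the kernel is (1 + \<zeta> z)/((\<zeta> - z)(\<zeta>^2 + 1)),
  degree one over degree three in \<zeta>. The constant is 2 R from the numerator divided by 1/2 for
  each factor below.\<close>

lemma norm_schwarz_kernel_le:
  assumes R: "R \<ge> 1" and z: "norm z \<le> R" and \<zeta>: "norm \<zeta> \<ge> 2 * R"
  shows "norm (schwarz_kernel z \<zeta>) \<le> 8 * R / (norm \<zeta>)\<^sup>2"
proof -
  have z2: "norm \<zeta> \<ge> 2" using R \<zeta> by linarith
  have sq: "(norm \<zeta>)\<^sup>2 \<ge> 2" using power_mono[OF z2, of 2] by simp
  have 1: "norm (\<zeta> - z) \<ge> norm \<zeta> / 2"
    using norm_triangle_ineq2[of \<zeta> z] z \<zeta> by linarith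
  have 2: "norm (\<zeta>\<^sup>2 + 1) \<ge> (norm \<zeta>)\<^sup>2 / 2"
    using norm_triangle_ineq2[of "\<zeta>\<^sup>2" "-1"] sq by (simp add: norm_power)
  have 3: "norm (1 + \<zeta> * z) \<le> 2 * R * norm \<zeta>"
  proof -
    have "norm (1 + \<zeta> * z) \<le> 1 + norm \<zeta> * norm z"
      using norm_triangle_ineq[of 1 "\<zeta> * z"] by (simp add: norm_mult)
    also have "norm \<zeta> * norm z \<le> norm \<zeta> * R" using z by (intro mult_left_mono) auto
    also have "1 \<le> R * norm \<zeta>" using R z2 mult_mono[of 1 R 1 "norm \<zeta>"] by simp
    finally show ?thesis by (simp add: algebra_simps)
  qed
  have nz: "\<zeta> - z \<noteq> 0" "\<zeta>\<^sup>2 + 1 \<noteq> 0" using 1 2 z2 sq by (auto simp: add_eq_0_iff2)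
  have "schwarz_kernel z \<zeta> = (1 + \<zeta> * z) / ((\<zeta> - z) * (\<zeta>\<^sup>2 + 1))"
    unfolding schwarz_kernel_def diff_frac_eq[OF nz] by (simp add: algebra_simps power2_eq_square)
  then have "norm (schwarz_kernel z \<zeta>) = norm (1 + \<zeta> * z) / (norm (\<zeta> - z) * norm (\<zeta>\<^sup>2 + 1))"
    by (simp add: norm_divide norm_mult)
  also have "\<dots> \<le> (2 * R * norm \<zeta>) / (norm \<zeta> / 2 * ((norm \<zeta>)\<^sup>2 / 2))"
    using 1 2 3 z2 R by (intro frac_le mult_mono mult_pos_pos) auto
  also have "\<dots> = 8 * R / (norm \<zeta>)\<^sup>2" using z2 by (simp add: power2_eq_square)
  finally show ?thesis .
qed

section \<open>Near and far parts of the area integral\<close>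

lemma AE_ne_pm_i: "AE \<zeta> in lborel. \<zeta> \<noteq> \<i> \<and> \<zeta> \<noteq> - \<i>"
  using AE_lborel_singleton[of \<i>] AE_lborel_singleton[of "-\<i>"] by eventually_elim auto

lemma measurable_schwarz_kernel [measurable (raw)]:
  assumes [measurable]: "f \<in> borel_measurable M" "g \<in> borel_measurable M"
  shows "(\<lambda>x. schwarz_kernel (f x) (g x)) \<in> borel_measurable M"
  unfolding schwarz_kernel_def by measurable

locale schwarz_density =
  fixes F :: "complex \<Rightarrow> complex" and p :: real
  assumes p: "p > 2" and meas [measurable]: "F \<in> borel_measurable borel"
    and Fp: "integrable lborel (\<lambda>z. norm (F z) powr p)"
    and F2: "integrable lborel (\<lambda>z. indicator {z. 1 < norm z} z * (norm (F z) / norm z ^ 2))"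
begin

text \<open>The cut at radius 2 R keeps the poles z, i and -i inside it and away from its edge
  whenever R \<ge> 1 and |z| \<le> R.\<close>

definition near :: "real \<Rightarrow> complex \<Rightarrow> complex" where
  "near R \<zeta> = indicator (ball 0 (2 * R)) \<zeta> *\<^sub>R F \<zeta>"

lemma near_Lp: "Lp_compact_support (near R) p (p / (p - 1)) (2 * R)"
proof
  have [measurable]: "ball 0 (2 * R) \<in> sets (borel :: complex measure)" by simp
  show [measurable]: "near R \<in> borel_measurable borel"
    unfolding near_def[abs_def] by (intro borel_measurable_scaleR borel_measurable_indicator meas) simp
  show "integrable lborel (\<lambda>w. norm (near R w) powr p)"
    by (rule Bochner_Integration.integrable_bound[OF Fp]) (auto simp: near_def indicator_def)
qed (use p in \<open>auto simp: near_def\<close>)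

definition tail :: "complex \<Rightarrow> real" where
  "tail \<zeta> = indicator {z. 1 < norm z} \<zeta> * (norm (F \<zeta>) / norm \<zeta> ^ 2)"

lemma integrable_tail: "integrable lborel tail"
  unfolding tail_def[abs_def] by (rule F2)

lemma tail_nonneg: "tail \<zeta> \<ge> 0"
  by (simp add: tail_def)

definition far :: "real \<Rightarrow> complex \<Rightarrow> complex \<Rightarrow> complex" where
  "far R z \<zeta> = indicator (- ball 0 (2 * R)) \<zeta> *\<^sub>R (F \<zeta> * schwarz_kernel z \<zeta>)"

lemma far_measurable [measurable]: "far R z \<in> borel_measurable borel"
  unfolding far_def[abs_def] 
  by (intro borel_measurable_scaleR borel_measurable_indicator borel_measurable_times measurable_schwarz_kernel meas) auto

lemma norm_far_le:
  assumes "R \<ge> 1" "norm z \<le> R"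
  shows "norm (far R z \<zeta>) \<le> 8 * R * tail \<zeta>"
proof (cases "norm \<zeta> \<ge> 2 * R")
  case True
  then have "norm (far R z \<zeta>) = norm (F \<zeta>) * norm (schwarz_kernel z \<zeta>)"
    by (simp add: far_def norm_mult indicator_def)
  also have "\<dots> \<le> norm (F \<zeta>) * (8 * R / norm \<zeta> ^ 2)"
    by (intro mult_left_mono norm_schwarz_kernel_le assms True) auto
  finally show ?thesis using True assms by (simp add: tail_def indicator_def mult_ac)
qed (use assms tail_nonneg in \<open>auto simp: far_def indicator_def\<close>)

lemma integrable_far: "R \<ge> 1 \<Longrightarrow> norm z \<le> R \<Longrightarrow> integrable lborel (far R z)"
  by (rule Bochner_Integration.integrable_bound[where f="\<lambda>\<zeta>. 8 * R * tail \<zeta>"])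
     (use integrable_tail in \<open>auto intro!: AE_I2 order_trans[OF norm_far_le] simp: tail_nonneg\<close>)

definition S :: "complex \<Rightarrow> complex" where
  "S z = (\<integral>\<zeta>. F \<zeta> * schwarz_kernel z \<zeta> \<partial>lborel)"

text \<open>One bound for the pole z and half a bound for each of i and -i make the factor 2; 8 R
  comes from \<open>norm_schwarz_kernel_le\<close>.\<close>

definition majorant :: "real \<Rightarrow> real" where
  "majorant R = 2 * Lp_compact_support.bound (near R) p (p / (p - 1)) (2 * R)
     + 8 * R * (\<integral>\<zeta>. tail \<zeta> \<partial>lborel)"

text \<open>Only the near part is split into simple poles: at infinity the single fractions decay
  like 1/|\<zeta>| and need not be integrable against \<open>F\<close>, while their combination
  is.\<close>

lemma integrand_split:
  assumes "\<zeta> \<noteq> \<i>" "\<zeta> \<noteq> - \<i>"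
  shows "F \<zeta> * schwarz_kernel z \<zeta> = near R \<zeta> / (\<zeta> - z) - (near R \<zeta> / (\<zeta> - \<i>) + near R \<zeta> / (\<zeta> - (- \<i>))) / 2 + far R z \<zeta>"
proof (cases "\<zeta> \<in> ball 0 (2 * R)")
  case True
  then show ?thesis
    unfolding schwarz_kernel_partial_fractions[OF assms]
    by (simp add: near_def far_def) (simp add: algebra_simps add_divide_distrib)
qed (simp add: near_def far_def)

text \<open>All three facts follow from \<open>integrand_split\<close>, which holds almost
  everywhere. The bound is uniform over |z| \<le> R, as Fubini will require.\<close>

lemma integrable_S: "integrable lborel (\<lambda>\<zeta>. F \<zeta> * schwarz_kernel z \<zeta>)"
  and integral_norm_S_le: "R \<ge> 1 \<Longrightarrow> norm z \<le> R \<Longrightarrow> (\<integral>\<zeta>. norm (F \<zeta> * schwarz_kernel z \<zeta>) \<partial>lborel) \<le> majorant R"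
  and S_eq: "R \<ge> 1 \<Longrightarrow> norm z \<le> R \<Longrightarrow> S z = Lp_compact_support.cauchy (near R) z
      - (Lp_compact_support.cauchy (near R) \<i> + Lp_compact_support.cauchy (near R) (- \<i>)) / 2 + (\<integral>\<zeta>. far R z \<zeta> \<partial>lborel)"
proof -
  have *: "integrable lborel (\<lambda>\<zeta>. F \<zeta> * schwarz_kernel z \<zeta>) \<and>
    (\<integral>\<zeta>. norm (F \<zeta> * schwarz_kernel z \<zeta>) \<partial>lborel) \<le> majorant R \<and>
    S z = Lp_compact_support.cauchy (near R) z
      - (Lp_compact_support.cauchy (near R) \<i> + Lp_compact_support.cauchy (near R) (- \<i>)) / 2 + (\<integral>\<zeta>. far R z \<zeta> \<partial>lborel)"
    if R: "R \<ge> 1" "norm z \<le> R" for R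
  proof -
    interpret N: Lp_compact_support "near R" p "p / (p - 1)" "2 * R" by (rule near_Lp)
    let ?rhs = "\<lambda>\<zeta>. near R \<zeta> / (\<zeta> - z) - (near R \<zeta> / (\<zeta> - \<i>) + near R \<zeta> / (\<zeta> - (- \<i>))) / 2 + far R z \<zeta>"
    have ae: "AE \<zeta> in lborel. F \<zeta> * schwarz_kernel z \<zeta> = ?rhs \<zeta>"
      using AE_ne_pm_i by eventually_elim (rule integrand_split, auto)
    have i: "integrable lborel (\<lambda>\<zeta>. near R \<zeta> / (\<zeta> - u))" for u by (rule N.integrable_cauchy)
    have int: "integrable lborel ?rhs"
      by (intro Bochner_Integration.integrable_add Bochner_Integration.integrable_diff integrable_divide i integrable_far R)
    then have A: "integrable lborel (\<lambda>\<zeta>. F \<zeta> * schwarz_kernel z \<zeta>)"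
      by (subst integrable_cong_AE[OF _ _ ae]) auto
    have "(\<integral>\<zeta>. norm (F \<zeta> * schwarz_kernel z \<zeta>) \<partial>lborel) = (\<integral>\<zeta>. norm (?rhs \<zeta>) \<partial>lborel)"
      using ae borel_measurable_integrable[OF int] by (intro integral_cong_AE) auto
    also have "\<dots> \<le> (\<integral>\<zeta>. norm (near R \<zeta> / (\<zeta> - z)) + (norm (near R \<zeta> / (\<zeta> - \<i>)) + norm (near R \<zeta> / (\<zeta> - (- \<i>)))) / 2 + norm (far R z \<zeta>) \<partial>lborel)"
    proof (rule integral_mono)
      fix \<zeta>
      have "norm ((near R \<zeta> / (\<zeta> - \<i>) + near R \<zeta> / (\<zeta> - (- \<i>))) / 2) \<le> (norm (near R \<zeta> / (\<zeta> - \<i>)) + norm (near R \<zeta> / (\<zeta> - (- \<i>)))) / 2"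
        unfolding norm_divide[of _ 2] using norm_triangle_ineq by (simp add: divide_right_mono)
      then show "norm (?rhs \<zeta>) \<le> norm (near R \<zeta> / (\<zeta> - z)) + (norm (near R \<zeta> / (\<zeta> - \<i>)) + norm (near R \<zeta> / (\<zeta> - (- \<i>)))) / 2 + norm (far R z \<zeta>)"
        by (intro order_trans[OF norm_triangle_ineq] add_right_mono order_trans[OF norm_triangle_ineq4] add_left_mono)
    qed (intro integrable_norm int Bochner_Integration.integrable_add integrable_divide i integrable_far R)+
    also have "\<dots> = (\<integral>\<zeta>. norm (near R \<zeta> / (\<zeta> - z)) \<partial>lborel) + ((\<integral>\<zeta>. norm (near R \<zeta> / (\<zeta> - \<i>)) \<partial>lborel)
         + (\<integral>\<zeta>. norm (near R \<zeta> / (\<zeta> - (- \<i>))) \<partial>lborel)) / 2 + (\<integral>\<zeta>. norm (far R z \<zeta>) \<partial>lborel)"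
      using integrable_norm[OF i] integrable_norm[OF integrable_far[OF R]]
      by (subst Bochner_Integration.integral_add Bochner_Integration.integral_divide | intro Bochner_Integration.integrable_add integrable_divide | assumption | simp only:)+
    also have "\<dots> \<le> N.bound + (N.bound + N.bound) / 2 + (\<integral>\<zeta>. 8 * R * tail \<zeta> \<partial>lborel)"
      using integrable_tail norm_far_le[OF R]
      by (intro add_mono divide_right_mono N.integral_norm_cauchy_le integral_mono integrable_norm integrable_far R) auto
    also have "\<dots> = majorant R" by (simp add: majorant_def)
    finally have B: "(\<integral>\<zeta>. norm (F \<zeta> * schwarz_kernel z \<zeta>) \<partial>lborel) \<le> majorant R" .
    have "S z = (\<integral>\<zeta>. ?rhs \<zeta> \<partial>lborel)"
      unfolding S_def using ae borel_measurable_integrable[OF int] by (intro integral_cong_AE) auto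
    also have "\<dots> = N.cauchy z - (N.cauchy \<i> + N.cauchy (- \<i>)) / 2 + (\<integral>\<zeta>. far R z \<zeta> \<partial>lborel)"
      unfolding N.cauchy_def using i integrable_far[OF R]
      by (subst Bochner_Integration.integral_add Bochner_Integration.integral_diff Bochner_Integration.integral_divide
           | intro Bochner_Integration.integrable_add Bochner_Integration.integrable_diff integrable_divide | assumption | simp only:)+
    finally show ?thesis using A B by simp
  qed
  from *[of "max 1 (norm z)"] show "integrable lborel (\<lambda>\<zeta>. F \<zeta> * schwarz_kernel z \<zeta>)" by simp
  show "R \<ge> 1 \<Longrightarrow> norm z \<le> R \<Longrightarrow> (\<integral>\<zeta>. norm (F \<zeta> * schwarz_kernel z \<zeta>) \<partial>lborel) \<le> majorant R" 
    using * by blast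
  show "R \<ge> 1 \<Longrightarrow> norm z \<le> R \<Longrightarrow> S z = Lp_compact_support.cauchy (near R) z
      - (Lp_compact_support.cauchy (near R) \<i> + Lp_compact_support.cauchy (near R) (- \<i>)) / 2 + (\<integral>\<zeta>. far R z \<zeta> \<partial>lborel)"
    using * by blast
qed

text \<open>On a ball around 0 containing z0 the near part is a Cauchy transform up to a constant,
  and the far part has pole-free integrands dominated by a multiple of \<open>tail\<close>.\<close>

lemma continuous_on_S: "continuous_on UNIV S"
proof -
  have "isCont S z0" for z0
  proof -
    define R where "R = norm z0 + 1"
    have R: "R \<ge> 1" by (simp add: R_def)
    interpret N: Lp_compact_support "near R" p "p / (p - 1)" "2 * R" by (rule near_Lp)
    have far: "continuous_on (ball 0 R) (\<lambda>z. \<integral>\<zeta>. far R z \<zeta> \<partial>lborel)"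
      unfolding continuous_on_sequentially o_def
    proof (intro allI impI ballI, elim conjE)
      fix x :: "nat \<Rightarrow> complex" and a
      assume a: "a \<in> ball 0 R" and xR: "\<forall>n. x n \<in> ball 0 R" and x: "x \<longlonglongrightarrow> a"
      show "(\<lambda>n. \<integral>\<zeta>. far R (x n) \<zeta> \<partial>lborel) \<longlonglongrightarrow> (\<integral>\<zeta>. far R a \<zeta> \<partial>lborel)"
      proof (rule integral_dominated_convergence)
        show "integrable lborel (\<lambda>\<zeta>. 8 * R * tail \<zeta>)"
          using integrable_tail by simp
        show "AE \<zeta> in lborel. norm (far R (x n) \<zeta>) \<le> 8 * R * tail \<zeta>" for n
          using xR R by (intro AE_I2 norm_far_le) (auto simp: less_imp_le)
        have "(\<lambda>n. far R (x n) \<zeta>) \<longlonglongrightarrow> far R a \<zeta>" for \<zeta>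
        proof (cases "\<zeta> \<in> ball 0 (2 * R)")
          case False
          then have "\<zeta> \<noteq> a" using a R by auto
          then have "(\<lambda>n. schwarz_kernel (x n) \<zeta>) \<longlonglongrightarrow> schwarz_kernel a \<zeta>"
            unfolding schwarz_kernel_def by (intro tendsto_intros x) auto
          then show ?thesis unfolding far_def by (intro tendsto_intros)
        qed (simp add: far_def)
        then show "AE \<zeta> in lborel. (\<lambda>n. far R (x n) \<zeta>) \<longlonglongrightarrow> far R a \<zeta>" by simp
      qed measurable
    qed
    have "continuous_on (ball 0 R) (\<lambda>z. N.cauchy z - (N.cauchy \<i> + N.cauchy (- \<i>)) / 2 + (\<integral>\<zeta>. far R z \<zeta> \<partial>lborel))"
      by (intro continuous_intros far continuous_on_subset[OF N.continuous_on_cauchy]) auto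
    then have "continuous_on (ball 0 R) S"
      by (rule continuous_on_eq) (simp add: S_eq[OF R])
    then show ?thesis by (simp add: continuous_on_eq_continuous_at R_def)
  qed
  then show ?thesis by (simp add: continuous_on_eq_continuous_at)
qed

lemma S_minus_i: "S (- \<i>) = - S \<i>"
proof -
  have "S (- \<i>) = (\<integral>\<zeta>. - (F \<zeta> * schwarz_kernel \<i> \<zeta>) \<partial>lborel)"
    unfolding S_def
  proof (rule integral_cong_AE)
    show "AE \<zeta> in lborel. F \<zeta> * schwarz_kernel (- \<i>) \<zeta> = - (F \<zeta> * schwarz_kernel \<i> \<zeta>)"
      using AE_ne_pm_i by eventually_elim (simp add: schwarz_kernel_at_i)
  qed measurable
  then show ?thesis by (simp add: S_def)
qed

end

text \<open>After Fubini, Cauchy-Pompeiu evaluates the inner integral, and the part of the kernel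
  independent of z drops out because \<open>dbar g\<close> has integral 0. The map \<open>a\<close>
  is the identity for S and \<open>cnj\<close> for the reflected term.\<close>

lemma integral_dbar_schwarz_kernel:
  fixes W :: "complex \<Rightarrow> complex" and a :: "complex \<Rightarrow> complex"
  assumes diff: "\<And>z. g differentiable (at z)"
    and cont: "\<And>v. continuous_on UNIV (\<lambda>z. frechet_derivative g (at z) v)"
    and supp: "\<And>z. norm z > R \<Longrightarrow> g z = 0"
    and [measurable]: "a \<in> borel_measurable borel" "W \<in> borel_measurable borel"
    and int: "\<And>z. norm z \<le> R \<Longrightarrow> integrable lborel (\<lambda>\<zeta>. W \<zeta> * schwarz_kernel z (a \<zeta>))"
    and bd: "\<And>z. norm z \<le> R \<Longrightarrow> (\<integral>\<zeta>. norm (W \<zeta> * schwarz_kernel z (a \<zeta>)) \<partial>lborel) \<le> M"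
  shows "(\<integral>z. dbar g z * (\<integral>\<zeta>. W \<zeta> * schwarz_kernel z (a \<zeta>) \<partial>lborel) \<partial>lborel) = of_real pi * (\<integral>\<zeta>. W \<zeta> * g (a \<zeta>) \<partial>lborel)"
proof -
  have op: "open {z::complex. norm z > R}" by (intro open_Collect_less continuous_intros)
  have dbg0: "dbar g z = 0" if "norm z > R" for z
    using frechet_derivative_eq_0_outside[OF op, of g z] supp that by (simp add: dbar_def)
  have d: "(\<integral>z. dbar g z \<partial>lborel) = 0" "integrable lborel (dbar g)"
    by (rule integral_dbar_eq_0[OF diff cont supp]; assumption)+
  have [measurable]: "dbar g \<in> borel_measurable borel" using d(2) by auto
  let ?f = "\<lambda>z \<zeta>. dbar g z * (W \<zeta> * schwarz_kernel z (a \<zeta>))"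
  have "integrable (lborel \<Otimes>\<^sub>M lborel) (\<lambda>(z, \<zeta>). ?f z \<zeta>)"
  proof (rule lborel_pair.Fubini_integrable)
    show "(\<lambda>(z, \<zeta>). ?f z \<zeta>) \<in> borel_measurable (lborel \<Otimes>\<^sub>M lborel)" by measurable
    show "AE z in lborel. integrable lborel (\<lambda>\<zeta>. case (z, \<zeta>) of (z, \<zeta>) \<Rightarrow> ?f z \<zeta>)"
    proof (intro AE_I2)
      fix z show "integrable lborel (\<lambda>\<zeta>. case (z, \<zeta>) of (z, \<zeta>) \<Rightarrow> ?f z \<zeta>)"
        using int[of z] dbg0[of z] by (cases "norm z \<le> R") (auto intro!: integrable_mult_right)
    qed
    show "integrable lborel (\<lambda>z. \<integral>\<zeta>. norm (case (z, \<zeta>) of (z, \<zeta>) \<Rightarrow> ?f z \<zeta>) \<partial>lborel)"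
    proof (rule Bochner_Integration.integrable_bound)
      show "integrable lborel (\<lambda>z. norm (dbar g z) * M)"
        by (intro integrable_mult_left integrable_norm d)
      show "AE z in lborel. norm (\<integral>\<zeta>. norm (case (z, \<zeta>) of (z, \<zeta>) \<Rightarrow> ?f z \<zeta>) \<partial>lborel) \<le> norm (norm (dbar g z) * M)"
      proof (intro AE_I2)
        fix z
        have eq: "(\<integral>\<zeta>. norm (case (z, \<zeta>) of (z, \<zeta>) \<Rightarrow> ?f z \<zeta>) \<partial>lborel) = norm (dbar g z) * (\<integral>\<zeta>. norm (W \<zeta> * schwarz_kernel z (a \<zeta>)) \<partial>lborel)"
          by (simp add: norm_mult)
        show "norm (\<integral>\<zeta>. norm (case (z, \<zeta>) of (z, \<zeta>) \<Rightarrow> ?f z \<zeta>) \<partial>lborel) \<le> norm (norm (dbar g z) * M)"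
        proof (cases "norm z \<le> R")
          case True
          have "0 \<le> (\<integral>\<zeta>. norm (W \<zeta> * schwarz_kernel z (a \<zeta>)) \<partial>lborel)" by (rule Bochner_Integration.integral_nonneg) simp
          with bd[OF True] show ?thesis unfolding eq real_norm_def abs_mult
            by (intro mult_mono) auto
        next
          case False
          then show ?thesis unfolding eq using dbg0[of z] by simp
        qed
      qed
    qed measurable
  qed
  then have "(\<integral>z. (\<integral>\<zeta>. ?f z \<zeta> \<partial>lborel) \<partial>lborel) = (\<integral>\<zeta>. (\<integral>z. ?f z \<zeta> \<partial>lborel) \<partial>lborel)"
    by (rule lborel_pair.Fubini_integral[symmetric])
  also have "\<dots> = (\<integral>\<zeta>. of_real pi * (W \<zeta> * g (a \<zeta>)) \<partial>lborel)"
  proof (rule Bochner_Integration.integral_cong[OF refl])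
    fix \<zeta>
    define k where "k = a \<zeta> / ((a \<zeta>)\<^sup>2 + 1)"
    have cp: "integrable lborel (\<lambda>z. dbar g z / (a \<zeta> - z))"
      "(\<integral>z. dbar g z / (a \<zeta> - z) \<partial>lborel) = of_real pi * g (a \<zeta>)"
      by (rule cauchy_pompeiu[OF diff cont supp]; assumption)+
    have dk: "integrable lborel (\<lambda>z. dbar g z * k)" using d(2) by simp
    have "(\<integral>z. ?f z \<zeta> \<partial>lborel) = (\<integral>z. W \<zeta> * (dbar g z / (a \<zeta> - z) - dbar g z * k) \<partial>lborel)"
      by (rule Bochner_Integration.integral_cong[OF refl]) (simp add: schwarz_kernel_def k_def algebra_simps)
    also have "\<dots> = W \<zeta> * ((\<integral>z. dbar g z / (a \<zeta> - z) \<partial>lborel) - (\<integral>z. dbar g z * k \<partial>lborel))"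
      using Bochner_Integration.integral_diff[OF cp(1) dk] by simp
    also have "\<dots> = of_real pi * (W \<zeta> * g (a \<zeta>))" using cp(2) d(1) by simp
    finally show "(\<integral>z. ?f z \<zeta> \<partial>lborel) = of_real pi * (W \<zeta> * g (a \<zeta>))" .
  qed
  finally show ?thesis by simp
qed

section \<open>The Schwarz problem\<close>

lemma open_Cplus: "open Cplus"
  by (rule open_halfspace_Im_gt)

section \<open>Test functions in the plane and the weak derivatives of the summands\<close>

lemma test_functions_C1:
  fixes \<phi> :: "complex \<Rightarrow> complex"
  assumes "\<phi> \<in> test_functions \<Omega>"
  shows "\<phi> differentiable (at z)" "continuous_on UNIV (\<lambda>z. frechet_derivative \<phi> (at z) v)"
  using test_functions_differentiable[OF assms] test_functions_continuous[OF test_functions_frechet_derivative[OF assms]] by auto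

lemma test_functions_eq_0: "\<phi> \<in> test_functions \<Omega> \<Longrightarrow> z \<notin> \<Omega> \<Longrightarrow> \<phi> z = 0"
  using closure_subset[of "{x. \<phi> x \<noteq> 0}"] by (auto simp: test_functions_def)

lemma dbar_eq_0_outside:
  assumes "\<phi> \<in> test_functions \<Omega>" "z \<notin> \<Omega>"
  shows "dbar \<phi> z = 0"
  using test_functions_eq_0[OF test_functions_frechet_derivative[OF assms(1)] assms(2)] by (simp add: dbar_def)

text \<open>For holomorphic h, h dbar \<phi> is dbar of h \<phi>. The extension of h \<phi> by zero
  is C^1 because the closed support of \<phi> lies inside \<Omega>, whatever h does at the
  boundary.\<close>

lemma integral_holomorphic_times_dbar:
  assumes h: "h holomorphic_on \<Omega>" and \<Omega>: "open \<Omega>" and \<phi>: "\<phi> \<in> test_functions \<Omega>"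
  shows "integrable lborel (\<lambda>z. indicator \<Omega> z *\<^sub>R (h z * dbar \<phi> z))" (is ?A)
    and "(\<integral>z. indicator \<Omega> z *\<^sub>R (h z * dbar \<phi> z) \<partial>lborel) = 0" (is ?B)
proof -
  let ?C = "closure {x. \<phi> x \<noteq> 0}"
  have C: "?C \<subseteq> \<Omega>" using \<phi> by (auto simp: test_functions_def)
  obtain R where R: "\<And>z. norm z > R \<Longrightarrow> \<phi> z = 0" using test_functions_bounded_support[OF \<phi>] by blast
  have \<phi>0: "\<phi> z = 0" if "z \<in> - ?C" for z using that closure_subset[of "{x. \<phi> x \<noteq> 0}"] by auto
  have d\<phi>0: "frechet_derivative \<phi> (at z) = (\<lambda>_. 0)" if "z \<in> - ?C" for z
    by (rule frechet_derivative_eq_0_outside[OF _ \<phi>0 that]) (intro open_Compl closed_closure)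
  define g where "g = (\<lambda>z. if z \<in> \<Omega> then h z * \<phi> z else 0)"
  define D where "D = (\<lambda>z v. if z \<in> \<Omega> then h z * frechet_derivative \<phi> (at z) v + (deriv h z * v) * \<phi> z else 0)"
  have gd: "(g has_derivative D z) (at z)" for z
  proof (cases "z \<in> \<Omega>")
    case True
    have hd: "(h has_derivative (\<lambda>v. deriv h z * v)) (at z)"
      using holomorphic_derivI[OF h \<Omega> True] by (simp add: has_field_derivative_def)
    have pd: "(\<phi> has_derivative frechet_derivative \<phi> (at z)) (at z)"
      using test_functions_C1(1)[OF \<phi>, of z] by (simp add: frechet_derivative_works)
    have "((\<lambda>z. h z * \<phi> z) has_derivative D z) (at z)"
      using has_derivative_mult[OF hd pd] True by (simp add: D_def)
    moreover have "h u * \<phi> u = g u" if "u \<in> \<Omega>" for u using that by (simp add: g_def)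
    ultimately show ?thesis by (rule has_derivative_transform_within_open[OF _ \<Omega> True])
  next
    case False
    then have zC: "z \<in> - ?C" using C by auto
    have "open (- ?C)" by (intro open_Compl closed_closure)
    moreover have "0 = g u" if "u \<in> - ?C" for u using \<phi>0[OF that] by (simp add: g_def)
    ultimately have "(g has_derivative (\<lambda>_. 0)) (at z)"
      by (rule has_derivative_transform_within_open[OF has_derivative_const _ zC])
    then show ?thesis using False by (simp add: D_def)
  qed
  have fd: "frechet_derivative g (at z) = D z" for z by (rule frechet_derivative_at[OF gd, symmetric])
  have hc: "isCont h z" "isCont (deriv h) z" if "z \<in> \<Omega>" for z
    using holomorphic_on_imp_continuous_on[OF h] holomorphic_on_imp_continuous_on[OF holomorphic_deriv[OF h \<Omega>]] that \<Omega>
    by (simp_all add: continuous_on_eq_continuous_at)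
  have "isCont (\<lambda>z. D z v) z" for z v
  proof (cases "z \<in> \<Omega>")
    case True
    have "isCont \<phi> z" "isCont (\<lambda>z. frechet_derivative \<phi> (at z) v) z"
      using test_functions_continuous[OF \<phi>] test_functions_C1(2)[OF \<phi>, of v] by (simp_all add: continuous_on_eq_continuous_at)
    then have "isCont (\<lambda>z. h z * frechet_derivative \<phi> (at z) v + (deriv h z * v) * \<phi> z) z"
      using hc[OF True] by (intro continuous_intros)
    moreover have "\<forall>\<^sub>F u in nhds z. D u v = h u * frechet_derivative \<phi> (at u) v + (deriv h u * v) * \<phi> u"
      using eventually_nhds_in_open[OF \<Omega> True] by eventually_elim (simp add: D_def)
    ultimately show ?thesis by (simp add: isCont_cong)
  next
    case False
    then have "z \<in> - ?C" using C by auto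
    then have "\<forall>\<^sub>F u in nhds z. u \<in> - ?C"
      by (intro eventually_nhds_in_open open_Compl closed_closure)
    then have "\<forall>\<^sub>F u in nhds z. D u v = 0"
    proof eventually_elim
      case (elim u)
      show ?case unfolding D_def \<phi>0[OF elim] d\<phi>0[OF elim] by simp
    qed
    then show ?thesis by (simp add: isCont_cong)
  qed
  then have Dc: "continuous_on UNIV (\<lambda>z. frechet_derivative g (at z) v)" for v
    by (simp add: fd continuous_on_eq_continuous_at)
  \<comment> \<open>The term with h' is complex linear in v and cancels in
    \<open>dbar\<close>.\<close>
  have "dbar g z = indicator \<Omega> z *\<^sub>R (h z * dbar \<phi> z)" for z
    by (simp add: dbar_def fd D_def indicator_def algebra_simps)
  then have eq: "dbar g = (\<lambda>z. indicator \<Omega> z *\<^sub>R (h z * dbar \<phi> z))" by auto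
  have "g differentiable (at z)" for z using gd by (auto simp: differentiable_def)
  moreover have "g z = 0" if "norm z > R" for z using R[OF that] by (simp add: g_def)
  ultimately have "(\<integral>z. dbar g z \<partial>lborel) = 0" "integrable lborel (dbar g)"
    using integral_dbar_eq_0[OF _ Dc] by blast+
  then show ?A ?B by (simp_all add: eq)
qed

context schwarz_density
begin

text \<open>The area term as a function on the whole plane, so that the real axis is interior to its
  domain of continuity; \<open>cnj (S (cnj z))\<close> carries the conjugated half of the
  integrand.\<close>

definition T :: "complex \<Rightarrow> complex" where
  "T z = - (1 / of_real pi) * (S z - cnj (S (cnj z)))"

lemma continuous_on_T: "continuous_on UNIV T"
  unfolding T_def[abs_def]
  by (intro continuous_intros continuous_on_S continuous_on_compose2[OF continuous_on_S]) auto

lemma Re_T_real: "Re (T (of_real t)) = 0"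
  by (simp add: T_def)

text \<open>By \<open>S_minus_i\<close> the reflected value \<open>S (cnj \<i>)\<close> is -S(i), so
  T(i) = -(2/\<pi>) Re S(i).\<close>

lemma Im_T_i: "Im (T \<i>) = 0"
  by (simp add: T_def S_minus_i)

lemma cnj_S: "cnj (S (cnj z)) = (\<integral>\<zeta>. cnj (F \<zeta>) * schwarz_kernel z (cnj \<zeta>) \<partial>lborel)"
  using Bochner_Integration.integral_cnj[where M=lborel and f= "\<lambda>\<zeta>. F \<zeta> * schwarz_kernel (cnj z) \<zeta>"]
  by (simp add: S_def cnj_schwarz_kernel)

text \<open>S contributes \<pi> times the pairing of F with \<phi>. The reflected term contributes
  the integral of cnj F(\<zeta>) \<phi>(cnj \<zeta>), which is 0: one factor lives in the upper
  half-plane, the other in the lower.\<close>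

lemma integral_T_dbar:
  assumes \<phi>: "\<phi> \<in> test_functions Cplus" and F0: "\<And>z. z \<notin> Cplus \<Longrightarrow> F z = 0"
  shows "integrable lborel (\<lambda>z. T z * dbar \<phi> z)"
    and "(\<integral>z. T z * dbar \<phi> z \<partial>lborel) = - (\<integral>\<zeta>. F \<zeta> * \<phi> \<zeta> \<partial>lborel)"
proof -
  obtain R' where R': "\<And>z. norm z > R' \<Longrightarrow> \<phi> z = 0" using test_functions_bounded_support[OF \<phi>] by blast
  define R where "R = max 1 R'"
  have R: "R \<ge> 1" "\<phi> z = 0" if "norm z > R" for z using R'[of z] that by (auto simp: R_def)
  have R1: "R \<ge> 1" by (simp add: R_def)
  note c1 = test_functions_C1[OF \<phi>]
  have dc: "continuous_on UNIV (dbar \<phi>)" unfolding dbar_def[abs_def] by (intro continuous_intros c1) auto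
  have d0: "dbar \<phi> z = 0" if "z \<notin> cbox (Complex (-R) (-R)) (Complex R R)" for z
  proof -
    have "norm z > R" using that abs_Re_le_cmod[of z] abs_Im_le_cmod[of z]
      by (rule_tac ccontr) (auto simp: in_cbox_complex_iff)
    then show ?thesis
      using frechet_derivative_eq_0_outside[of "{z. norm z > R}" \<phi> z] R(2)
      by (simp add: dbar_def open_Collect_less continuous_intros)
  qed
  have int: "integrable lborel (\<lambda>z. g z * dbar \<phi> z)" if "continuous_on UNIV g" for g
    by (rule integrable_compact_support[where a="Complex (-R) (-R)" and b="Complex R R"])
       (use that dc d0 in \<open>auto intro: continuous_on_mult\<close>)
  show "integrable lborel (\<lambda>z. T z * dbar \<phi> z)" by (rule int[OF continuous_on_T])
  have cS: "continuous_on UNIV (\<lambda>z. cnj (S (cnj z)))"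
    by (intro continuous_intros continuous_on_compose2[OF continuous_on_S]) auto
  have "(\<integral>z. dbar \<phi> z * (\<integral>\<zeta>. F \<zeta> * schwarz_kernel z ((\<lambda>x. x) \<zeta>) \<partial>lborel) \<partial>lborel) = of_real pi * (\<integral>\<zeta>. F \<zeta> * \<phi> ((\<lambda>x. x) \<zeta>) \<partial>lborel)"
    using integrable_S integral_norm_S_le[OF R1] R(2)
    by (intro integral_dbar_schwarz_kernel[where R=R and M="majorant R"] c1) auto
  then have 1: "(\<integral>z. S z * dbar \<phi> z \<partial>lborel) = of_real pi * (\<integral>\<zeta>. F \<zeta> * \<phi> \<zeta> \<partial>lborel)"
    by (simp add: S_def mult.commute)
  have "integrable lborel (\<lambda>\<zeta>. cnj (F \<zeta>) * schwarz_kernel z (cnj \<zeta>))" for z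
    using integrable_cnj[OF integrable_S[of "cnj z"]] by (simp add: cnj_schwarz_kernel)
  moreover have "(\<integral>\<zeta>. norm (cnj (F \<zeta>) * schwarz_kernel z (cnj \<zeta>)) \<partial>lborel) \<le> majorant R" if "norm z \<le> R" for z
  proof -
    have "norm (cnj (F \<zeta>) * schwarz_kernel z (cnj \<zeta>)) = norm (F \<zeta> * schwarz_kernel (cnj z) \<zeta>)" for \<zeta>
      using complex_mod_cnj[of "F \<zeta> * schwarz_kernel (cnj z) \<zeta>"] by (simp add: cnj_schwarz_kernel)
    then show ?thesis using integral_norm_S_le[OF R1, of "cnj z"] that by simp
  qed
  ultimately have "(\<integral>z. dbar \<phi> z * (\<integral>\<zeta>. cnj (F \<zeta>) * schwarz_kernel z (cnj \<zeta>) \<partial>lborel) \<partial>lborel)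
      = of_real pi * (\<integral>\<zeta>. cnj (F \<zeta>) * \<phi> (cnj \<zeta>) \<partial>lborel)"
  proof (intro integral_dbar_schwarz_kernel[where R=R and M="majorant R"] c1)
    show [measurable]: "cnj \<in> borel_measurable borel"
      by (intro borel_measurable_continuous_onI continuous_intros)
    show "(\<lambda>\<zeta>. cnj (F \<zeta>)) \<in> borel_measurable borel" by measurable
  qed (use R(2) in auto)
  then have 2: "(\<integral>z. cnj (S (cnj z)) * dbar \<phi> z \<partial>lborel) = of_real pi * (\<integral>\<zeta>. cnj (F \<zeta>) * \<phi> (cnj \<zeta>) \<partial>lborel)"
    by (simp add: cnj_S mult.commute)
  have "cnj (F \<zeta>) * \<phi> (cnj \<zeta>) = 0" for \<zeta>
    using F0[of \<zeta>] test_functions_eq_0[OF \<phi>, of "cnj \<zeta>"] by (cases "Im \<zeta> > 0") auto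
  with 2 have 3: "(\<integral>z. cnj (S (cnj z)) * dbar \<phi> z \<partial>lborel) = 0" by simp
  have "(\<integral>z. T z * dbar \<phi> z \<partial>lborel) = (\<integral>z. - (1 / of_real pi) * (S z * dbar \<phi> z - cnj (S (cnj z)) * dbar \<phi> z) \<partial>lborel)"
    by (rule Bochner_Integration.integral_cong) (auto simp: T_def algebra_simps)
  also have "\<dots> = - (1 / of_real pi) * ((\<integral>z. S z * dbar \<phi> z \<partial>lborel) - (\<integral>z. cnj (S (cnj z)) * dbar \<phi> z \<partial>lborel))"
    by (subst integral_mult_right_zero, subst Bochner_Integration.integral_diff[OF int[OF continuous_on_S] int[OF cS]]) simp
  also have "\<dots> = - (\<integral>\<zeta>. F \<zeta> * \<phi> \<zeta> \<partial>lborel)" unfolding 1 3 by simp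
  finally show "(\<integral>z. T z * dbar \<phi> z \<partial>lborel) = - (\<integral>\<zeta>. F \<zeta> * \<phi> \<zeta> \<partial>lborel)" .
qed

lemma integrable_on_bounded:
  assumes "bounded K" and [measurable]: "K \<in> sets borel"
  shows "integrable lborel (\<lambda>z. indicator K z *\<^sub>R F z)"
proof -
  obtain R where R: "K \<subseteq> ball 0 (2 * R)"
    using bounded_subset_ballD[OF assms(1), of 0] by (metis field_sum_of_halves mult_2)
  interpret N: Lp_compact_support "near R" p "p / (p - 1)" "2 * R" by (rule near_Lp)
  show ?thesis
    by (rule Bochner_Integration.integrable_bound[OF N.integrable_G]) (use R in \<open>auto simp: near_def indicator_def subset_iff intro!: AE_I2\<close>)
qed

text \<open>The return from \<open>F\<close> to \<open>f\<close>: on \<open>Cplus\<close> they agree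
  almost everywhere, and off it both \<open>F\<close> and the indicator vanish. Pulling conjugation
  out of the second half of the integrand moves z to \<open>cnj z\<close>.\<close>

lemma set_integral_schwarz_integrand:
  assumes ae: "AE z in lebesgue. z \<in> Cplus \<longrightarrow> F z = f z" and F0: "\<And>z. z \<notin> Cplus \<Longrightarrow> F z = 0"
  shows "set_integrable lebesgue Cplus (schwarz_integrand f z)"
    and "(LINT \<zeta>:Cplus|lebesgue. schwarz_integrand f z \<zeta>) = S z - cnj (S (cnj z))"
proof -
  let ?G = "\<lambda>\<zeta>. F \<zeta> * schwarz_kernel z \<zeta> - cnj (F \<zeta> * schwarz_kernel (cnj z) \<zeta>)"
  have i: "integrable lborel (\<lambda>\<zeta>. cnj (F \<zeta> * schwarz_kernel (cnj z) \<zeta>))"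
    by (intro integrable_cnj integrable_S)
  have int: "integrable lborel ?G"
    by (intro Bochner_Integration.integrable_diff integrable_S i)
  then have intl: "integrable lebesgue ?G"
    by (subst integrable_completion) auto
  have eq: "AE \<zeta> in lebesgue. ?G \<zeta> = indicator Cplus \<zeta> *\<^sub>R schwarz_integrand f z \<zeta>"
    using ae
  proof eventually_elim
    case (elim \<zeta>)
    then show ?case using F0[of \<zeta>]
      by (cases "\<zeta> \<in> Cplus") (simp_all add: schwarz_integrand_def schwarz_kernel_def)
  qed
  then have eq': "AE \<zeta> in lebesgue. \<zeta> \<in> UNIV \<longrightarrow> ?G \<zeta> = indicator Cplus \<zeta> *\<^sub>R schwarz_integrand f z \<zeta>" by simp
  have m: "(\<lambda>\<zeta>. indicator Cplus \<zeta> *\<^sub>R schwarz_integrand f z \<zeta>) \<in> borel_measurable lebesgue"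
    by (rule borel_measurable_AE[OF borel_measurable_integrable[OF intl] eq])
  show "set_integrable lebesgue Cplus (schwarz_integrand f z)"
    unfolding set_integrable_def by (rule integrable_cong_AE_imp[OF intl m]) (use eq in \<open>auto elim: eventually_mono\<close>)
  have "(LINT \<zeta>:Cplus|lebesgue. schwarz_integrand f z \<zeta>) = (\<integral>\<zeta>. ?G \<zeta> \<partial>lebesgue)"
    unfolding set_lebesgue_integral_def
    by (rule integral_cong_AE[OF m borel_measurable_integrable[OF intl]]) (use eq in \<open>auto elim: eventually_mono\<close>)
  also have "\<dots> = (\<integral>\<zeta>. ?G \<zeta> \<partial>lborel)" using int by (intro integral_completion) auto
  also have "\<dots> = S z - cnj (S (cnj z))"
    by (simp only: S_def Bochner_Integration.integral_diff[OF integrable_S i] Bochner_Integration.integral_cnj)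
  finally show "(LINT \<zeta>:Cplus|lebesgue. schwarz_integrand f z \<zeta>) = S z - cnj (S (cnj z))" .
qed

end

lemma integrable_lebesgue_of_lborel: "integrable lborel f \<Longrightarrow> integrable lebesgue f"
  for f :: "'a::euclidean_space \<Rightarrow> 'b::{banach, second_countable_topology}"
  by (subst integrable_completion) auto

lemma integral_lebesgue_of_lborel: "integrable lborel f \<Longrightarrow> (\<integral>x. f x \<partial>lebesgue) = (\<integral>x. f x \<partial>lborel)"
  for f :: "'a::euclidean_space \<Rightarrow> 'b::{banach, second_countable_topology}"
  by (subst integral_completion) auto

theorem theorem3p15:
  fixes p c :: real and f h w :: "complex \<Rightarrow> complex" and I :: complex
  assumes "p > 2"
    and "f \<in> Lp_nu_space p 2"
    and "h \<in> H_tg"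
    and I: "I = \<i> / of_real pi *
      bv_pairing (\<lambda>z. of_real (Im (h z))) (\<lambda>t. of_real (poisson t 1))"
    and w: "\<And>x y. y > 0 \<Longrightarrow> w (Complex x y) =
      \<i> * of_real c
      + 1 / of_real pi * bv_pairing h (\<lambda>t. of_real (poisson (x - t) y))
      - \<i> / of_real pi * bv_pairing (\<lambda>z. of_real (Im (h z))) (\<lambda>t. of_real (poisson t 1))
      - 1 / of_real pi * (LINT \<zeta>:Cplus|lebesgue.
          f \<zeta> * (1 / (\<zeta> - Complex x y) - \<zeta> / (\<zeta>\<^sup>2 + 1))
          - cnj (f \<zeta>) * (1 / (cnj \<zeta> - Complex x y) - cnj \<zeta> / ((cnj \<zeta>)\<^sup>2 + 1)))"
  shows "(\<forall>x y. y > 0 \<longrightarrow> bv_pairing_exists h (\<lambda>t. of_real (poisson (x - t) y)))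
    \<and> bv_pairing_exists (\<lambda>z. of_real (Im (h z))) (\<lambda>t. of_real (poisson t 1))
    \<and> (\<forall>z\<in>Cplus. set_integrable lebesgue Cplus (schwarz_integrand f z))
    \<and> solves_schwarz f h c w
    \<and> (\<forall>z\<in>Cplus. w z = \<i> * of_real c + h z - I + T_Cplus f z)"
proof -
  note h = \<open>h \<in> H_tg\<close>
  have hh: "h holomorphic_on Cplus" using h by (simp add: H_tg_def)
  obtain F where F: "F \<in> borel_measurable lborel" "AE z in lebesgue. z \<in> Cplus \<longrightarrow> F z = f z"
    "\<And>z. z \<notin> Cplus \<Longrightarrow> F z = 0" "integrable lborel (\<lambda>z. norm (F z) powr p)"
    "integrable lborel (\<lambda>z. indicator {z. 1 < norm z} z * (norm (F z) / norm z ^ 2))"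
    using Lp_nu_space_borel_version[OF assms(1,2)] by blast
  interpret schwarz_density F p by unfold_locales (use F assms(1) in auto)
  \<comment> \<open>The value makes \<open>I\<close> purely imaginary.\<close>
  have I_eq: "I = \<i> * of_real (Im (h \<i>))"
    unfolding I bv_pairing_Im_poisson(2)[OF h] by simp
  have T_eq: "T_Cplus f z = T z" for z
  proof -
    have "(LINT \<zeta>:Cplus|lebesgue. schwarz_integrand f z \<zeta>) = S z - cnj (S (cnj z))"
      by (rule set_integral_schwarz_integrand(2)[OF F(2)]) (rule F(3))
    then show ?thesis by (simp only: T_Cplus_def T_def)
  qed
  have w_formula: "w z = \<i> * of_real c + h z - I + T_Cplus f z" if "z \<in> Cplus" for z
  proof -
    obtain x y where z: "z = Complex x y" by (cases z)
    with that have y: "y > 0" by simp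
    show ?thesis
      unfolding z w[OF y] I T_Cplus_def schwarz_integrand_def[abs_def] bv_pairing_poisson(2)[OF h y] by simp
  qed
  \<comment> \<open>All constants together; being purely imaginary, they leave the real part of the
    boundary value alone.\<close>
  define k where "k = \<i> * of_real c - I"
  have w_eq: "w z = h z + k + T z" if "z \<in> Cplus" for z
    using w_formula[OF that] by (simp add: T_eq k_def)
  have Re_k: "Re k = 0" by (simp add: k_def I_eq)
  have hc: "continuous_on Cplus h" by (rule holomorphic_on_imp_continuous_on[OF hh])
  have [measurable]: "Cplus \<in> sets borel" using open_Cplus by simp
  have "continuous_on Cplus (\<lambda>z. h z + k + T z)"
    by (intro continuous_intros hc continuous_on_subset[OF continuous_on_T]) auto
  then have wc: "continuous_on Cplus w" by (rule continuous_on_eq) (simp add: w_eq)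

  have "locally_integrable_on Cplus w"
    unfolding locally_integrable_on_def
  proof (intro allI impI, elim conjE)
    fix K assume K: "compact K" "K \<subseteq> Cplus"
    have "integrable lborel (\<lambda>z. indicator K z *\<^sub>R w z)"
      by (rule borel_integrable_compact[OF K(1) continuous_on_subset[OF wc K(2)]])
    then show "set_integrable lebesgue K w"
      unfolding set_integrable_def by (rule integrable_lebesgue_of_lborel)
  qed
  moreover have "locally_integrable_on Cplus f"
    unfolding locally_integrable_on_def
  proof (intro allI impI, elim conjE)
    fix K assume K: "compact K" "K \<subseteq> Cplus"
    have "integrable lebesgue (\<lambda>z. indicator K z *\<^sub>R F z)"
      using K by (intro integrable_lebesgue_of_lborel integrable_on_bounded compact_imp_bounded borel_compact)
    moreover have ae: "AE z in lebesgue. indicator K z *\<^sub>R F z = indicator K z *\<^sub>R f z"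
      using F(2) by eventually_elim (use K in \<open>auto simp: indicator_def\<close>)
    ultimately show "set_integrable lebesgue K f"
      unfolding set_integrable_def
      by (intro integrable_cong_AE_imp[OF _ _ ae] borel_measurable_AE[OF _ ae] borel_measurable_integrable)
  qed
  moreover have "(LINT z:Cplus|lebesgue. w z * dbar \<phi> z) = - (LINT z:Cplus|lebesgue. f z * \<phi> z)"
    if \<phi>: "\<phi> \<in> test_functions Cplus" for \<phi>
  proof -
    note c1 = test_functions_C1[OF \<phi>]
    obtain R where R: "\<And>z. norm z > R \<Longrightarrow> \<phi> z = 0" using test_functions_bounded_support[OF \<phi>] by blast
    have d: "(\<integral>z. dbar \<phi> z \<partial>lborel) = 0" "integrable lborel (dbar \<phi>)"
      by (rule integral_dbar_eq_0[OF c1 R]; assumption)+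
    note hi = integral_holomorphic_times_dbar[OF hh open_Cplus \<phi>]
    have Ti: "integrable lborel (\<lambda>z. T z * dbar \<phi> z)"
      "(\<integral>z. T z * dbar \<phi> z \<partial>lborel) = - (\<integral>\<zeta>. F \<zeta> * \<phi> \<zeta> \<partial>lborel)"
      by (rule integral_T_dbar[OF \<phi> F(3)]; assumption)+
    let ?s = "\<lambda>z. indicator Cplus z *\<^sub>R (h z * dbar \<phi> z) + k * dbar \<phi> z + T z * dbar \<phi> z"
    have eq: "indicator Cplus z *\<^sub>R (w z * dbar \<phi> z) = ?s z" for z
      using dbar_eq_0_outside[OF \<phi>, of z] w_eq[of z] by (cases "z \<in> Cplus") (auto simp: algebra_simps)
    have int: "integrable lborel ?s"
      by (intro Bochner_Integration.integrable_add hi Ti integrable_mult_right d)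
    have "(LINT z:Cplus|lebesgue. w z * dbar \<phi> z) = (\<integral>z. ?s z \<partial>lborel)"
      unfolding set_lebesgue_integral_def eq by (rule integral_lebesgue_of_lborel[OF int])
    also have "\<dots> = - (\<integral>\<zeta>. F \<zeta> * \<phi> \<zeta> \<partial>lborel)"
      using hi d Ti by simp
    finally have 1: "(LINT z:Cplus|lebesgue. w z * dbar \<phi> z) = - (\<integral>\<zeta>. F \<zeta> * \<phi> \<zeta> \<partial>lborel)" .
    have [measurable]: "\<phi> \<in> borel_measurable borel"
      by (rule borel_measurable_continuous_onI[OF test_functions_continuous[OF \<phi>]])
    have mF: "(\<lambda>z. F z * \<phi> z) \<in> borel_measurable lborel" by measurable
    have ae: "AE z in lebesgue. F z * \<phi> z = indicator Cplus z *\<^sub>R (f z * \<phi> z)"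
      using F(2) by eventually_elim (use F(3) in \<open>auto simp: indicator_def\<close>)
    have "(LINT z:Cplus|lebesgue. f z * \<phi> z) = (\<integral>z. F z * \<phi> z \<partial>lebesgue)"
      unfolding set_lebesgue_integral_def
      by (rule integral_cong_AE[OF borel_measurable_AE[OF measurable_completion[OF mF] ae] measurable_completion[OF mF]])
         (use ae in \<open>auto elim: eventually_mono\<close>)
    also have "\<dots> = (\<integral>z. F z * \<phi> z \<partial>lborel)" by (rule integral_completion[OF mF])
    finally show ?thesis using 1 by simp
  qed
  ultimately have weak: "weak_dbar_eq Cplus w f" by (simp add: weak_dbar_eq_def)

  have hbv: "has_distr_bv h" by (rule H_tg_has_distr_bv[OF h])
  \<comment> \<open>The limit \<open>a\<close> for h is carried along so that the two boundary
    values can be compared.\<close>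
  have bv: "bv_pairing_exists w \<phi> \<and> (\<exists>a. bv_pairing h \<phi> = a \<and> 
      bv_pairing w \<phi> = a + k * (\<integral>t. \<phi> t \<partial>lborel) + slice_pairing T \<phi> 0)"
    if \<phi>: "\<phi> \<in> test_functions UNIV" for \<phi>
  proof -
    obtain a where a: "(slice_pairing h \<phi> \<longlongrightarrow> a) (at_right 0)"
      using slice_pairing_convergent[OF h \<phi>] by blast
    obtain R where R: "\<And>t. norm t > R \<Longrightarrow> \<phi> t = 0" using test_functions_bounded_support[OF \<phi>] by blast
    have i\<phi>: "integrable lborel \<phi>"
      by (rule integrable_compact_support[where a="-R" and b=R, OF test_functions_continuous[OF \<phi>]])
         (use R in \<open>force simp: abs_if\<close>)
    note ih = integrable_slice[OF hc _ \<phi>]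
    note iT = slice_pairing_continuous_at_0(1)[OF continuous_on_T \<phi>]
    have eq: "w (Complex t s) * \<phi> t = h (Complex t s) * \<phi> t + k * \<phi> t + T (Complex t s) * \<phi> t" if "s > 0" for t s
      using w_eq[of "Complex t s"] that by (simp add: algebra_simps)
    have iw: "integrable lborel (\<lambda>t. w (Complex t s) * \<phi> t)" if "s > 0" for s
      unfolding eq[OF that] by (intro Bochner_Integration.integrable_add ih iT integrable_mult_right i\<phi> that)
    have sw: "(\<integral>t. w (Complex t s) * \<phi> t \<partial>lborel) = slice_pairing h \<phi> s + k * (\<integral>t. \<phi> t \<partial>lborel) + slice_pairing T \<phi> s" if "s > 0" for s
      unfolding eq[OF that] slice_pairing_def using ih[OF that] iT i\<phi> by simp
    have "((\<lambda>s. \<integral>t. w (Complex t s) * \<phi> t \<partial>lborel) \<longlongrightarrow> a + k * (\<integral>t. \<phi> t \<partial>lborel) + slice_pairing T \<phi> 0) (at_right 0)"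
    proof (rule Lim_transform_eventually)
      show "((\<lambda>s. slice_pairing h \<phi> s + k * (\<integral>t. \<phi> t \<partial>lborel) + slice_pairing T \<phi> s)
         \<longlongrightarrow> a + k * (\<integral>t. \<phi> t \<partial>lborel) + slice_pairing T \<phi> 0) (at_right 0)"
        by (intro tendsto_intros a slice_pairing_continuous_at_0(2)[OF continuous_on_T \<phi>])
      show "\<forall>\<^sub>F s in at_right 0. slice_pairing h \<phi> s + k * (\<integral>t. \<phi> t \<partial>lborel) + slice_pairing T \<phi> s = (\<integral>t. w (Complex t s) * \<phi> t \<partial>lborel)"
        using eventually_at_right_less[of 0] by eventually_elim (simp add: sw)
    qed
    from bv_pairingI[OF iw this] bv_pairingI(2)[OF ih, of a] a show ?thesis
      unfolding slice_pairing_def by blast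
  qed
  have "distr_Re (bv_pairing w) \<phi> = distr_Re (bv_pairing h) \<phi>"
    if \<phi>: "\<phi> \<in> test_functions UNIV" for \<phi> :: "real \<Rightarrow> real"
  proof -
    let ?\<phi> = "\<lambda>t. complex_of_real (\<phi> t)"
    \<comment> \<open>T is purely imaginary on the real axis and \<phi> is real.\<close>
    have "Re (slice_pairing T ?\<phi> 0) = 0"
    proof -
      have "Re (slice_pairing T ?\<phi> 0) = (\<integral>t. Re (T (Complex t 0) * ?\<phi> t) \<partial>lborel)"
        unfolding slice_pairing_def
        by (rule integral_Re[symmetric]) (rule slice_pairing_continuous_at_0(1)[OF continuous_on_T test_functions_of_real[OF \<phi>]])
      also have "\<dots> = 0" using Re_T_real by (simp add: complex_of_real_def)
      finally show ?thesis .
    qed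
    moreover have "Re (k * (\<integral>t. ?\<phi> t \<partial>lborel)) = 0" using Re_k by simp
    ultimately show ?thesis
      using bv[OF test_functions_of_real[OF \<phi>]] by (auto simp: distr_Re_def)
  qed
  \<comment> \<open>The contribution Im h(i) is removed by \<open>I\<close>, T contributes nothing,
    and c remains.\<close>
  moreover have "Im (w \<i>) = c" using w_eq[of \<i>] by (simp add: k_def I_eq Im_T_i)
  ultimately have "solves_schwarz f h c w"
    using weak hbv bv by (simp add: solves_schwarz_def has_distr_bv_def)
  moreover have "set_integrable lebesgue Cplus (schwarz_integrand f z)" for z
    by (rule set_integral_schwarz_integrand(1)[OF F(2)]) (rule F(3))
  ultimately show ?thesis
    using bv_pairing_poisson(1)[OF h] bv_pairing_Im_poisson(1)[OF h] w_formula by blast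
qed

end
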